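(* Let $X$ be a metrizable space, let $A\subseteq X$ be a closed subset, let $G$ be an abelian group, and let $(\beta X,\beta A)$ be the pair of Stone–Čech compactifications of $X$ and $A$. Then for every integer $n\ge 0$ there are isomorphisms $$\check{H}_{n}^{f}(\beta X\setminus X,\beta A\setminus A;G)\cong\check{H}_{n}^{\infty}(X,A;G)$$ and $$\hat{H}^{n}_{f}(\beta X\setminus X,\beta A\setminus A;G)\cong\hat{H}^{n}_{\infty}(X,A;G).$$
   Context: Conventions. Normal spaces are $T_1$ (hence Hausdorff). A closed pair $(X,A)$ is a space $X$ with a closed subset $A$; a single space $X$ is identified with the pair $(X,\emptyset)$. For $A$ closed in a metrizable (more generally normal) space $X$, $\beta A$ is identified with the closure of $A$ in $\beta X$, so that $\beta A\setminus A$ is a closed subset of $\beta X\setminus X$. An indexed family $\alpha=\{\alpha_v\}_{v\in(V_\alpha,V_\alpha^A)}$ of subsets of $X$ is a function $v\mapsto\alpha_v$ on an index set $V_\alpha$ together with a distinguished subset $V_\alpha^A\subseteq V_\alpha$; it is finite if $V_\alpha$ is finite. Border covers. A border cover of a closed pair $(X,A)$ with $X$ normal is a finite indexed family $\alpha=\{\alpha_v\}_{v\in(V_\alpha,V_\alpha^A)}$ of open subsets of $X$ for which there is a compact subset $K_\alpha\subseteq X$ with $X\setminus K_\alpha=\bigcup_{v\in V_\alpha}\alpha_v$ and $A\setminus K_\alpha\subseteq\bigcup_{v\in V_\alpha^A}\alpha_v$. The set of border covers is $\mathrm{cov}_\infty(X,A)$. One writes $\alpha\le\beta$ ($\beta$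 refines $\alpha$) if there is a refinement projection, i.e. a function $p:V_\beta\to V_\alpha$ with $p(V_\beta^A)\subseteq V_\alpha^A$ and $\beta_v\subseteq\alpha_{p(v)}$ for all $v\in V_\beta$. This makes $\mathrm{cov}_\infty(X,A)$ a directed set. Border groups. For $\alpha\in\mathrm{cov}_\infty(X,A)$ let $X_\alpha$ be the nerve of $\alpha$: its simplexes are the nonempty finite $s\subseteq V_\alpha$ with carrier $\mathrm{Car}_\alpha(s)=\bigcap_{v\in s}\alpha_v\neq\emptyset$; let $A_\alpha$ be the subcomplex of simplexes $s\subseteq V_\alpha^A$ with $\mathrm{Car}_\alpha(s)\cap A\neq\emptyset$. A refinement projection for $\alpha\le\beta$ induces a simplicial map $(X_\beta,A_\beta)\to(X_\alpha,A_\alpha)$; any two such are contiguous, so there are well-defined homomorphisms $p^\beta_{\alpha*}:H_n(X_\beta,A_\beta;G)\to H_n(X_\alpha,A_\alpha;G)$ and $p^{\beta*}_{\alpha}:H^n(X_\alpha,A_\alpha;G)\to H^n(X_\beta,A_\beta;G)$ on simplicial (co)homology. The Čech border homology and cohomology groups are $\check H_n^\infty(X,A;G)=\varprojlim_{\alpha}H_n(X_\alpha,A_\alpha;G)$ and $\hat H^n_\infty(X,A;G)=\varinjlim_{\alpha}H^n(X_\alpha,A_\alpha;G)$, over $\alpha\in\mathrm{cov}_\infty(X,A)$. Čech groups based on finite open covers. For a closed pair $(Y,B)$, $\check H_n^f(Y,B;G)$ and $\hat H^n_f(Y,B;G)$ are the inverse limit of homology, respectively direct limit of cohomology, of the nerve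 pairs, defined in the same way but over all finite open covers of $(Y,B)$, i.e. finite families $\{\alpha_v\}_{v\in(V_\alpha,V_\alpha^B)}$ of open subsets of $Y$ with $\bigcup_{v\in V_\alpha}\alpha_v=Y$ and $B\subseteq\bigcup_{v\in V_\alpha^B}\alpha_v$. *)

theory Defs
  imports
    "HOL-Analysis.Analysis"
    "HOL-Algebra.FiniteProduct"
    "HOL-Algebra.Product_Groups"
    "HOL-Combinatorics.Permutations"
begin

section \<open>Simplicial homology and cohomology of finite pairs\<close>

text \<open>
  A simplicial complex is given by its set \<open>K\<close> of simplexes, which are nonempty finite sets of
  vertices. All complexes below are finite, so no finite-support condition on chains is needed.

  An \<open>n\<close>-chain of \<open>K\<close> with coefficients in \<open>G\<close> is a \<open>G\<close>-valued function on the oriented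
  \<open>n\<close>-simplexes of \<open>K\<close> that changes sign under reversal of orientation. An oriented simplex is
  represented by any enumeration of its vertices without repetition; the function is extended by
  the neutral element to all other lists. The function \<open>c\<close> corresponds to the formal sum
  \<open>\<Sum> c(\<sigma>) \<sigma>\<close> in which each simplex occurs once, with an arbitrary orientation. For finite \<open>K\<close>
  the same functions are the homomorphisms from the integral oriented \<open>n\<close>-chains to \<open>G\<close>, that is,
  the \<open>n\<close>-cochains. The group operation of \<open>G\<close> is written multiplicatively.
\<close>

definition ordered_simplexes :: "nat \<Rightarrow> 'v set set \<Rightarrow> 'v list set" where
  "ordered_simplexes n K = {\<sigma>. length \<sigma> = Suc n \<and> distinct \<sigma> \<and> set \<sigma> \<in> K}"

definition alternating ::
    "('g, 'm) monoid_scheme \<Rightarrow> nat \<Rightarrow> 'v set set \<Rightarrow> ('v list \<Rightarrow> 'g) set" where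
  "alternating G n K =
     {c. (\<forall>\<sigma>. c \<sigma> \<in> carrier G) \<and>
         (\<forall>\<sigma>. \<sigma> \<notin> ordered_simplexes n K \<longrightarrow> c \<sigma> = \<one>\<^bsub>G\<^esub>) \<and>
         (\<forall>\<sigma>\<in>ordered_simplexes n K. \<forall>\<pi>. \<pi> permutes {..<length \<sigma>} \<longrightarrow>
            c (permute_list \<pi> \<sigma>) = (if evenperm \<pi> then c \<sigma> else inv\<^bsub>G\<^esub> (c \<sigma>)))}"

definition chain_group ::
    "('g, 'm) monoid_scheme \<Rightarrow> nat \<Rightarrow> 'v set set \<Rightarrow> ('v list \<Rightarrow> 'g) monoid" where
  "chain_group G n K =
     \<lparr>carrier = alternating G n K,
      monoid.mult = (\<lambda>c d \<sigma>. c \<sigma> \<otimes>\<^bsub>G\<^esub> d \<sigma>),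
      one = (\<lambda>\<sigma>. \<one>\<^bsub>G\<^esub>)\<rparr>"

text \<open>
  The coefficient of \<open>\<tau>\<close> in the boundary of \<open>c\<close>. An oriented simplex having \<open>\<tau>\<close> as a face is
  \<open>\<plusminus>(v # \<tau>)\<close> for one vertex \<open>v\<close>, and \<open>\<tau>\<close> occurs in the boundary of \<open>v # \<tau>\<close> with sign \<open>+1\<close>. The
  value at the empty list is neutral since there are no chains in degree \<open>-1\<close> (homology is
  unreduced).
\<close>

definition boundary ::
    "('g, 'm) monoid_scheme \<Rightarrow> 'v set set \<Rightarrow> ('v list \<Rightarrow> 'g) \<Rightarrow> 'v list \<Rightarrow> 'g" where
  "boundary G K c \<tau> = (if \<tau> = [] then \<one>\<^bsub>G\<^esub> else finprod G (\<lambda>v. c (v # \<tau>)) (\<Union>K))"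

definition coboundary ::
    "('g, 'm) monoid_scheme \<Rightarrow> nat \<Rightarrow> 'v set set \<Rightarrow> ('v list \<Rightarrow> 'g) \<Rightarrow> 'v list \<Rightarrow> 'g" where
  "coboundary G n K c \<sigma> =
     (if \<sigma> \<in> ordered_simplexes (Suc n) K
      then finprod G (\<lambda>i. let x = c (take i \<sigma> @ drop (Suc i) \<sigma>)
                          in if even i then x else inv\<^bsub>G\<^esub> x) {..Suc n}
      else \<one>\<^bsub>G\<^esub>)"

text \<open>For a subcomplex \<open>L\<close> of \<open>K\<close>, the homology of the quotient of the chains of \<open>K\<close> by those of
  \<open>L\<close> is described by cycles and boundaries modulo chains of \<open>L\<close>.\<close>

definition rel_cycles ::
    "('g, 'm) monoid_scheme \<Rightarrow> nat \<Rightarrow> 'v set set \<Rightarrow> 'v set set \<Rightarrow> ('v list \<Rightarrow> 'g) set" where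
  "rel_cycles G n K L =
     {c \<in> alternating G n K. n = 0 \<or> boundary G K c \<in> alternating G (n - 1) L}"

definition rel_boundaries ::
    "('g, 'm) monoid_scheme \<Rightarrow> nat \<Rightarrow> 'v set set \<Rightarrow> 'v set set \<Rightarrow> ('v list \<Rightarrow> 'g) set" where
  "rel_boundaries G n K L =
     (boundary G K ` alternating G (Suc n) K) <#>\<^bsub>chain_group G n K\<^esub> alternating G n L"

definition simplicial_homology ::
    "('g, 'm) monoid_scheme \<Rightarrow> nat \<Rightarrow> 'v set set \<Rightarrow> 'v set set \<Rightarrow> ('v list \<Rightarrow> 'g) set monoid" where
  "simplicial_homology G n K L =
     (chain_group G n K)\<lparr>carrier := rel_cycles G n K L\<rparr> Mod rel_boundaries G n K L"

definition rel_cochains ::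
    "('g, 'm) monoid_scheme \<Rightarrow> nat \<Rightarrow> 'v set set \<Rightarrow> 'v set set \<Rightarrow> ('v list \<Rightarrow> 'g) set" where
  "rel_cochains G n K L =
     {c \<in> alternating G n K. \<forall>\<sigma>\<in>ordered_simplexes n L. c \<sigma> = \<one>\<^bsub>G\<^esub>}"

definition rel_cocycles ::
    "('g, 'm) monoid_scheme \<Rightarrow> nat \<Rightarrow> 'v set set \<Rightarrow> 'v set set \<Rightarrow> ('v list \<Rightarrow> 'g) set" where
  "rel_cocycles G n K L =
     {c \<in> rel_cochains G n K L. coboundary G n K c = (\<lambda>\<sigma>. \<one>\<^bsub>G\<^esub>)}"

definition rel_coboundaries ::
    "('g, 'm) monoid_scheme \<Rightarrow> nat \<Rightarrow> 'v set set \<Rightarrow> 'v set set \<Rightarrow> ('v list \<Rightarrow> 'g) set" where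
  "rel_coboundaries G n K L =
     (if n = 0 then {\<lambda>\<sigma>. \<one>\<^bsub>G\<^esub>} else coboundary G (n - 1) K ` rel_cochains G (n - 1) K L)"

definition simplicial_cohomology ::
    "('g, 'm) monoid_scheme \<Rightarrow> nat \<Rightarrow> 'v set set \<Rightarrow> 'v set set \<Rightarrow> ('v list \<Rightarrow> 'g) set monoid" where
  "simplicial_cohomology G n K L =
     (chain_group G n K)\<lparr>carrier := rel_cocycles G n K L\<rparr> Mod rel_coboundaries G n K L"

text \<open>
  The maps induced by a vertex map \<open>f\<close>, on chains and cochains. A simplex \<open>\<sigma>\<close> is sent to
  \<open>map f \<sigma>\<close> if this list has no repetition and to the neutral element otherwise; every simplex
  mapped bijectively onto \<open>set \<tau>\<close> has exactly one enumeration \<open>\<sigma>\<close> with \<open>map f \<sigma> = \<tau>\<close>.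
\<close>

definition chain_map ::
    "('g, 'm) monoid_scheme \<Rightarrow> nat \<Rightarrow> 'v set set \<Rightarrow> ('v \<Rightarrow> 'w) \<Rightarrow> ('v list \<Rightarrow> 'g) \<Rightarrow> 'w list \<Rightarrow> 'g"
  where
  "chain_map G n K f c \<tau> =
     (if distinct \<tau> then finprod G c {\<sigma> \<in> ordered_simplexes n K. map f \<sigma> = \<tau>} else \<one>\<^bsub>G\<^esub>)"

definition cochain_map ::
    "('g, 'm) monoid_scheme \<Rightarrow> nat \<Rightarrow> 'v set set \<Rightarrow> ('v \<Rightarrow> 'w) \<Rightarrow> ('w list \<Rightarrow> 'g) \<Rightarrow> 'v list \<Rightarrow> 'g"
  where
  "cochain_map G n K f c \<sigma> = (if \<sigma> \<in> ordered_simplexes n K then c (map f \<sigma>) else \<one>\<^bsub>G\<^esub>)"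

text \<open>On (co)homology classes, which are cosets: the image of a coset, saturated with respect to
  the (co)boundaries of the target. Here \<open>f\<close> is a simplicial map from \<open>(K, L)\<close> to \<open>(K', L')\<close>.\<close>

definition homology_map ::
    "('g, 'm) monoid_scheme \<Rightarrow> nat \<Rightarrow> 'v set set \<Rightarrow> 'w set set \<Rightarrow> 'w set set \<Rightarrow> ('v \<Rightarrow> 'w) \<Rightarrow>
     ('v list \<Rightarrow> 'g) set \<Rightarrow> ('w list \<Rightarrow> 'g) set" where
  "homology_map G n K K' L' f x =
     rel_boundaries G n K' L' <#>\<^bsub>chain_group G n K'\<^esub> (chain_map G n K f ` x)"

definition cohomology_map ::
    "('g, 'm) monoid_scheme \<Rightarrow> nat \<Rightarrow> 'v set set \<Rightarrow> 'v set set \<Rightarrow> ('v \<Rightarrow> 'w) \<Rightarrow>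
     ('w list \<Rightarrow> 'g) set \<Rightarrow> ('v list \<Rightarrow> 'g) set" where
  "cohomology_map G n K L f x =
     rel_coboundaries G n K L <#>\<^bsub>chain_group G n K\<^esub> (cochain_map G n K f ` x)"

section \<open>Inverse and direct limits of groups\<close>

text \<open>
  \<open>I\<close> is directed by the preorder \<open>r\<close>; for \<open>r i j\<close> the transition homomorphism is
  \<open>\<phi> i j : H j \<rightarrow> H i\<close> for inverse systems and \<open>\<phi> i j : H i \<rightarrow> H j\<close> for direct systems.
\<close>

definition inverse_limit ::
    "'i set \<Rightarrow> ('i \<Rightarrow> 'i \<Rightarrow> bool) \<Rightarrow> ('i \<Rightarrow> 'h monoid) \<Rightarrow> ('i \<Rightarrow> 'i \<Rightarrow> 'h \<Rightarrow> 'h) \<Rightarrow> ('i \<Rightarrow> 'h) monoid"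
  where
  "inverse_limit I r H \<phi> =
     (product_group I H)
       \<lparr>carrier := {x \<in> carrier (product_group I H). \<forall>i\<in>I. \<forall>j\<in>I. r i j \<longrightarrow> \<phi> i j (x j) = x i}\<rparr>"

definition direct_limit_rel ::
    "'i set \<Rightarrow> ('i \<Rightarrow> 'i \<Rightarrow> bool) \<Rightarrow> ('i \<Rightarrow> 'h monoid) \<Rightarrow> ('i \<Rightarrow> 'i \<Rightarrow> 'h \<Rightarrow> 'h) \<Rightarrow> ('i \<times> 'h) rel"
  where
  "direct_limit_rel I r H \<phi> =
     {((i, x), (j, y)). i \<in> I \<and> j \<in> I \<and> x \<in> carrier (H i) \<and> y \<in> carrier (H j) \<and>
        (\<exists>k\<in>I. r i k \<and> r j k \<and> \<phi> i k x = \<phi> j k y)}"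

definition direct_limit ::
    "'i set \<Rightarrow> ('i \<Rightarrow> 'i \<Rightarrow> bool) \<Rightarrow> ('i \<Rightarrow> 'h monoid) \<Rightarrow> ('i \<Rightarrow> 'i \<Rightarrow> 'h \<Rightarrow> 'h) \<Rightarrow>
     ('i \<times> 'h) set monoid" where
  "direct_limit I r H \<phi> =
     \<lparr>carrier = (SIGMA i:I. carrier (H i)) // direct_limit_rel I r H \<phi>,
      monoid.mult = (\<lambda>C D. direct_limit_rel I r H \<phi> ``
        {(k, \<phi> i k x \<otimes>\<^bsub>H k\<^esub> \<phi> j k y) | i x j y k.
           (i, x) \<in> C \<and> (j, y) \<in> D \<and> k \<in> I \<and> r i k \<and> r j k}),
      one = direct_limit_rel I r H \<phi> `` {(i, \<one>\<^bsub>H i\<^esub>) | i. i \<in> I}\<rparr>"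

section \<open>Covers, nerves and Cech groups\<close>

text \<open>
  Every finite indexed family can be reindexed by a finite set of natural numbers; using such
  index sets only makes the covers of a space form a set.
\<close>

record 'a family =
  index :: "nat set"
  subindex :: "nat set"
  member :: "nat \<Rightarrow> 'a set"

definition finite_open_family :: "'a topology \<Rightarrow> 'a family \<Rightarrow> bool" where
  "finite_open_family X \<alpha> \<longleftrightarrow>
     finite (index \<alpha>) \<and> subindex \<alpha> \<subseteq> index \<alpha> \<and> member \<alpha> \<in> extensional (index \<alpha>) \<and>
     (\<forall>v\<in>index \<alpha>. openin X (member \<alpha> v))"

definition border_covers :: "'a topology \<Rightarrow> 'a set \<Rightarrow> 'a family set" where
  "border_covers X A =
     {\<alpha>. finite_open_family X \<alpha> \<and>
         (\<exists>K. compactin X K \<and>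
              topspace X - K = (\<Union>v\<in>index \<alpha>. member \<alpha> v) \<and>
              A - K \<subseteq> (\<Union>v\<in>subindex \<alpha>. member \<alpha> v))}"

definition finite_open_covers :: "'a topology \<Rightarrow> 'a set \<Rightarrow> 'a family set" where
  "finite_open_covers Y B =
     {\<alpha>. finite_open_family Y \<alpha> \<and>
         (\<Union>v\<in>index \<alpha>. member \<alpha> v) = topspace Y \<and>
         B \<subseteq> (\<Union>v\<in>subindex \<alpha>. member \<alpha> v)}"

definition refinement_projection :: "'a family \<Rightarrow> 'a family \<Rightarrow> (nat \<Rightarrow> nat) \<Rightarrow> bool" where
  "refinement_projection \<alpha> \<beta> p \<longleftrightarrow>
     p \<in> index \<beta> \<rightarrow> index \<alpha> \<and> p ` subindex \<beta> \<subseteq> subindex \<alpha> \<and>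
     (\<forall>v\<in>index \<beta>. member \<beta> v \<subseteq> member \<alpha> (p v))"

definition refined_by :: "'a family \<Rightarrow> 'a family \<Rightarrow> bool" where
  "refined_by \<alpha> \<beta> \<longleftrightarrow> (\<exists>p. refinement_projection \<alpha> \<beta> p)"

definition family_carrier :: "'a family \<Rightarrow> nat set \<Rightarrow> 'a set" where
  "family_carrier \<alpha> s = (\<Inter>v\<in>s. member \<alpha> v)"

definition nerve :: "'a family \<Rightarrow> nat set set" where
  "nerve \<alpha> = {s. s \<noteq> {} \<and> finite s \<and> s \<subseteq> index \<alpha> \<and> family_carrier \<alpha> s \<noteq> {}}"

definition subnerve :: "'a set \<Rightarrow> 'a family \<Rightarrow> nat set set" where
  "subnerve A \<alpha> = {s. s \<noteq> {} \<and> finite s \<and> s \<subseteq> subindex \<alpha> \<and> family_carrier \<alpha> s \<inter> A \<noteq> {}}"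

text \<open>Any two refinement projections are contiguous, so that the choice of one of them does not
  influence the maps below.\<close>

definition chosen_projection :: "'a family \<Rightarrow> 'a family \<Rightarrow> nat \<Rightarrow> nat" where
  "chosen_projection \<alpha> \<beta> = (SOME p. refinement_projection \<alpha> \<beta> p)"

definition nerve_homology_limit ::
    "('g, 'm) monoid_scheme \<Rightarrow> nat \<Rightarrow> 'a family set \<Rightarrow> 'a set \<Rightarrow>
     ('a family \<Rightarrow> (nat list \<Rightarrow> 'g) set) monoid" where
  "nerve_homology_limit G n \<C> A =
     inverse_limit \<C> refined_by
       (\<lambda>\<alpha>. simplicial_homology G n (nerve \<alpha>) (subnerve A \<alpha>))
       (\<lambda>\<alpha> \<beta>. homology_map G n (nerve \<beta>) (nerve \<alpha>) (subnerve A \<alpha>) (chosen_projection \<alpha> \<beta>))"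

definition nerve_cohomology_limit ::
    "('g, 'm) monoid_scheme \<Rightarrow> nat \<Rightarrow> 'a family set \<Rightarrow> 'a set \<Rightarrow>
     ('a family \<times> (nat list \<Rightarrow> 'g) set) set monoid" where
  "nerve_cohomology_limit G n \<C> A =
     direct_limit \<C> refined_by
       (\<lambda>\<alpha>. simplicial_cohomology G n (nerve \<alpha>) (subnerve A \<alpha>))
       (\<lambda>\<alpha> \<beta>. cohomology_map G n (nerve \<beta>) (subnerve A \<beta>) (chosen_projection \<alpha> \<beta>))"

definition border_homology ::
    "('g, 'm) monoid_scheme \<Rightarrow> nat \<Rightarrow> 'a topology \<Rightarrow> 'a set \<Rightarrow>
     ('a family \<Rightarrow> (nat list \<Rightarrow> 'g) set) monoid" where
  "border_homology G n X A = nerve_homology_limit G n (border_covers X A) A"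

definition border_cohomology ::
    "('g, 'm) monoid_scheme \<Rightarrow> nat \<Rightarrow> 'a topology \<Rightarrow> 'a set \<Rightarrow>
     ('a family \<times> (nat list \<Rightarrow> 'g) set) set monoid" where
  "border_cohomology G n X A = nerve_cohomology_limit G n (border_covers X A) A"

definition finite_cech_homology ::
    "('g, 'm) monoid_scheme \<Rightarrow> nat \<Rightarrow> 'a topology \<Rightarrow> 'a set \<Rightarrow>
     ('a family \<Rightarrow> (nat list \<Rightarrow> 'g) set) monoid" where
  "finite_cech_homology G n Y B = nerve_homology_limit G n (finite_open_covers Y B) B"

definition finite_cech_cohomology ::
    "('g, 'm) monoid_scheme \<Rightarrow> nat \<Rightarrow> 'a topology \<Rightarrow> 'a set \<Rightarrow>
     ('a family \<times> (nat list \<Rightarrow> 'g) set) set monoid" where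
  "finite_cech_cohomology G n Y B = nerve_cohomology_limit G n (finite_open_covers Y B) B"

section \<open>The Stone-Cech compactification\<close>

text \<open>The closure of the image of \<open>X\<close> under the evaluation map into the cube whose coordinates are
  the continuous functions from \<open>X\<close> to the unit interval. For completely regular Hausdorff \<open>X\<close> the
  evaluation map is an embedding
  (\<open>completely_regular_space_cube_embedding_explicit\<close>).\<close>

definition unit_functions :: "'a topology \<Rightarrow> ('a \<Rightarrow> real) set" where
  "unit_functions X =
     {f \<in> extensional (topspace X). continuous_map X (top_of_set {0..1}) f}"

definition unit_cube :: "'a topology \<Rightarrow> (('a \<Rightarrow> real) \<Rightarrow> real) topology" where
  "unit_cube X = product_topology (\<lambda>f. top_of_set {0..1}) (unit_functions X)"

definition stone_cech_map :: "'a topology \<Rightarrow> 'a \<Rightarrow> ('a \<Rightarrow> real) \<Rightarrow> real" where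
  "stone_cech_map X x = (\<lambda>f\<in>unit_functions X. f x)"

definition stone_cech :: "'a topology \<Rightarrow> (('a \<Rightarrow> real) \<Rightarrow> real) topology" where
  "stone_cech X =
     subtopology (unit_cube X) (unit_cube X closure_of (stone_cech_map X ` topspace X))"

text \<open>The remainder of \<open>X\<close>, and the remainder of a closed subset \<open>A\<close> of a normal space \<open>X\<close>, whose
  Stone-Cech compactification is identified with its closure in that of \<open>X\<close>.\<close>

definition remainder :: "'a topology \<Rightarrow> (('a \<Rightarrow> real) \<Rightarrow> real) topology" where
  "remainder X =
     subtopology (stone_cech X) (topspace (stone_cech X) - stone_cech_map X ` topspace X)"

definition remainder_of :: "'a topology \<Rightarrow> 'a set \<Rightarrow> (('a \<Rightarrow> real) \<Rightarrow> real) set" where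
  "remainder_of X A =
     stone_cech X closure_of (stone_cech_map X ` A) - stone_cech_map X ` A"

end

theory Submission
  imports Defs
begin

text \<open>
  Write \<open>Z\<close> for the compactification of \<open>X\<close> and \<open>Ex U = Z - cl (X - U)\<close> for the largest open subset of
  \<open>Z\<close> with trace \<open>U\<close> on \<open>X\<close>. Taking the traces of the sets \<open>Ex \<alpha>\<^sub>v\<close> on the remainder turns a border
  cover of \<open>(X, A)\<close> into a finite open cover of the pair of remainders. The operation \<open>Ex\<close> commutes
  with finite intersections, so nerves are preserved as soon as every nonempty carrier reaches the
  remainder; a carrier that does not has compact closure and can be deleted, so such border covers are
  cofinal. In the other direction, the complement of a compact subset of \<open>X\<close> is normal in \<open>Z\<close>, since
  compact subsets of metrizable spaces have countable neighbourhood bases; shrinking a finite open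
  cover there shows that the image of the border covers is cofinal. Both limits are therefore
  limits of the same system. That its transition maps are well defined rests on contiguity, which is
  only needed for two vertex maps that differ at one vertex: then the chain homotopy is a product
  with two vectors in the exterior algebra of alternating functions.
\<close>

section \<open>Alternating functions as an exterior algebra\<close>

text \<open>The arbitrary choice in \<open>chosen_projection\<close> forces the homological half of
  the proof: a pair of covers and its image in the other system may receive different projections,
  so even equal nerves carry equal transition maps only after passing to homology or cohomology. The
  recursive operators \<open>wedge\<close> and \<open>push\<close> keep the signs of the homotopies
  local to the first entry of a list, so that no sums over permutations appear. The trace on the
  remainder may shrink the nerve of a general border cover, so the two limits are not compared
  directly. The covers in \<open>nonvanishing_covers\<close> map into both systems without change of
  nerve, and each limit is compared with theirs. A set \<open>W\<close> open in the compactification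
  may be smaller than the largest open set with the same trace on \<open>X\<close>. This is why a
  cover of the remainder is shrunk, and why the shrinking takes place off the compact set that the
  cover misses. Beyond the separation axioms, metrizability enters twice: it makes the complement of
  that compact set normal, and it turns the absence of infinite closed discrete subsets into
  compactness.\<close>

text \<open>This is \<open>alternating\<close> without degree and without complex, so that prefixing
  a vertex stays inside the class. The third clause is independent of the second: for equal
  neighbours the second says only that the value is its own inverse, which leaves room for
  2-torsion.\<close>

definition antisym_function :: "('g, 'm) monoid_scheme \<Rightarrow> ('v list \<Rightarrow> 'g) \<Rightarrow> bool" where
  "antisym_function G c \<longleftrightarrow>
     (\<forall>\<sigma>. c \<sigma> \<in> carrier G) \<and>
     (\<forall>xs a b ys. c (xs @ a # b # ys) = inv\<^bsub>G\<^esub> (c (xs @ b # a # ys))) \<and>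
     (\<forall>xs a ys. c (xs @ a # a # ys) = \<one>\<^bsub>G\<^esub>)"

text \<open>Exterior multiplication from the left by the sum of the basis vectors in \<open>S\<close>; prefixing a fixed
  vertex to the argument is contraction by that vertex. For \<open>S = UNIV\<close> this is the coboundary.\<close>

fun wedge :: "('g, 'm) monoid_scheme \<Rightarrow> 'v set \<Rightarrow> ('v list \<Rightarrow> 'g) \<Rightarrow> 'v list \<Rightarrow> 'g" where
  "wedge G S b [] = \<one>\<^bsub>G\<^esub>"
| "wedge G S b (x # \<tau>) =
     (if x \<in> S then b \<tau> else \<one>\<^bsub>G\<^esub>) \<otimes>\<^bsub>G\<^esub> inv\<^bsub>G\<^esub> (wedge G S (\<lambda>\<rho>. b (x # \<rho>)) \<tau>)"

text \<open>Unlike \<open>boundary\<close>, this also augments \<open>0\<close>-chains, with value at the empty list.\<close>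

definition full_boundary :: "('g, 'm) monoid_scheme \<Rightarrow> 'v set \<Rightarrow> ('v list \<Rightarrow> 'g) \<Rightarrow> 'v list \<Rightarrow> 'g" where
  "full_boundary G V c \<tau> = finprod G (\<lambda>v. c (v # \<tau>)) V"

text \<open>Agrees with \<open>chain_map\<close> on alternating functions, where the value at lists with repetition is
  neutral without a case distinction. The recursion makes it commute with the boundary.\<close>

fun push :: "('g, 'm) monoid_scheme \<Rightarrow> 'v set \<Rightarrow> ('v \<Rightarrow> 'w) \<Rightarrow> ('v list \<Rightarrow> 'g) \<Rightarrow> 'w list \<Rightarrow> 'g" where
  "push G V f c [] = c []"
| "push G V f c (x # \<tau>) = finprod G (\<lambda>v. push G V f (\<lambda>\<rho>. c (v # \<rho>)) \<tau>) {v \<in> V. f v = x}"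

section \<open>Signs under adjacent swaps and under all permutations\<close>

lemma antisym_functionI:
  assumes "\<And>\<sigma>. c \<sigma> \<in> carrier G"
    and "\<And>xs a b ys. c (xs @ a # b # ys) = inv\<^bsub>G\<^esub> (c (xs @ b # a # ys))"
    and "\<And>xs a ys. c (xs @ a # a # ys) = \<one>\<^bsub>G\<^esub>"
  shows "antisym_function G c"
  using assms unfolding antisym_function_def by blast

lemma antisym_function_closed: "antisym_function G c \<Longrightarrow> c \<sigma> \<in> carrier G"
  unfolding antisym_function_def by blast

lemma antisym_function_swap:
  "antisym_function G c \<Longrightarrow> c (xs @ a # b # ys) = inv\<^bsub>G\<^esub> (c (xs @ b # a # ys))"
  unfolding antisym_function_def by blast

lemma antisym_function_eq: "antisym_function G c \<Longrightarrow> c (xs @ a # a # ys) = \<one>\<^bsub>G\<^esub>"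
  unfolding antisym_function_def by blast

lemma antisym_function_Cons:
  assumes "antisym_function G c" shows "antisym_function G (\<lambda>\<rho>. c (v # \<rho>))"
proof (rule antisym_functionI)
  show "c (v # \<sigma>) \<in> carrier G" for \<sigma>
    using assms by (rule antisym_function_closed)
  show "c (v # xs @ a # b # ys) = inv\<^bsub>G\<^esub> (c (v # xs @ b # a # ys))" for xs a b ys
    using antisym_function_swap[OF assms, of "v # xs" a b ys] by simp
  show "c (v # xs @ a # a # ys) = \<one>\<^bsub>G\<^esub>" for xs a ys
    using antisym_function_eq[OF assms, of "v # xs" a ys] by simp
qed

lemma antisym_function_map:
  assumes "antisym_function G c" shows "antisym_function G (\<lambda>\<rho>. c (map f \<rho>))"
proof (rule antisym_functionI)
  show "c (map f \<sigma>) \<in> carrier G" for \<sigma>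
    using assms by (rule antisym_function_closed)
  show "c (map f (xs @ a # b # ys)) = inv\<^bsub>G\<^esub> (c (map f (xs @ b # a # ys)))" for xs a b ys
    using antisym_function_swap[OF assms, of "map f xs" "f a" "f b" "map f ys"] by simp
  show "c (map f (xs @ a # a # ys)) = \<one>\<^bsub>G\<^esub>" for xs a ys
    using antisym_function_eq[OF assms, of "map f xs" "f a" "map f ys"] by simp
qed

lemma permute_list_transpose:
  assumes "i < j" "j < length \<sigma>"
  obtains xs a ys b zs where "\<sigma> = xs @ a # ys @ b # zs"
    "permute_list (Transposition.transpose i j) \<sigma> = xs @ b # ys @ a # zs"
proof -
  define xs where "xs = take i \<sigma>"
  define ys where "ys = take (j - Suc i) (drop (Suc i) \<sigma>)"
  define zs where "zs = drop (Suc j) \<sigma>"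
  have 1: "drop (Suc i) \<sigma> = ys @ \<sigma> ! j # zs"
    using assms id_take_nth_drop[of "j - Suc i" "drop (Suc i) \<sigma>"] by (simp add: ys_def zs_def)
  have 2: "\<sigma> = xs @ \<sigma> ! i # ys @ \<sigma> ! j # zs"
    using id_take_nth_drop[of i \<sigma>] assms 1 by (simp add: xs_def)
  have len: "length xs = i" "length ys = j - Suc i"
    using assms by (auto simp: xs_def ys_def)
  have tp: "Transposition.transpose i j permutes {..<length \<sigma>}"
    using assms by (intro permutes_swap_id) auto
  have "permute_list (Transposition.transpose i j) \<sigma> = xs @ \<sigma> ! j # ys @ \<sigma> ! i # zs"
  proof (rule nth_equalityI)
    show "length (permute_list (Transposition.transpose i j) \<sigma>) =
        length (xs @ \<sigma> ! j # ys @ \<sigma> ! i # zs)"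
      using arg_cong[OF 2, of length] by simp
    fix k assume k: "k < length (permute_list (Transposition.transpose i j) \<sigma>)"
    then have k': "k < length \<sigma>" by simp
    consider "k < i" | "k = i" | "i < k" "k < j" | "k = j" | "j < k" by linarith
    then have "\<sigma> ! (Transposition.transpose i j k) = (xs @ \<sigma> ! j # ys @ \<sigma> ! i # zs) ! k"
    proof cases
      case 1
      then show ?thesis using assms by (simp add: nth_append len xs_def)
    next
      case 2
      then show ?thesis using len by (simp add: nth_append)
    next
      case 3
      then have "\<sigma> ! k = (xs @ \<sigma> ! i # ys @ \<sigma> ! j # zs) ! k" using 2 by simp
      with 3 show ?thesis using len
        by (simp add: nth_append nth_Cons split: nat.split)
    next
      case 4
      then show ?thesis using len assms by (auto simp: nth_append nth_Cons split: nat.split)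
    next
      case 5
      then have "\<sigma> ! k = (xs @ \<sigma> ! i # ys @ \<sigma> ! j # zs) ! k" using 2 by simp
      with 5 show ?thesis using len assms
        by (auto simp: nth_append nth_Cons split: nat.split)
    qed
    then show "permute_list (Transposition.transpose i j) \<sigma> ! k =
        (xs @ \<sigma> ! j # ys @ \<sigma> ! i # zs) ! k"
      using permute_list_nth[OF tp k'] by simp
  qed
  with 2 that show ?thesis by blast
qed

lemma permute_list_transpose_adjacent:
  "permute_list (Transposition.transpose (length xs) (Suc (length xs))) (xs @ a # b # ys) =
     xs @ b # a # ys"
proof (rule nth_equalityI)
  fix k
  assume "k < length (permute_list (Transposition.transpose (length xs) (Suc (length xs)))
    (xs @ a # b # ys))"
  then have "k < length (xs @ a # b # ys)" by simp
  moreover have "Transposition.transpose (length xs) (Suc (length xs)) permutes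
      {..<length (xs @ a # b # ys)}"
    by (rule permutes_swap_id) auto
  ultimately have "permute_list (Transposition.transpose (length xs) (Suc (length xs)))
      (xs @ a # b # ys) ! k = (xs @ a # b # ys) ! Transposition.transpose (length xs) (Suc (length xs)) k"
    using permute_list_nth by blast
  also have "\<dots> = (xs @ b # a # ys) ! k"
    by (cases "k < length xs"; cases "k = length xs"; cases "k = Suc (length xs)")
      (auto simp: nth_append nth_Cons split: nat.split)
  finally show "permute_list (Transposition.transpose (length xs) (Suc (length xs)))
      (xs @ a # b # ys) ! k = (xs @ b # a # ys) ! k" .
qed simp

context comm_group
begin

lemma antisym_function_eq_apart:
  assumes "antisym_function G c"
  shows "c (xs @ a # ys @ a # zs) = \<one>"
proof -
  show ?thesis
  proof (induction ys arbitrary: xs)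
    case Nil
    show ?case using antisym_function_eq[OF assms(1)] by simp
  next
    case (Cons y ys)
    have "c (xs @ a # y # ys @ a # zs) = inv (c ((xs @ [y]) @ a # ys @ a # zs))"
      using antisym_function_swap[OF assms(1), of xs a y] by simp
    then show ?case using Cons.IH[of "xs @ [y]"] by simp
  qed
qed

text \<open>One entry moves past a neighbour, the induction hypothesis exchanges the two entries at
  the shorter distance, and the other entry moves past the same neighbour: three sign changes, hence
  one.\<close>

lemma antisym_function_swap_apart:
  assumes "antisym_function G c"
  shows "c (xs @ a # ys @ b # zs) = inv (c (xs @ b # ys @ a # zs))"
proof -
  show ?thesis
  proof (induction ys arbitrary: xs)
    case Nil
    show ?case using antisym_function_swap[OF assms(1), of xs a b] by simp
  next
    case (Cons y ys)
    have "c (xs @ a # y # ys @ b # zs) = inv (c ((xs @ [y]) @ a # ys @ b # zs))"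
      using antisym_function_swap[OF assms(1), of xs a y] by simp
    also have "\<dots> = inv (inv (c (xs @ y # b # ys @ a # zs)))"
      using Cons.IH[of "xs @ [y]"] by simp
    also have "\<dots> = inv (c (xs @ b # y # ys @ a # zs))"
      using antisym_function_swap[OF assms(1), of xs y b] antisym_function_closed[OF assms(1)]
      by simp
    finally show ?case by simp
  qed
qed

lemma antisym_function_not_distinct:
  assumes "antisym_function G c" "\<not> distinct \<sigma>"
  shows "c \<sigma> = \<one>"
proof -
  obtain xs ys zs a where "\<sigma> = xs @ [a] @ ys @ [a] @ zs"
    using not_distinct_decomp[OF assms(2)] by blast
  then show ?thesis using antisym_function_eq_apart[OF assms(1)] by simp
qed

text \<open>Transpositions generate all permutations, and each of them is an odd number of adjacent
  swaps. Adjacent swaps are the form that recursion on lists can preserve; the form with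
  permutations is accessed only through this equivalence.\<close>

lemma alternating_iff_antisym:
  fixes c :: "'v list \<Rightarrow> 'a"
  shows "c \<in> alternating G n K \<longleftrightarrow>
     antisym_function G c \<and> (\<forall>\<sigma>. \<sigma> \<notin> ordered_simplexes n K \<longrightarrow> c \<sigma> = \<one>)"
proof
  assume c: "c \<in> alternating G n K"
  then have cl: "c \<sigma> \<in> carrier G" and out: "\<sigma> \<notin> ordered_simplexes n K \<Longrightarrow> c \<sigma> = \<one>" for \<sigma>
    by (auto simp: alternating_def)
  have "antisym_function G c"
  proof (rule antisym_functionI[OF cl])
    show "c (xs @ a # a # ys) = \<one>" for xs a ys
      by (rule out) (simp add: ordered_simplexes_def)
    fix xs ys :: "'v list" and a b
    define \<sigma> where "\<sigma> = xs @ a # b # ys"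
    define \<tau> where "\<tau> = xs @ b # a # ys"
    have iff: "\<sigma> \<in> ordered_simplexes n K \<longleftrightarrow> \<tau> \<in> ordered_simplexes n K"
      by (auto simp: ordered_simplexes_def \<sigma>_def \<tau>_def insert_commute)
    show "c \<sigma> = inv c \<tau>"
    proof (cases "\<sigma> \<in> ordered_simplexes n K")
      case False
      then show ?thesis using iff out by simp
    next
      case True
      let ?\<pi> = "Transposition.transpose (length xs) (Suc (length xs))"
      have \<pi>: "?\<pi> permutes {..<length \<tau>}"
        by (rule permutes_swap_id) (auto simp: \<tau>_def)
      have "permute_list ?\<pi> \<tau> = \<sigma>"
        unfolding \<tau>_def \<sigma>_def by (rule permute_list_transpose_adjacent)
      moreover have "c (permute_list ?\<pi> \<tau>) = inv c \<tau>"
        using c True iff \<pi> unfolding alternating_def by (auto simp: evenperm_swap)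
      ultimately show ?thesis by simp
    qed
  qed
  then show "antisym_function G c \<and> (\<forall>\<sigma>. \<sigma> \<notin> ordered_simplexes n K \<longrightarrow> c \<sigma> = \<one>)"
    using out by blast
next
  assume *: "antisym_function G c \<and> (\<forall>\<sigma>. \<sigma> \<notin> ordered_simplexes n K \<longrightarrow> c \<sigma> = \<one>)"
  then have a: "antisym_function G c" by blast
  note cl = antisym_function_closed[OF a]
  have "c (permute_list \<pi> \<sigma>) = (if evenperm \<pi> then c \<sigma> else inv (c \<sigma>))"
    if "\<pi> permutes {..<length \<sigma>}" for \<pi> \<sigma>
    using finite_lessThan that
  proof (induction rule: permutes_rev_induct)
    case id
    show ?case by simp
  next
    case (swap i j \<pi>)
    let ?t = "Transposition.transpose i j"
    \<comment> \<open>Stated for an arbitrary list, since the new transposition acts on the list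
      already permuted by \<open>\<pi>\<close>.\<close>
    have sw: "c (permute_list (Transposition.transpose k l) \<rho>) = inv (c \<rho>)"
      if "k < l" "l < length \<rho>" for k l \<rho>
      using permute_list_transpose[OF that] antisym_function_swap_apart[OF a]
      by metis
    have "?t permutes {..<length \<sigma>}" using swap by (intro permutes_swap_id) auto
    then have "c (permute_list (\<pi> \<circ> ?t) \<sigma>) = c (permute_list ?t (permute_list \<pi> \<sigma>))"
      by (simp add: permute_list_compose)
    also have "\<dots> = inv (c (permute_list \<pi> \<sigma>))"
    proof (cases "i < j")
      case True then show ?thesis using swap by (intro sw) auto
    next
      case False
      then show ?thesis using swap sw[of j i "permute_list \<pi> \<sigma>"] 
        by (simp add: transpose_commute)
    qed
    finally have *: "c (permute_list (\<pi> \<circ> ?t) \<sigma>) = inv (c (permute_list \<pi> \<sigma>))" .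
    have **: "evenperm (\<pi> \<circ> ?t) \<longleftrightarrow> \<not> evenperm \<pi>"
      using swap by (subst evenperm_comp)
        (auto simp: evenperm_swap permutation_swap_id intro: permutation_permutes[THEN iffD2])
    show ?case unfolding * ** using swap.IH cl by simp
  qed
  with * show "c \<in> alternating G n K"
    unfolding alternating_def using cl by auto
qed

section \<open>Finite products in an abelian group\<close>

lemma finprod_swap:
  assumes "finite A" "finite B" "\<And>a b. a \<in> A \<Longrightarrow> b \<in> B \<Longrightarrow> f a b \<in> carrier G"
  shows "finprod G (\<lambda>a. finprod G (f a) B) A = finprod G (\<lambda>b. finprod G (\<lambda>a. f a b) A) B"
  using assms(1,3)
proof (induction A rule: finite_induct)
  case empty
  then show ?case using assms(2) by (simp add: finprod_one_eqI)
next
  case (insert a A)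
  have "finprod G (\<lambda>a. finprod G (f a) B) (insert a A) =
      finprod G (f a) B \<otimes> finprod G (\<lambda>b. finprod G (\<lambda>a. f a b) A) B"
    using insert by (subst finprod_insert) (auto intro!: finprod_closed)
  also have "\<dots> = finprod G (\<lambda>b. f a b \<otimes> finprod G (\<lambda>a. f a b) A) B"
    using insert by (subst finprod_multf) (auto intro!: finprod_closed)
  also have "\<dots> = finprod G (\<lambda>b. finprod G (\<lambda>a. f a b) (insert a A)) B"
    using insert by (intro finprod_cong') (auto intro!: finprod_closed)
  finally show ?case .
qed

lemma finprod_inv:
  assumes "\<And>a. a \<in> A \<Longrightarrow> f a \<in> carrier G"
  shows "finprod G (\<lambda>a. inv (f a)) A = inv (finprod G f A)"
\<comment> \<open>For infinite \<open>A\<close> both products take the default value, which is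
  neutral.\<close>
proof (cases "finite A")
  case True
  then show ?thesis using assms
    by (induction A rule: finite_induct) (auto simp: inv_mult intro!: finprod_closed)
qed simp

text \<open>Pairing off the terms does not need that \<open>G\<close> has no 2-torsion, since the diagonal is neutral.\<close>

lemma finprod_antisym:
  assumes "finite A" "\<And>a b. a \<in> A \<Longrightarrow> b \<in> A \<Longrightarrow> f a b \<in> carrier G"
    and "\<And>a b. a \<in> A \<Longrightarrow> b \<in> A \<Longrightarrow> f a b = inv (f b a)" "\<And>a. a \<in> A \<Longrightarrow> f a a = \<one>"
  shows "finprod G (\<lambda>a. finprod G (f a) A) A = \<one>"
  using assms
proof (induction A rule: finite_induct)
  case empty
  show ?case by simp
next
  case (insert a A)
  have fcl: "f b b' \<in> carrier G" if "b \<in> insert a A" "b' \<in> insert a A" for b b'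
    using insert.prems(1) that by blast
  have IH: "finprod G (\<lambda>b. finprod G (f b) A) A = \<one>"
    using insert.prems by (intro insert.IH) blast+
  have fa: "finite A" "a \<notin> A" using insert.hyps by auto
  have cl: "finprod G (\<lambda>b. f b a) A \<in> carrier G" "finprod G (f a) A \<in> carrier G"
    "\<And>b. b \<in> A \<Longrightarrow> finprod G (f b) A \<in> carrier G"
    using fcl by (auto intro!: finprod_closed)
  \<comment> \<open>Row \<open>a\<close> is the inverse of column \<open>a\<close>, so the terms
    added by the new index cancel; the corner \<open>f a a\<close> is neutral.\<close>
  have "finprod G (f a) A = finprod G (\<lambda>b. inv (f b a)) A"
  proof (rule finprod_cong')
    show "f a b = inv (f b a)" if "b \<in> A" for b
      using insert.prems(2)[of a b] that by simp
  qed (use fcl in auto)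
  also have "\<dots> = inv (finprod G (\<lambda>b. f b a) A)"
    using fcl by (intro finprod_inv) auto
  finally have 1: "finprod G (f a) A = inv (finprod G (\<lambda>b. f b a) A)" .
  have "finprod G (\<lambda>b. finprod G (f b) (insert a A)) A =
      finprod G (\<lambda>b. f b a \<otimes> finprod G (f b) A) A"
    using fa fcl cl by (intro finprod_cong') (auto intro!: finprod_closed)
  also have "\<dots> = finprod G (\<lambda>b. f b a) A \<otimes> finprod G (\<lambda>b. finprod G (f b) A) A"
    using fcl cl by (intro finprod_multf) auto
  finally have 2: "finprod G (\<lambda>b. finprod G (f b) (insert a A)) A = finprod G (\<lambda>b. f b a) A"
    using cl IH by simp
  have "finprod G (f a) (insert a A) = f a a \<otimes> finprod G (f a) A"
    using fa fcl by (intro finprod_insert) auto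
  then have 3: "finprod G (f a) (insert a A) = finprod G (f a) A"
    using insert.prems(3)[of a] cl by simp
  have "finprod G (\<lambda>b. finprod G (f b) (insert a A)) (insert a A) =
      finprod G (f a) (insert a A) \<otimes> finprod G (\<lambda>b. finprod G (f b) (insert a A)) A"
    using fa fcl by (intro finprod_insert) (auto intro!: finprod_closed)
  then show ?case using 1 2 3 cl by simp
qed

section \<open>Exterior multiplication\<close>

lemma wedge_closed:
  "(\<And>\<sigma>. b \<sigma> \<in> carrier G) \<Longrightarrow> wedge G S b \<tau> \<in> carrier G"
  by (induction \<tau> arbitrary: b) auto

lemma wedge_mult:
  assumes "\<And>\<sigma>. b \<sigma> \<in> carrier G" "\<And>\<sigma>. b' \<sigma> \<in> carrier G"
  shows "wedge G S (\<lambda>\<rho>. b \<rho> \<otimes> b' \<rho>) \<tau> = wedge G S b \<tau> \<otimes> wedge G S b' \<tau>"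
  using assms
proof (induction \<tau> arbitrary: b b')
  case (Cons x \<tau>)
  have "wedge G S (\<lambda>\<rho>. b (x # \<rho>) \<otimes> b' (x # \<rho>)) \<tau> =
      wedge G S (\<lambda>\<rho>. b (x # \<rho>)) \<tau> \<otimes> wedge G S (\<lambda>\<rho>. b' (x # \<rho>)) \<tau>"
    using Cons.prems by (intro Cons.IH)
  moreover have "wedge G S (\<lambda>\<rho>. b (x # \<rho>)) \<tau> \<in> carrier G"
    "wedge G S (\<lambda>\<rho>. b' (x # \<rho>)) \<tau> \<in> carrier G"
    using Cons.prems by (auto intro: wedge_closed)
  ultimately show ?case using Cons.prems[of \<tau>] by (simp add: inv_mult m_ac)
qed simp

lemma wedge_one [simp]: "wedge G S (\<lambda>\<rho>. \<one>) \<tau> = \<one>"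
  by (induction \<tau>) auto

lemma wedge_inv:
  assumes "\<And>\<sigma>. b \<sigma> \<in> carrier G"
  shows "wedge G S (\<lambda>\<rho>. inv (b \<rho>)) \<tau> = inv (wedge G S b \<tau>)"
  using assms
proof (induction \<tau> arbitrary: b)
  case (Cons x \<tau>)
  have "wedge G S (\<lambda>\<rho>. inv (b (x # \<rho>))) \<tau> = inv (wedge G S (\<lambda>\<rho>. b (x # \<rho>)) \<tau>)"
    using Cons.prems by (intro Cons.IH)
  moreover have "wedge G S (\<lambda>\<rho>. b (x # \<rho>)) \<tau> \<in> carrier G"
    using Cons.prems by (intro wedge_closed)
  ultimately show ?case using Cons.prems[of \<tau>] by (simp add: inv_mult)
qed simp

lemma wedge_finprod:
  assumes "finite A" "\<And>a \<sigma>. a \<in> A \<Longrightarrow> b a \<sigma> \<in> carrier G"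
  shows "wedge G S (\<lambda>\<rho>. finprod G (\<lambda>a. b a \<rho>) A) \<tau> = finprod G (\<lambda>a. wedge G S (b a) \<tau>) A"
  using assms
proof (induction A rule: finite_induct)
  case (insert a A)
  have "(\<lambda>\<rho>. finprod G (\<lambda>a. b a \<rho>) (insert a A)) = (\<lambda>\<rho>. b a \<rho> \<otimes> finprod G (\<lambda>a. b a \<rho>) A)"
    using insert by (intro ext finprod_insert) auto
  then show ?case using insert by (simp add: wedge_mult wedge_closed Pi_def)
qed simp

text \<open>The value at \<open>\<sigma>\<close> is an alternating sum over the positions whose
  entry lies in \<open>S\<close>, each reading \<open>b\<close> at the list with that entry removed.
  Changing \<open>b\<close> away from these faces is therefore harmless.\<close>

lemma wedge_cong:
  assumes "\<And>i. i < length \<sigma> \<Longrightarrow> \<sigma> ! i \<in> S \<Longrightarrow>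
      b (take i \<sigma> @ drop (Suc i) \<sigma>) = b' (take i \<sigma> @ drop (Suc i) \<sigma>)"
  shows "wedge G S b \<sigma> = wedge G S b' \<sigma>"
  using assms
proof (induction \<sigma> arbitrary: b b')
  case (Cons x \<sigma>)
  have "wedge G S (\<lambda>\<rho>. b (x # \<rho>)) \<sigma> = wedge G S (\<lambda>\<rho>. b' (x # \<rho>)) \<sigma>"
  proof (rule Cons.IH)
    fix i assume "i < length \<sigma>" "\<sigma> ! i \<in> S"
    then show "b (x # take i \<sigma> @ drop (Suc i) \<sigma>) = b' (x # take i \<sigma> @ drop (Suc i) \<sigma>)"
      using Cons.prems[of "Suc i"] by simp
  qed
  moreover have "x \<in> S \<Longrightarrow> b \<sigma> = b' \<sigma>" using Cons.prems[of 0] by simp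
  ultimately show ?case by simp
qed simp

lemma wedge_eq_one:
  assumes "\<And>i. i < length \<sigma> \<Longrightarrow> \<sigma> ! i \<in> S \<Longrightarrow> b (take i \<sigma> @ drop (Suc i) \<sigma>) = \<one>"
  shows "wedge G S b \<sigma> = \<one>"
  using wedge_cong[of \<sigma> S b "\<lambda>_. \<one>"] assms by simp

lemma wedge_UNIV_map: "wedge G UNIV (\<lambda>\<rho>. c (map f \<rho>)) \<sigma> = wedge G UNIV c (map f \<sigma>)"
proof (induction \<sigma> arbitrary: c)
  case (Cons x \<sigma>)
  show ?case using Cons.IH[of "\<lambda>\<rho>. c (f x # \<rho>)"] by simp
qed simp

text \<open>After two steps of the recursion the value at \<open>x # y # ys\<close> consists of a
  term omitting \<open>x\<close>, a term omitting \<open>y\<close> with opposite sign, and a term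
  that contracts \<open>b\<close> by both. Exchanging \<open>x\<close> and \<open>y\<close> swaps
  the first two up to sign and reverses the third by antisymmetry of \<open>b\<close>.\<close>

lemma antisym_function_wedge:
  assumes "antisym_function G b"
  shows "antisym_function G (wedge G S b)"
proof (rule antisym_functionI)
  show "wedge G S b \<sigma> \<in> carrier G" for \<sigma>
    using assms antisym_function_closed wedge_closed by metis
  show "wedge G S b (xs @ x # y # ys) = inv (wedge G S b (xs @ y # x # ys))" for xs x y ys
    using assms
  proof (induction xs arbitrary: b)
    case Nil
    note cl = antisym_function_closed[OF Nil]
    have "wedge G S (\<lambda>\<rho>. b (x # y # \<rho>)) ys = inv (wedge G S (\<lambda>\<rho>. b (y # x # \<rho>)) ys)"
      using antisym_function_swap[OF Nil, of "[]" x y] cl by (simp add: wedge_inv)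
    then show ?case using cl by (auto simp: wedge_closed inv_mult m_ac)
  next
    case (Cons z xs)
    have "wedge G S (\<lambda>\<rho>. b (z # \<rho>)) (xs @ x # y # ys) =
        inv (wedge G S (\<lambda>\<rho>. b (z # \<rho>)) (xs @ y # x # ys))"
      using Cons.IH[OF antisym_function_Cons[OF Cons.prems]] .
    moreover have "b (xs @ x # y # ys) = inv (b (xs @ y # x # ys))"
      using antisym_function_swap[OF Cons.prems] .
    ultimately show ?case using antisym_function_closed[OF Cons.prems]
      by (auto simp: wedge_closed inv_mult)
  qed
  show "wedge G S b (xs @ x # x # ys) = \<one>" for xs x ys
    using assms
  proof (induction xs arbitrary: b)
    case Nil
    note cl = antisym_function_closed[OF Nil]
    have "(\<lambda>\<rho>. b (x # x # \<rho>)) = (\<lambda>\<rho>. \<one>)"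
      using antisym_function_eq[OF Nil, of "[]" x] by auto
    then show ?case using cl by auto
  next
    case (Cons z xs)
    have "wedge G S (\<lambda>\<rho>. b (z # \<rho>)) (xs @ x # x # ys) = \<one>"
      using Cons.IH[OF antisym_function_Cons[OF Cons.prems]] .
    moreover have "b (xs @ x # x # ys) = \<one>"
      using antisym_function_eq[OF Cons.prems] .
    ultimately show ?case by auto
  qed
qed

text \<open>Left multiplications by two vectors of an exterior algebra anticommute. Contracting by
  the head of the list gives one single term for each factor, with opposite signs in the two orders,
  and a double term covered by the induction hypothesis.\<close>

lemma wedge_anticommute:
  assumes "\<And>\<sigma>. b \<sigma> \<in> carrier G"
  shows "wedge G S (wedge G T b) \<tau> = inv (wedge G T (wedge G S b) \<tau>)"
  using assms
proof (induction \<tau> arbitrary: b)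
  case (Cons x \<tau>)
  \<comment> \<open>\<open>A\<close> and \<open>B\<close> stay free so that the same expansion
    serves both orders of \<open>S\<close> and \<open>T\<close>.\<close>
  have *: "wedge G A (\<lambda>\<rho>. wedge G B b (x # \<rho>)) \<tau> =
     (if x \<in> B then wedge G A b \<tau> else \<one>) \<otimes> inv (wedge G A (wedge G B (\<lambda>\<rho>. b (x # \<rho>))) \<tau>)" for A B
  proof -
    have "wedge G A (\<lambda>\<rho>. wedge G B b (x # \<rho>)) \<tau> =
      wedge G A (\<lambda>\<rho>. if x \<in> B then b \<rho> else \<one>) \<tau> \<otimes>
      wedge G A (\<lambda>\<rho>. inv (wedge G B (\<lambda>\<rho>. b (x # \<rho>)) \<rho>)) \<tau>"
      using Cons.prems by (subst wedge_mult[symmetric]) (auto simp: wedge_closed)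
    then show ?thesis using Cons.prems by (auto simp: wedge_inv wedge_closed)
  qed
  have IH: "wedge G S (wedge G T (\<lambda>\<rho>. b (x # \<rho>))) \<tau> =
      inv (wedge G T (wedge G S (\<lambda>\<rho>. b (x # \<rho>))) \<tau>)"
    using Cons.prems by (intro Cons.IH)
  note [simp del] = wedge.simps(2)
  show ?case
    unfolding wedge.simps(2)[of G S "wedge G T b"] wedge.simps(2)[of G T "wedge G S b"] * IH
    using Cons.prems by (auto simp: wedge_closed inv_mult m_ac)
qed simp

text \<open>Each step of the recursion inverts the tail, which matches the change of parity when
  positions are shifted by one.\<close>

lemma wedge_UNIV_finprod:
  assumes "\<And>\<sigma>. c \<sigma> \<in> carrier G"
  shows "wedge G UNIV c \<sigma> = finprod G (\<lambda>i. let x = c (take i \<sigma> @ drop (Suc i) \<sigma>)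
                          in if even i then x else inv x) {..<length \<sigma>}"
  using assms
proof (induction \<sigma> arbitrary: c)
  case (Cons x \<sigma>)
  let ?t = "\<lambda>c \<sigma> i. let x = c (take i \<sigma> @ drop (Suc i) \<sigma>) in if even i then x else inv x"
  have cl: "?t c \<rho> i \<in> carrier G" for \<rho> i using Cons.prems by (simp add: Let_def)
  have "finprod G (?t c (x # \<sigma>)) {..<length (x # \<sigma>)} =
      finprod G (?t c (x # \<sigma>)) (insert 0 (Suc ` {..<length \<sigma>}))"
    by (simp add: lessThan_Suc_eq_insert_0)
  also have "\<dots> = c \<sigma> \<otimes> finprod G (?t c (x # \<sigma>)) (Suc ` {..<length \<sigma>})"
    using cl Cons.prems by (subst finprod_insert) (auto simp: Let_def)
  also have "finprod G (?t c (x # \<sigma>)) (Suc ` {..<length \<sigma>}) =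
      finprod G (\<lambda>i. ?t c (x # \<sigma>) (Suc i)) {..<length \<sigma>}"
    by (intro finprod_reindex) (use Cons.prems in \<open>auto simp: Let_def\<close>)
  also have "\<dots> = finprod G (\<lambda>i. inv (?t (\<lambda>\<rho>. c (x # \<rho>)) \<sigma> i)) {..<length \<sigma>}"
    using Cons.prems by (intro finprod_cong') (auto simp: Let_def)
  also have "\<dots> = inv (wedge G UNIV (\<lambda>\<rho>. c (x # \<rho>)) \<sigma>)"
    using Cons by (subst finprod_inv) (auto simp: Let_def)
  finally show ?case by simp
qed simp

lemma coboundary_eq_wedge:
  assumes "\<And>\<sigma>. c \<sigma> \<in> carrier G"
  shows "coboundary G n K c \<sigma> =
    (if \<sigma> \<in> ordered_simplexes (Suc n) K then wedge G UNIV c \<sigma> else \<one>)"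
  using assms unfolding coboundary_def wedge_UNIV_finprod[OF assms]
  by (auto simp: ordered_simplexes_def lessThan_Suc_atMost)

section \<open>Contraction by the sum of all vertices\<close>

lemma full_boundary_closed:
  "(\<And>\<sigma>. c \<sigma> \<in> carrier G) \<Longrightarrow> full_boundary G V c \<tau> \<in> carrier G"
  unfolding full_boundary_def by (intro finprod_closed) auto

lemma antisym_function_finprod:
  assumes "\<And>v. v \<in> V \<Longrightarrow> antisym_function G (c v)"
  shows "antisym_function G (\<lambda>\<rho>. finprod G (\<lambda>v. c v \<rho>) V)"
proof (rule antisym_functionI)
  have cl: "c v \<rho> \<in> carrier G" if "v \<in> V" for v \<rho>
    using assms[OF that] antisym_function_closed by metis
  show "finprod G (\<lambda>v. c v \<sigma>) V \<in> carrier G" for \<sigma>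
    using cl by (intro finprod_closed) auto
  show "finprod G (\<lambda>v. c v (xs @ a # b # ys)) V = inv (finprod G (\<lambda>v. c v (xs @ b # a # ys)) V)"
    for xs a b ys
  proof -
    have "finprod G (\<lambda>v. c v (xs @ a # b # ys)) V = finprod G (\<lambda>v. inv (c v (xs @ b # a # ys))) V"
    proof (rule finprod_cong')
      show "c v (xs @ a # b # ys) = inv (c v (xs @ b # a # ys))" if "v \<in> V" for v
        using antisym_function_swap[OF assms[OF that]] .
    qed (use cl in auto)
    also have "\<dots> = inv (finprod G (\<lambda>v. c v (xs @ b # a # ys)) V)"
      using cl by (intro finprod_inv)
    finally show ?thesis .
  qed
  show "finprod G (\<lambda>v. c v (xs @ a # a # ys)) V = \<one>" for xs a ys
    by (rule finprod_one_eqI) (rule antisym_function_eq[OF assms])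
qed

lemma antisym_function_full_boundary:
  "antisym_function G c \<Longrightarrow> antisym_function G (full_boundary G V c)"
  unfolding full_boundary_def
  by (intro antisym_function_finprod antisym_function_Cons)

lemma antisym_Cons_Cons:
  assumes "antisym_function G c"
  shows "c (u # v # \<rho>) = inv (c (v # u # \<rho>))"
  using antisym_function_swap[OF assms, of "[]" u v \<rho>] by simp

text \<open>Contractions anticommute: moving \<open>u\<close> to the front past the summation vertex
  costs one sign.\<close>

lemma full_boundary_Cons:
  assumes "antisym_function G c"
  shows "full_boundary G V c (u # \<tau>) = inv (full_boundary G V (\<lambda>\<rho>. c (u # \<rho>)) \<tau>)"
proof -
  have "finprod G (\<lambda>v. c (v # u # \<tau>)) V = finprod G (\<lambda>v. inv (c (u # v # \<tau>))) V"
    by (intro finprod_cong' antisym_Cons_Cons[OF assms] refl)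
      (auto intro!: antisym_function_closed[OF assms])
  then show ?thesis
    using antisym_function_closed[OF assms] by (simp add: full_boundary_def finprod_inv)
qed

text \<open>In the exterior algebra, contraction with the sum of all basis vectors is a derivation.\<close>

lemma full_boundary_wedge:
  assumes "antisym_function G b" "finite V" "y \<in> V"
  shows "full_boundary G V (wedge G {y} b) \<tau> =
     b \<tau> \<otimes> inv (wedge G {y} (full_boundary G V b) \<tau>)"
proof -
  note cl = antisym_function_closed[OF assms(1)]
  have "full_boundary G V (wedge G {y} b) \<tau> =
      finprod G (\<lambda>v. if v \<in> {y} then b \<tau> else \<one>) V \<otimes>
      finprod G (\<lambda>v. inv (wedge G {y} (\<lambda>\<rho>. b (v # \<rho>)) \<tau>)) V"
    unfolding full_boundary_def wedge.simps
    using cl by (intro finprod_multf) (auto intro: wedge_closed)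
  \<comment> \<open>Among the vertices of \<open>V\<close> only \<open>y\<close> contributes; this
    is where \<open>y \<in> V\<close> enters.\<close>
  also have "finprod G (\<lambda>v. if v \<in> {y} then b \<tau> else \<one>) V = b \<tau>"
    using finprod_singleton[OF assms(3,2), of "\<lambda>_. b \<tau>"] cl by (simp add: eq_commute)
  also have "finprod G (\<lambda>v. inv (wedge G {y} (\<lambda>\<rho>. b (v # \<rho>)) \<tau>)) V =
      inv (wedge G {y} (full_boundary G V b) \<tau>)"
    unfolding full_boundary_def
    using assms(2) cl by (subst finprod_inv) (auto simp: wedge_finprod intro: wedge_closed)
  finally show ?thesis .
qed

section \<open>Push-forward along a vertex map\<close>

lemma push_closed:
  "(\<And>\<sigma>. c \<sigma> \<in> carrier G) \<Longrightarrow> push G V f c \<tau> \<in> carrier G"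
  by (induction \<tau> arbitrary: c) (auto intro!: finprod_closed)

lemma push_one [simp]: "push G V f (\<lambda>\<rho>. \<one>) \<tau> = \<one>"
  by (induction \<tau>) auto

lemma push_mult:
  assumes "\<And>\<sigma>. b \<sigma> \<in> carrier G" "\<And>\<sigma>. b' \<sigma> \<in> carrier G"
  shows "push G V f (\<lambda>\<rho>. b \<rho> \<otimes> b' \<rho>) \<tau> = push G V f b \<tau> \<otimes> push G V f b' \<tau>"
  using assms
proof (induction \<tau> arbitrary: b b')
  case (Cons x \<tau>)
  have "push G V f (\<lambda>\<rho>. b (v # \<rho>) \<otimes> b' (v # \<rho>)) \<tau> =
      push G V f (\<lambda>\<rho>. b (v # \<rho>)) \<tau> \<otimes> push G V f (\<lambda>\<rho>. b' (v # \<rho>)) \<tau>" for v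
    using Cons.prems by (intro Cons.IH)
  moreover have "finprod G (\<lambda>v. push G V f (\<lambda>\<rho>. b (v # \<rho>)) \<tau> \<otimes> push G V f (\<lambda>\<rho>. b' (v # \<rho>)) \<tau>)
      {v \<in> V. f v = x} = finprod G (\<lambda>v. push G V f (\<lambda>\<rho>. b (v # \<rho>)) \<tau>) {v \<in> V. f v = x} \<otimes>
      finprod G (\<lambda>v. push G V f (\<lambda>\<rho>. b' (v # \<rho>)) \<tau>) {v \<in> V. f v = x}"
    using Cons.prems by (intro finprod_multf) (auto intro!: push_closed)
  ultimately show ?case by simp
qed simp

lemma push_inv:
  assumes "\<And>\<sigma>. b \<sigma> \<in> carrier G"
  shows "push G V f (\<lambda>\<rho>. inv (b \<rho>)) \<tau> = inv (push G V f b \<tau>)"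
proof (rule sym, rule inv_equality)
  show "push G V f (\<lambda>\<rho>. inv (b \<rho>)) \<tau> \<otimes> push G V f b \<tau> = \<one>"
    using assms by (subst push_mult[symmetric]) auto
qed (use assms in \<open>auto intro!: push_closed\<close>)

lemma push_finprod:
  assumes "finite A" "\<And>a \<sigma>. a \<in> A \<Longrightarrow> b a \<sigma> \<in> carrier G"
  shows "push G V f (\<lambda>\<rho>. finprod G (\<lambda>a. b a \<rho>) A) \<tau> = finprod G (\<lambda>a. push G V f (b a) \<tau>) A"
  using assms
proof (induction A rule: finite_induct)
  case (insert a A)
  have "(\<lambda>\<rho>. finprod G (\<lambda>a. b a \<rho>) (insert a A)) = (\<lambda>\<rho>. b a \<rho> \<otimes> finprod G (\<lambda>a. b a \<rho>) A)"
    using insert by (intro ext finprod_insert) auto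
  then show ?case using insert by (simp add: push_mult push_closed Pi_def)
qed simp

text \<open>Antisymmetry comes from exchanging two fibre sums. For a repeated entry both sums run
  over the same fibre and the summand is antisymmetric with neutral diagonal, so the terms cancel in
  pairs.\<close>

lemma antisym_function_push:
  assumes "antisym_function G c" "finite V"
  shows "antisym_function G (push G V f c)"
proof (rule antisym_functionI)
  show "push G V f c \<sigma> \<in> carrier G" for \<sigma>
    using assms antisym_function_closed push_closed by metis
  have sw: "push G V f (\<lambda>\<rho>. c (v # v' # \<rho>)) \<tau> = inv (push G V f (\<lambda>\<rho>. c (v' # v # \<rho>)) \<tau>)"
    if "antisym_function G c" for c v v' \<tau>
  proof -
    have "(\<lambda>\<rho>. c (v # v' # \<rho>)) = (\<lambda>\<rho>. inv (c (v' # v # \<rho>)))"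
      using antisym_Cons_Cons[OF that] by blast
    then show ?thesis
      using push_inv[of "\<lambda>\<rho>. c (v' # v # \<rho>)"] antisym_function_closed[OF that] by simp
  qed
  show "push G V f c (xs @ x # y # ys) = inv (push G V f c (xs @ y # x # ys))" for xs x y ys
    using assms(1)
  proof (induction xs arbitrary: c)
    case Nil
    note cl = antisym_function_closed[OF Nil]
    have "push G V f c (x # y # ys) = finprod G (\<lambda>v. finprod G (\<lambda>v'.
        inv (push G V f (\<lambda>\<rho>. c (v' # v # \<rho>)) ys)) {v \<in> V. f v = y}) {v \<in> V. f v = x}"
      unfolding push.simps
      by (intro finprod_cong' finprod_closed sw[OF Nil] refl) (auto intro!: cl push_closed finprod_closed)
    also have "\<dots> = inv (finprod G (\<lambda>v. finprod G (\<lambda>v'.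
        push G V f (\<lambda>\<rho>. c (v' # v # \<rho>)) ys) {v \<in> V. f v = y}) {v \<in> V. f v = x})"
      by (simp add: finprod_inv push_closed cl finprod_closed)
    also have "\<dots> = inv (push G V f c (y # x # ys))"
      unfolding push.simps using assms(2)
      by (subst finprod_swap) (auto intro!: cl push_closed)
    finally show ?case by simp
  next
    case (Cons z xs)
    note cl = antisym_function_closed[OF Cons.prems]
    have "push G V f c ((z # xs) @ x # y # ys) =
        finprod G (\<lambda>v. inv (push G V f (\<lambda>\<rho>. c (v # \<rho>)) (xs @ y # x # ys))) {v \<in> V. f v = z}"
      unfolding push.simps append_Cons
      by (intro finprod_cong' Cons.IH antisym_function_Cons[OF Cons.prems] refl)
        (auto intro!: cl push_closed)
    also have "\<dots> = inv (push G V f c ((z # xs) @ y # x # ys))"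
      by (simp add: finprod_inv push_closed cl)
    finally show ?case .
  qed
  show "push G V f c (xs @ x # x # ys) = \<one>" for xs x ys
    using assms(1)
  proof (induction xs arbitrary: c)
    case Nil
    note cl = antisym_function_closed[OF Nil]
    have "push G V f (\<lambda>\<rho>. c (v # v # \<rho>)) ys = \<one>" for v
      using antisym_function_eq[OF Nil, of "[]" v] by simp
    then show ?case
      unfolding append_Nil push.simps using assms(2)
      by (intro finprod_antisym sw[OF Nil]) (auto intro!: cl push_closed)
  next
    case (Cons z xs)
    show ?case
      unfolding push.simps append_Cons
      by (intro finprod_one_eqI Cons.IH antisym_function_Cons[OF Cons.prems])
  qed
qed

text \<open>Unrolls the recursion into one sum over the lifts of \<open>\<tau>\<close>, grouped by
  their first vertex. This form serves for supports and for the comparison with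
  \<open>chain_map\<close>; the recursive form serves for the algebra.\<close>

lemma push_eq_finprod:
  assumes "finite V" "\<And>\<sigma>. c \<sigma> \<in> carrier G"
  shows "push G V f c \<tau> = finprod G c {\<sigma> \<in> lists V. map f \<sigma> = \<tau>}"
  using assms(2)
proof (induction \<tau> arbitrary: c)
  case Nil
  have "{\<sigma> \<in> lists V. map f \<sigma> = []} = {[]}" by auto
  then show ?case using Nil by simp
next
  case (Cons x \<tau>)
  let ?A = "{v \<in> V. f v = x}" and ?B = "{\<sigma> \<in> lists V. map f \<sigma> = \<tau>}"
  have finB: "finite ?B"
    by (rule finite_subset[OF _ finite_lists_length_eq[OF assms(1), of "length \<tau>"]]) auto
  have eq: "{\<sigma> \<in> lists V. map f \<sigma> = x # \<tau>} = (\<Union>v\<in>?A. (#) v ` ?B)"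
    by (auto simp: map_eq_Cons_conv image_iff)
  have "finprod G c (\<Union>v\<in>?A. (#) v ` ?B) = finprod G (\<lambda>v. finprod G c ((#) v ` ?B)) ?A"
    using assms(1) finB Cons.prems
    by (intro finprod_UN_disjoint) (auto simp: pairwise_def disjnt_def)
  also have "\<dots> = finprod G (\<lambda>v. push G V f (\<lambda>\<rho>. c (v # \<rho>)) \<tau>) ?A"
  proof (rule finprod_cong')
    fix v
    have "finprod G c ((#) v ` ?B) = finprod G (\<lambda>\<rho>. c (v # \<rho>)) ?B"
      using Cons.prems by (intro finprod_reindex) auto
    then show "finprod G c ((#) v ` ?B) = push G V f (\<lambda>\<rho>. c (v # \<rho>)) \<tau>"
      using Cons.IH[of "\<lambda>\<rho>. c (v # \<rho>)"] Cons.prems by simp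
  qed (use Cons.prems in \<open>auto intro!: push_closed\<close>)
  finally show ?case using eq by simp
qed

lemma finprod_fibers:
  assumes "finite A" "finite B" "f ` A \<subseteq> B" "\<And>a. a \<in> A \<Longrightarrow> g a \<in> carrier G"
  shows "finprod G (\<lambda>b. finprod G g {a \<in> A. f a = b}) B = finprod G g A"
proof -
  have "A = (\<Union>b\<in>B. {a \<in> A. f a = b})" using assms(3) by blast
  then have "finprod G g A = finprod G g (\<Union>b\<in>B. {a \<in> A. f a = b})" by simp
  also have "\<dots> = finprod G (\<lambda>b. finprod G g {a \<in> A. f a = b}) B"
    using assms by (intro finprod_UN_disjoint) (auto simp: pairwise_def disjnt_def)
  finally show ?thesis by simp
qed

text \<open>The fibres over all \<open>w \<in> V'\<close> exhaust \<open>V\<close>, since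
  \<open>f\<close> maps \<open>V\<close> into \<open>V'\<close>; the remaining exchange of the sum
  with \<open>push\<close> is linearity.\<close>

lemma full_boundary_push:
  assumes "\<And>\<sigma>. c \<sigma> \<in> carrier G" "finite V" "finite V'" "f ` V \<subseteq> V'"
  shows "full_boundary G V' (push G V f c) \<tau> = push G V f (full_boundary G V c) \<tau>"
proof -
  have "full_boundary G V' (push G V f c) \<tau> = finprod G (\<lambda>v. push G V f (\<lambda>\<rho>. c (v # \<rho>)) \<tau>) V"
    unfolding full_boundary_def push.simps
    using assms by (intro finprod_fibers) (auto intro!: push_closed)
  also have "\<dots> = push G V f (full_boundary G V c) \<tau>"
    unfolding full_boundary_def using assms by (subst push_finprod) auto
  finally show ?thesis .
qed

text \<open>The fibre of \<open>g \<circ> f\<close> over a vertex is the disjoint union of the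
  fibres of \<open>f\<close> over the fibre of \<open>g\<close>.\<close>

lemma push_push:
  assumes "\<And>\<sigma>. c \<sigma> \<in> carrier G" "finite V" "finite V'" "f ` V \<subseteq> V'"
  shows "push G V' g (push G V f c) \<tau> = push G V (g \<circ> f) c \<tau>"
  using assms(1)
proof (induction \<tau> arbitrary: c)
  case (Cons x \<tau>)
  let ?P = "\<lambda>v. push G V f (\<lambda>\<rho>. c (v # \<rho>))"
  have *: "push G V' g (\<lambda>\<rho>. push G V f c (w # \<rho>)) \<tau> =
      finprod G (\<lambda>v. push G V (g \<circ> f) (\<lambda>\<rho>. c (v # \<rho>)) \<tau>) {v \<in> V. f v = w}" for w
  proof -
    have "push G V' g (\<lambda>\<rho>. push G V f c (w # \<rho>)) \<tau> =
        finprod G (\<lambda>v. push G V' g (?P v) \<tau>) {v \<in> V. f v = w}"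
      unfolding push.simps
      using assms(2) Cons.prems by (subst push_finprod) (auto intro!: push_closed)
    also have "\<dots> = finprod G (\<lambda>v. push G V (g \<circ> f) (\<lambda>\<rho>. c (v # \<rho>)) \<tau>) {v \<in> V. f v = w}"
      using Cons.prems by (intro finprod_cong' Cons.IH refl) (auto intro!: push_closed)
    finally show ?thesis .
  qed
  have sub: "{v \<in> V. f v = w} = {v \<in> {v \<in> V. g (f v) = x}. f v = w}"
    if "w \<in> {w \<in> V'. g w = x}" for w using that by auto
  have "push G V' g (push G V f c) (x # \<tau>) = finprod G (\<lambda>w. finprod G
      (\<lambda>v. push G V (g \<circ> f) (\<lambda>\<rho>. c (v # \<rho>)) \<tau>) {v \<in> V. f v = w}) {w \<in> V'. g w = x}"
    unfolding push.simps(2)[of G V' g] * ..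
  also have "\<dots> = finprod G (\<lambda>w. finprod G
      (\<lambda>v. push G V (g \<circ> f) (\<lambda>\<rho>. c (v # \<rho>)) \<tau>) {v \<in> {v \<in> V. g (f v) = x}. f v = w}) {w \<in> V'. g w = x}"
    using Cons.prems sub by (intro finprod_cong' arg_cong2[of _ _ _ _ "finprod G"] refl)
      (auto intro!: push_closed finprod_closed)
  also have "\<dots> = finprod G (\<lambda>v. push G V (g \<circ> f) (\<lambda>\<rho>. c (v # \<rho>)) \<tau>) {v \<in> V. g (f v) = x}"
    using assms Cons.prems by (intro finprod_fibers) (auto intro!: push_closed)
  also have "\<dots> = push G V (g \<circ> f) c (x # \<tau>)" by (simp only: push.simps(2) o_apply)
  finally show ?case .
qed simp

text \<open>The two sets of lifts differ only by lists through a vertex where \<open>f\<close> and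
  \<open>g\<close> disagree, and there \<open>c\<close> is neutral. The case of interest is a
  contraction by \<open>u\<close>, which vanishes on lists containing \<open>u\<close>.\<close>

lemma push_cong_map:
  assumes "\<And>v. v \<in> V \<Longrightarrow> f v = g v \<or> (\<forall>\<rho>. v \<in> set \<rho> \<longrightarrow> c \<rho> = \<one>)"
    and "\<And>\<sigma>. c \<sigma> \<in> carrier G" "finite V"
  shows "push G V f c \<tau> = push G V g c \<tau>"
proof -
  have "{\<sigma> \<in> lists V. map h \<sigma> = \<tau>} \<subseteq> {\<sigma>. set \<sigma> \<subseteq> V \<and> length \<sigma> = length \<tau>}" for h by auto
  then have fin: "finite {\<sigma> \<in> lists V. map h \<sigma> = \<tau>}" for h
    using finite_lists_length_eq[OF assms(3)] finite_subset by blast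
  have ne: "map f \<sigma> = map g \<sigma>" if "\<sigma> \<in> lists V" "c \<sigma> \<noteq> \<one>" for \<sigma>
    using assms(1) that by (metis in_listsD map_cong)
  have "finprod G c {\<sigma> \<in> lists V. map f \<sigma> = \<tau>} = finprod G c {\<sigma> \<in> lists V. map g \<sigma> = \<tau>}"
  proof (rule finprod_mono_neutral_cong)
    show "c x = \<one>" if "x \<in> {\<sigma> \<in> lists V. map g \<sigma> = \<tau>} - {\<sigma> \<in> lists V. map f \<sigma> = \<tau>}" for x
      using ne[of x] that by (cases "c x = \<one>") auto
    show "c x = \<one>" if "x \<in> {\<sigma> \<in> lists V. map f \<sigma> = \<tau>} - {\<sigma> \<in> lists V. map g \<sigma> = \<tau>}" for x
      using ne[of x] that by (cases "c x = \<one>") auto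
  qed (use fin assms(2) in auto)
  then show ?thesis
    using push_eq_finprod[of V c f \<tau>] push_eq_finprod[of V c g \<tau>] assms(2,3) by simp
qed

section \<open>Homotopies for a change at one vertex\<close>

text \<open>Think of \<open>c\<close> as a part without \<open>u\<close> plus \<open>u\<close> times
  its contraction by \<open>u\<close>. Push-forward respects exterior products and the first part
  does not see the update, so the difference is (\<open>w\<close> minus \<open>p u\<close>) times
  the push-forward of the contraction.\<close>

lemma push_fun_upd_quotient:
  assumes "antisym_function G c" "finite V" "u \<in> V"
  shows "push G V (p(u := w)) c \<tau> \<otimes> inv (push G V p c \<tau>) =
     wedge G {w} (push G V p (\<lambda>\<rho>. c (u # \<rho>))) \<tau> \<otimes>
     inv (wedge G {p u} (push G V p (\<lambda>\<rho>. c (u # \<rho>))) \<tau>)"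
  using assms(1)
proof (induction \<tau> arbitrary: c)
  case Nil
  then show ?case using antisym_function_closed[OF Nil] by simp
next
  case (Cons x \<tau>)
  note cl = antisym_function_closed[OF Cons.prems]
  let ?q = "p(u := w)" and ?A = "{v \<in> V. p v = x}"
  define b where "b = push G V p (\<lambda>\<rho>. c (u # \<rho>))"
  define P where "P = (\<lambda>v. push G V p (\<lambda>\<rho>. c (v # \<rho>)) \<tau>)"
  define Q where "Q = (\<lambda>v. push G V ?q (\<lambda>\<rho>. c (v # \<rho>)) \<tau>)"
  define R where "R = (\<lambda>y v. wedge G {y} (push G V p (\<lambda>\<rho>. c (v # u # \<rho>))) \<tau>)"
  define M where "M = finprod G Q (?A - {u})"
  have Pc: "P v \<in> carrier G" and Qc: "Q v \<in> carrier G" and Rc: "R y v \<in> carrier G"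
    and bc: "b \<rho> \<in> carrier G" for v y \<rho>
    unfolding P_def Q_def R_def b_def using cl by (auto intro!: push_closed wedge_closed)
  have Mc: "M \<in> carrier G" unfolding M_def using Qc by (intro finprod_closed) auto
  have IH: "Q v \<otimes> inv (P v) = R w v \<otimes> inv (R (p u) v)" for v
    unfolding P_def Q_def R_def
    by (rule Cons.IH[OF antisym_function_Cons[OF Cons.prems]])
  \<comment> \<open>The inverse in the recursion of \<open>wedge\<close> is cancelled by the sign of
    moving \<open>u\<close> behind \<open>v\<close>, so the terms \<open>R\<close> enter without
    inverse.\<close>
  have wedge_step: "wedge G {y} b (x # \<tau>) = (if x = y then b \<tau> else \<one>) \<otimes> finprod G (R y) ?A" for y
  proof -
    have "b (x # \<rho>) = inv (finprod G (\<lambda>v. push G V p (\<lambda>\<rho>. c (v # u # \<rho>)) \<rho>) ?A)" for \<rho>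
    proof -
      have "push G V p (\<lambda>\<rho>. c (u # v # \<rho>)) \<rho> = inv (push G V p (\<lambda>\<rho>. c (v # u # \<rho>)) \<rho>)" for v
      proof -
        have "(\<lambda>\<rho>. c (u # v # \<rho>)) = (\<lambda>\<rho>. inv (c (v # u # \<rho>)))"
          using antisym_Cons_Cons[OF Cons.prems] by blast
        then show ?thesis using push_inv[of "\<lambda>\<rho>. c (v # u # \<rho>)"] cl by simp
      qed
      then show ?thesis
        unfolding b_def push.simps using cl by (simp add: finprod_inv push_closed)
    qed
    then have "wedge G {y} (\<lambda>\<rho>. b (x # \<rho>)) \<tau> = inv (finprod G (R y) ?A)"
      unfolding R_def using cl assms(2)
      by (simp add: wedge_inv wedge_finprod push_closed finprod_closed)
    moreover have "finprod G (R y) ?A \<in> carrier G" using Rc by (intro finprod_closed) auto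
    ultimately show ?thesis by simp
  qed
  \<comment> \<open>Once \<open>u\<close> is used up as first vertex it cannot occur again, so the
    update at \<open>u\<close> is invisible.\<close>
  have Qu: "Q u = b \<tau>"
    unfolding Q_def b_def
  proof (rule push_cong_map)
    fix v
    show "?q v = p v \<or> (\<forall>\<rho>. v \<in> set \<rho> \<longrightarrow> c (u # \<rho>) = \<one>)"
    proof (cases "v = u")
      case True
      have "c (u # \<rho>) = \<one>" if "u \<in> set \<rho>" for \<rho>
        using that by (intro antisym_function_not_distinct[OF Cons.prems]) simp
      with True show ?thesis by blast
    qed simp
  qed (use cl assms(2) in auto)
  have QA: "finprod G Q A = (if u \<in> A then b \<tau> else \<one>) \<otimes> finprod G Q (A - {u})" if "finite A" for A
  proof (cases "u \<in> A")
    case True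
    then have "finprod G Q A = finprod G Q (insert u (A - {u}))" by (simp add: insert_absorb)
    also have "\<dots> = Q u \<otimes> finprod G Q (A - {u})"
      using that Qc by (intro finprod_insert) auto
    finally show ?thesis using True Qu by simp
  next
    case False
    have "finprod G Q A \<in> carrier G" using Qc by (intro finprod_closed) auto
    with False show ?thesis by simp
  qed
  have eq: "{v \<in> V. ?q v = x} - {u} = ?A - {u}" and
    uq: "u \<in> {v \<in> V. ?q v = x} \<longleftrightarrow> x = w" and up: "u \<in> ?A \<longleftrightarrow> x = p u"
    using assms(3) by auto
  have fin: "finite {v \<in> V. ?q v = x}" "finite ?A" using assms(2) by auto
  have 1: "finprod G Q {v \<in> V. ?q v = x} = (if x = w then b \<tau> else \<one>) \<otimes> M"
    using QA[OF fin(1)] unfolding eq uq M_def .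
  have 2: "finprod G Q ?A = (if x = p u then b \<tau> else \<one>) \<otimes> M"
    using QA[OF fin(2)] unfolding up M_def .
  have inv2: "finprod G (\<lambda>v. f v \<otimes> inv (g v)) ?A = finprod G f ?A \<otimes> inv (finprod G g ?A)"
    if "\<And>v. f v \<in> carrier G" "\<And>v. g v \<in> carrier G" for f g
    using that by (subst finprod_multf) (auto simp: finprod_inv)
  have "finprod G (\<lambda>v. Q v \<otimes> inv (P v)) ?A = finprod G (\<lambda>v. R w v \<otimes> inv (R (p u) v)) ?A"
    using IH by simp
  then have 3: "finprod G Q ?A \<otimes> inv (finprod G P ?A) =
      finprod G (R w) ?A \<otimes> inv (finprod G (R (p u)) ?A)"
    using inv2[of Q P] inv2[of "R w" "R (p u)"] Pc Qc Rc by simp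
  \<comment> \<open>The induction hypothesis was multiplied over the fibre of the old map, while the
    claim concerns the fibre of the updated one. The fibres differ at most in \<open>u\<close>:
    \<open>\<alpha>\<close> is its term in the new fibre, \<open>\<beta>\<close> its term in the old
    one.\<close>
  define \<alpha> where "\<alpha> = (if x = w then b \<tau> else \<one>)"
  define \<beta> where "\<beta> = (if x = p u then b \<tau> else \<one>)"
  have ab: "\<alpha> \<in> carrier G" "\<beta> \<in> carrier G" using bc by (auto simp: \<alpha>_def \<beta>_def)
  have fc: "finprod G P ?A \<in> carrier G" "finprod G (R w) ?A \<in> carrier G"
    "finprod G (R (p u)) ?A \<in> carrier G"
    using Pc Rc by (auto intro!: finprod_closed)
  have "wedge G {w} b (x # \<tau>) \<otimes> inv (wedge G {p u} b (x # \<tau>)) =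
      \<alpha> \<otimes> inv \<beta> \<otimes> (finprod G (R w) ?A \<otimes> inv (finprod G (R (p u)) ?A))"
    unfolding wedge_step \<alpha>_def[symmetric] \<beta>_def[symmetric] using ab fc by (simp add: inv_mult m_ac)
  also have "\<dots> = \<alpha> \<otimes> inv \<beta> \<otimes> (\<beta> \<otimes> M \<otimes> inv (finprod G P ?A))"
    using 2 3 by (simp add: \<beta>_def)
  also have "\<dots> = (\<alpha> \<otimes> M) \<otimes> inv (finprod G P ?A)"
  proof -
    have "\<alpha> \<otimes> inv \<beta> \<otimes> (\<beta> \<otimes> M \<otimes> inv (finprod G P ?A)) =
        (inv \<beta> \<otimes> \<beta>) \<otimes> ((\<alpha> \<otimes> M) \<otimes> inv (finprod G P ?A))"
      using ab Mc fc by (simp only: m_ac m_closed inv_closed)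
    then show ?thesis using ab Mc fc by simp
  qed
  also have "\<dots> = push G V ?q c (x # \<tau>) \<otimes> inv (push G V p c (x # \<tau>))"
    unfolding push.simps P_def[symmetric] Q_def[symmetric] 1 \<alpha>_def ..
  finally show ?case unfolding b_def by (rule sym)
qed

text \<open>The homotopy sends a simplex \<open>u # \<rho>\<close> to \<open>p u # w # map p \<rho>\<close>, and simplexes without \<open>u\<close> to
  zero.\<close>

lemma push_homotopy:
  assumes "antisym_function G c" "finite V" "u \<in> V" "finite V'" "p ` V \<subseteq> V'" "w \<in> V'"
  shows "push G V (p(u := w)) c \<tau> \<otimes> inv (push G V p c \<tau>) =
     full_boundary G V' (wedge G {p u} (wedge G {w} (push G V p (\<lambda>\<rho>. c (u # \<rho>))))) \<tau> \<otimes>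
     wedge G {p u} (wedge G {w} (push G V p (\<lambda>\<rho>. full_boundary G V c (u # \<rho>)))) \<tau>"
proof -
  define B where "B = push G V p (\<lambda>\<rho>. c (u # \<rho>))"
  define N where "N = push G V p (\<lambda>\<rho>. full_boundary G V c (u # \<rho>))"
  have aB: "antisym_function G B"
    unfolding B_def by (intro antisym_function_push antisym_function_Cons assms)
  have aN: "antisym_function G N"
    unfolding N_def
    by (intro antisym_function_push antisym_function_Cons antisym_function_full_boundary assms)
  note Bc = antisym_function_closed[OF aB] and Nc = antisym_function_closed[OF aN]
  have pu: "p u \<in> V'" using assms by blast
  have c1: "full_boundary G V (\<lambda>\<rho>. c (u # \<rho>)) \<rho> \<in> carrier G" for \<rho>
    by (rule full_boundary_closed) (rule antisym_function_closed[OF assms(1)])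
  \<comment> \<open>The boundary commutes with the push-forward and anticommutes with contraction by
    \<open>u\<close>. This sign makes the homotopy formula a sum rather than a difference.\<close>
  have "full_boundary G V' B \<rho> = inv (N \<rho>)" for \<rho>
  proof -
    have "full_boundary G V' B \<rho> = push G V p (full_boundary G V (\<lambda>\<rho>. c (u # \<rho>))) \<rho>"
      unfolding B_def using assms antisym_function_closed[OF assms(1)]
      by (intro full_boundary_push) auto
    also have "N \<rho> = push G V p (\<lambda>\<rho>. inv (full_boundary G V (\<lambda>\<rho>. c (u # \<rho>)) \<rho>)) \<rho>"
      unfolding N_def by (simp only: full_boundary_Cons[OF assms(1)])
    then have "push G V p (full_boundary G V (\<lambda>\<rho>. c (u # \<rho>))) \<rho> = inv (N \<rho>)"
      using c1 by (simp add: push_inv push_closed)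
    finally show ?thesis .
  qed
  then have "full_boundary G V' B = (\<lambda>\<rho>. inv (N \<rho>))" by blast
  then have 1: "full_boundary G V' (wedge G {w} B) = (\<lambda>\<rho>. B \<rho> \<otimes> wedge G {w} N \<rho>)"
    using full_boundary_wedge[OF aB assms(4,6)] Nc by (auto simp: wedge_inv wedge_closed)
  have "full_boundary G V' (wedge G {p u} (wedge G {w} B)) \<tau> =
      wedge G {w} B \<tau> \<otimes> inv (wedge G {p u} (\<lambda>\<rho>. B \<rho> \<otimes> wedge G {w} N \<rho>) \<tau>)"
    using full_boundary_wedge[OF antisym_function_wedge[OF aB, of "{w}"] assms(4) pu, of \<tau>]
    unfolding 1 .
  also have "\<dots> = wedge G {w} B \<tau> \<otimes> inv (wedge G {p u} B \<tau> \<otimes> wedge G {p u} (wedge G {w} N) \<tau>)"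
    using Bc Nc by (simp add: wedge_mult wedge_closed)
  finally have "full_boundary G V' (wedge G {p u} (wedge G {w} B)) \<tau> \<otimes>
      wedge G {p u} (wedge G {w} N) \<tau> = wedge G {w} B \<tau> \<otimes> inv (wedge G {p u} B \<tau>)"
    using Bc Nc by (simp add: wedge_closed inv_mult m_assoc)
  then show ?thesis
    using push_fun_upd_quotient[OF assms(1,2,3)] unfolding B_def N_def by simp
qed

text \<open>Dual to \<open>push_fun_upd_quotient\<close>. Without repetition, \<open>u\<close>
  occurs in \<open>\<sigma>\<close> at most once. Multiplication by \<open>u\<close> picks that
  position, and moving \<open>w\<close> or \<open>p u\<close> from the front back to it undoes the
  sign of \<open>wedge\<close>.\<close>

lemma wedge_pullback_quotient:
  assumes "antisym_function G c" "distinct \<sigma>"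
  shows "wedge G {u} (\<lambda>\<rho>. c (w # map p \<rho>) \<otimes> inv (c (p u # map p \<rho>))) \<sigma> =
    c (map (p(u := w)) \<sigma>) \<otimes> inv (c (map p \<sigma>))"
  using assms
proof (induction \<sigma> arbitrary: c)
  case Nil
  then show ?case using antisym_function_closed[OF Nil(1)] by simp
next
  case (Cons x \<sigma>)
  note cl = antisym_function_closed[OF Cons.prems(1)]
  show ?case
  proof (cases "x = u")
    case True
    \<comment> \<open>The tail avoids \<open>u\<close>, so only the head contributes and the updated
      map agrees with \<open>p\<close> on the tail.\<close>
    then have u: "u \<notin> set \<sigma>" using Cons.prems by simp
    have 1: "wedge G {u} (\<lambda>\<rho>. c (w # map p (x # \<rho>)) \<otimes> inv (c (p u # map p (x # \<rho>)))) \<sigma> = \<one>"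
      using u by (intro wedge_eq_one) (auto simp: set_conv_nth)
    have m: "map (p(u := w)) \<sigma> = map p \<sigma>" using u by (rule map_fun_upd)
    show ?thesis using 1 True cl by (simp add: m fun_upd_same del: fun_upd_apply)
  next
    case False
    have "c (w # p x # map p \<rho>) \<otimes> inv (c (p u # p x # map p \<rho>)) =
        inv (c (p x # w # map p \<rho>) \<otimes> inv (c (p x # p u # map p \<rho>)))" for \<rho>
      unfolding antisym_Cons_Cons[OF Cons.prems(1), of w "p x"]
        antisym_Cons_Cons[OF Cons.prems(1), of "p u" "p x"]
      using cl by (simp add: inv_mult)
    then have "wedge G {u} (\<lambda>\<rho>. c (w # map p (x # \<rho>)) \<otimes> inv (c (p u # map p (x # \<rho>)))) \<sigma> =
        inv (wedge G {u} (\<lambda>\<rho>. c (p x # w # map p \<rho>) \<otimes> inv (c (p x # p u # map p \<rho>))) \<sigma>)"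
      using cl by (simp add: wedge_inv del: inv_mult_group)
    also have "\<dots> = inv (c (p x # map (p(u := w)) \<sigma>) \<otimes> inv (c (p x # map p \<sigma>)))"
      using Cons.IH[OF antisym_function_Cons[OF Cons.prems(1), of "p x"]] Cons.prems(2)
      by (simp del: fun_upd_apply)
    finally show ?thesis using False cl by (simp add: fun_upd_other del: fun_upd_apply)
  qed
qed

lemma inv_mult_mid: "x \<in> carrier G \<Longrightarrow> y \<in> carrier G \<Longrightarrow> inv y \<otimes> (x \<otimes> y) = x"
  using m_lcomm[of "inv y" x y] by simp

text \<open>The transpose of the homotopy on chains. Expanding the coboundary at
  \<open>p u # w # map p \<rho>\<close> gives the two faces that omit \<open>p u\<close> or
  \<open>w\<close>, and the coboundary of the function to which \<open>wedge G {u}\<close> is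
  applied. The latter cancels because \<open>wedge G UNIV\<close> and \<open>wedge G {u}\<close>
  anticommute.\<close>

lemma pullback_homotopy:
  assumes "antisym_function G c" "distinct \<sigma>"
  shows "c (map (p(u := w)) \<sigma>) \<otimes> inv (c (map p \<sigma>)) =
     wedge G UNIV (wedge G {u} (\<lambda>\<rho>. c (p u # w # map p \<rho>))) \<sigma> \<otimes>
     wedge G {u} (\<lambda>\<rho>. wedge G UNIV c (p u # w # map p \<rho>)) \<sigma>"
proof -
  note cl = antisym_function_closed[OF assms(1)]
  let ?g = "\<lambda>\<rho>. c (p u # w # map p \<rho>)"
  let ?d = "\<lambda>\<rho>. c (w # map p \<rho>) \<otimes> inv (c (p u # map p \<rho>))"
  have "wedge G UNIV c (p u # w # map p \<rho>) = ?d \<rho> \<otimes> wedge G UNIV ?g \<rho>" for \<rho>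
    using cl wedge_UNIV_map[of "\<lambda>\<rho>. c (p u # w # \<rho>)" p \<rho>]
    by (simp add: inv_mult wedge_closed m_assoc)
  then have "wedge G {u} (\<lambda>\<rho>. wedge G UNIV c (p u # w # map p \<rho>)) \<sigma> =
      wedge G {u} ?d \<sigma> \<otimes> wedge G {u} (wedge G UNIV ?g) \<sigma>"
    using cl by (simp add: wedge_mult wedge_closed)
  moreover have "wedge G UNIV (wedge G {u} ?g) \<sigma> = inv (wedge G {u} (wedge G UNIV ?g) \<sigma>)"
    using cl by (intro wedge_anticommute)
  moreover have "wedge G {u} (wedge G UNIV ?g) \<sigma> \<in> carrier G" "wedge G {u} ?d \<sigma> \<in> carrier G"
    using cl by (auto intro!: wedge_closed)
  ultimately have "wedge G UNIV (wedge G {u} ?g) \<sigma> \<otimes>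
      wedge G {u} (\<lambda>\<rho>. wedge G UNIV c (p u # w # map p \<rho>)) \<sigma> = wedge G {u} ?d \<sigma>"
    using inv_mult_mid by simp
  then show ?thesis using wedge_pullback_quotient[OF assms] by simp
qed

end

section \<open>Functoriality and contiguity for finite pairs\<close>

text \<open>\<open>h\<close> may map \<open>B\<close> onto a proper subset of \<open>B'\<close>, so
  the image of a coset need not be a coset. Multiplying by \<open>B'\<close> completes it, which is
  how \<open>homology_map\<close> and \<open>cohomology_map\<close> are formed.\<close>

lemma homomorphic_image_r_coset:
  assumes "comm_group M" "comm_group M'" "h \<in> hom M M'" "subgroup B M" "subgroup B' M'"
    and "h ` B \<subseteq> B'" "c \<in> carrier M"
  shows "B' <#>\<^bsub>M'\<^esub> (h ` (B #>\<^bsub>M\<^esub> c)) = B' #>\<^bsub>M'\<^esub> h c"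
proof -
  interpret M: comm_group M by fact
  interpret M': comm_group M' by fact
  have sub: "B \<subseteq> carrier M" "B' \<subseteq> carrier M'"
    using assms(4,5) by (auto dest: subgroup.subset)
  have hc: "h c \<in> carrier M'" using assms(3,7) by (rule hom_in_carrier)
  have im: "h (b \<otimes>\<^bsub>M\<^esub> c) = h b \<otimes>\<^bsub>M'\<^esub> h c" if "b \<in> B" for b
    using hom_mult[OF assms(3)] that sub assms(7) by blast
  show ?thesis
  proof (intro equalityI subsetI)
    fix x assume "x \<in> B' <#>\<^bsub>M'\<^esub> (h ` (B #>\<^bsub>M\<^esub> c))"
    then obtain b' b where b: "b' \<in> B'" "b \<in> B" "x = b' \<otimes>\<^bsub>M'\<^esub> h (b \<otimes>\<^bsub>M\<^esub> c)"
      by (auto simp: set_mult_def r_coset_def)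
    have hb: "h b \<in> B'" using b assms(6) by blast
    have "x = (b' \<otimes>\<^bsub>M'\<^esub> h b) \<otimes>\<^bsub>M'\<^esub> h c"
      using im[OF b(2)] b hb hc sub M'.m_assoc[of b' "h b" "h c"] by (simp add: subset_iff)
    then show "x \<in> B' #>\<^bsub>M'\<^esub> h c"
      using subgroup.m_closed[OF assms(5) b(1) hb] by (auto simp: r_coset_def)
  next
    fix x assume "x \<in> B' #>\<^bsub>M'\<^esub> h c"
    then obtain b' where b: "b' \<in> B'" "x = b' \<otimes>\<^bsub>M'\<^esub> h c" by (auto simp: r_coset_def)
    have "c \<in> B #>\<^bsub>M\<^esub> c" using M.rcos_self assms(4,7) by blast
    with b show "x \<in> B' <#>\<^bsub>M'\<^esub> (h ` (B #>\<^bsub>M\<^esub> c))" by (auto simp: set_mult_def)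
  qed
qed

lemma r_coset_eqI:
  assumes "comm_group M" "subgroup B M" "x \<in> carrier M" "y \<in> carrier M"
    and "x \<otimes>\<^bsub>M\<^esub> inv\<^bsub>M\<^esub> y \<in> B"
  shows "B #>\<^bsub>M\<^esub> x = B #>\<^bsub>M\<^esub> y"
proof -
  interpret comm_group M by fact
  have "x = (x \<otimes>\<^bsub>M\<^esub> inv\<^bsub>M\<^esub> y) \<otimes>\<^bsub>M\<^esub> y" using assms by (simp add: m_assoc)
  then have "x \<in> B #>\<^bsub>M\<^esub> y" using assms(5) by (force simp: r_coset_def)
  then show ?thesis using repr_independence assms by metis
qed

definition face_closed :: "'v set set \<Rightarrow> bool" where
  "face_closed K \<longleftrightarrow> (\<forall>s\<in>K. \<forall>t. t \<subseteq> s \<and> t \<noteq> {} \<longrightarrow> t \<in> K)"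

lemma face_closedD: "face_closed K \<Longrightarrow> s \<in> K \<Longrightarrow> t \<subseteq> s \<Longrightarrow> t \<noteq> {} \<Longrightarrow> t \<in> K"
  unfolding face_closed_def by blast

definition complex_pair :: "'v set set \<Rightarrow> 'v set set \<Rightarrow> bool" where
  "complex_pair K L \<longleftrightarrow> finite (\<Union>K) \<and> L \<subseteq> K \<and> face_closed K \<and> face_closed L"

definition simplicial_map ::
    "'v set set \<Rightarrow> 'v set set \<Rightarrow> 'w set set \<Rightarrow> 'w set set \<Rightarrow> ('v \<Rightarrow> 'w) \<Rightarrow> bool" where
  "simplicial_map K L K' L' f \<longleftrightarrow> (\<forall>s\<in>K. f ` s \<in> K') \<and> (\<forall>s\<in>L. f ` s \<in> L')"

lemma simplicial_map_vertices: "simplicial_map K L K' L' f \<Longrightarrow> f ` (\<Union>K) \<subseteq> \<Union>K'"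
  unfolding simplicial_map_def by blast

lemma ordered_simplexes_mono: "L \<subseteq> K \<Longrightarrow> ordered_simplexes n L \<subseteq> ordered_simplexes n K"
  unfolding ordered_simplexes_def by blast

lemma ordered_simplexes_tl:
  assumes "face_closed K" "v # \<tau> \<in> ordered_simplexes (Suc n) K"
  shows "\<tau> \<in> ordered_simplexes n K"
proof -
  have "set \<tau> \<subseteq> set (v # \<tau>)" "set \<tau> \<noteq> {}" "set (v # \<tau>) \<in> K"
    using assms(2) by (auto simp: ordered_simplexes_def)
  then have "set \<tau> \<in> K" using assms(1) unfolding face_closed_def by blast
  then show ?thesis using assms(2) by (auto simp: ordered_simplexes_def)
qed

lemma set_take_drop_Suc:
  "i < length \<sigma> \<Longrightarrow> set \<sigma> = insert (\<sigma> ! i) (set (take i \<sigma> @ drop (Suc i) \<sigma>))"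
  by (subst id_take_nth_drop[of i \<sigma>]) (auto simp del: append_take_drop_id)

lemma distinct_take_drop_Suc:
  assumes "distinct \<sigma>" "i < length \<sigma>"
  shows "distinct (take i \<sigma> @ drop (Suc i) \<sigma>)" "\<sigma> ! i \<notin> set (take i \<sigma> @ drop (Suc i) \<sigma>)"
proof -
  have "distinct (take i \<sigma> @ \<sigma> ! i # drop (Suc i) \<sigma>)"
    using assms id_take_nth_drop[of i \<sigma>] by simp
  then show "distinct (take i \<sigma> @ drop (Suc i) \<sigma>)" "\<sigma> ! i \<notin> set (take i \<sigma> @ drop (Suc i) \<sigma>)"
    by auto
qed

lemma ordered_simplexes_face:
  assumes "face_closed K" "\<sigma> \<in> ordered_simplexes (Suc n) K" "i < length \<sigma>"
  shows "take i \<sigma> @ drop (Suc i) \<sigma> \<in> ordered_simplexes n K"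
proof -
  let ?\<rho> = "take i \<sigma> @ drop (Suc i) \<sigma>"
  have len: "length \<sigma> = Suc (Suc n)" and d: "distinct \<sigma>" and s: "set \<sigma> \<in> K"
    using assms(2) by (auto simp: ordered_simplexes_def)
  have l: "length ?\<rho> = Suc n" using len assms(3) by simp
  then have "set ?\<rho> \<noteq> {}" by (metis length_greater_0_conv set_empty zero_less_Suc)
  moreover have "set ?\<rho> \<subseteq> set \<sigma>" using set_take_drop_Suc[OF assms(3)] by blast
  ultimately have "set ?\<rho> \<in> K" using assms(1) s unfolding face_closed_def by blast
  then show ?thesis
    using l distinct_take_drop_Suc(1)[OF d assms(3)] by (simp add: ordered_simplexes_def)
qed

definition contiguous ::
    "'v set set \<Rightarrow> 'v set set \<Rightarrow> 'w set set \<Rightarrow> 'w set set \<Rightarrow> ('v \<Rightarrow> 'w) \<Rightarrow> ('v \<Rightarrow> 'w) \<Rightarrow> bool" where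
  "contiguous K L K' L' f g \<longleftrightarrow>
     (\<forall>s\<in>K. f ` s \<union> g ` s \<in> K') \<and> (\<forall>s\<in>L. f ` s \<union> g ` s \<in> L')"

text \<open>Each image is a face of the union of the two images. It is nonempty because the empty
  set is no simplex of \<open>K\<close> or \<open>L\<close>.\<close>

lemma contiguous_simplicial_map:
  assumes "face_closed K'" "face_closed L'" "contiguous K L K' L' p q" "{} \<notin> K" "{} \<notin> L"
  shows "simplicial_map K L K' L' p" "simplicial_map K L K' L' q"
proof -
  have *: "p ` s \<in> M' \<and> q ` s \<in> M'" if "p ` s \<union> q ` s \<in> M'" "s \<noteq> {}" "face_closed M'" for s M'
    using face_closedD[OF that(3,1)] that(2) by simp
  have "p ` s \<in> K' \<and> q ` s \<in> K'" if "s \<in> K" for s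
  proof (rule *[OF _ _ assms(1)])
    show "p ` s \<union> q ` s \<in> K'" using assms(3) that by (simp add: contiguous_def)
    show "s \<noteq> {}" using assms(4) that by blast
  qed
  moreover have "p ` s \<in> L' \<and> q ` s \<in> L'" if "s \<in> L" for s
  proof (rule *[OF _ _ assms(2)])
    show "p ` s \<union> q ` s \<in> L'" using assms(3) that by (simp add: contiguous_def)
    show "s \<noteq> {}" using assms(5) that by blast
  qed
  ultimately show "simplicial_map K L K' L' p" "simplicial_map K L K' L' q"
    by (auto simp: simplicial_map_def)
qed

context comm_group
begin

section \<open>Groups of alternating functions and induced chain maps\<close>

lemma finprod_neq_one: "finprod G f A \<noteq> \<one> \<Longrightarrow> \<exists>a\<in>A. f a \<noteq> \<one>"
  using finprod_one_eqI[of A f] by blast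

lemma antisym_function_mult:
  assumes "antisym_function G c" "antisym_function G d"
  shows "antisym_function G (\<lambda>\<sigma>. c \<sigma> \<otimes> d \<sigma>)"
proof (rule antisym_functionI)
  note cl = antisym_function_closed[OF assms(1)] antisym_function_closed[OF assms(2)]
  show "c \<sigma> \<otimes> d \<sigma> \<in> carrier G" for \<sigma> using cl by simp
  show "c (xs @ a # b # ys) \<otimes> d (xs @ a # b # ys) =
      inv (c (xs @ b # a # ys) \<otimes> d (xs @ b # a # ys))" for xs a b ys
    unfolding antisym_function_swap[OF assms(1), of xs a b] antisym_function_swap[OF assms(2), of xs a b]
    using cl by (simp add: inv_mult)
  show "c (xs @ a # a # ys) \<otimes> d (xs @ a # a # ys) = \<one>" for xs a ys
    using antisym_function_eq[OF assms(1)] antisym_function_eq[OF assms(2)] by simp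
qed

lemma antisym_function_inv:
  assumes "antisym_function G c"
  shows "antisym_function G (\<lambda>\<sigma>. inv (c \<sigma>))"
proof (rule antisym_functionI)
  note cl = antisym_function_closed[OF assms(1)]
  show "inv (c \<sigma>) \<in> carrier G" for \<sigma> using cl by simp
  show "inv (c (xs @ a # b # ys)) = inv (inv (c (xs @ b # a # ys)))" for xs a b ys
    unfolding antisym_function_swap[OF assms(1), of xs a b] ..
  show "inv (c (xs @ a # a # ys)) = \<one>" for xs a ys
    using antisym_function_eq[OF assms(1)] by simp
qed

lemma alternating_antisym: "c \<in> alternating G n K \<Longrightarrow> antisym_function G c"
  and alternating_closed: "c \<in> alternating G n K \<Longrightarrow> c \<sigma> \<in> carrier G"
  and alternating_outside: "c \<in> alternating G n K \<Longrightarrow> \<sigma> \<notin> ordered_simplexes n K \<Longrightarrow> c \<sigma> = \<one>"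
  by (auto simp: alternating_iff_antisym antisym_function_closed)

text \<open>Only lists without repetition have to be inspected; antisymmetry settles the
  others.\<close>

lemma alternatingI:
  assumes "antisym_function G c"
    and "\<And>\<sigma>. c \<sigma> \<noteq> \<one> \<Longrightarrow> distinct \<sigma> \<Longrightarrow> length \<sigma> = Suc n \<and> set \<sigma> \<in> K"
  shows "c \<in> alternating G n K"
  unfolding alternating_iff_antisym
proof (intro conjI allI impI assms(1))
  fix \<sigma> assume "\<sigma> \<notin> ordered_simplexes n K"
  then show "c \<sigma> = \<one>"
    using assms(2)[of \<sigma>] antisym_function_not_distinct[OF assms(1), of \<sigma>]
    by (cases "distinct \<sigma>") (auto simp: ordered_simplexes_def)
qed

lemma alternating_support:
  "c \<in> alternating G n K \<Longrightarrow> c \<sigma> \<noteq> \<one> \<Longrightarrow> \<sigma> \<in> ordered_simplexes n K"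
  using alternating_outside by blast

lemma alternating_mono: "L \<subseteq> K \<Longrightarrow> alternating G n L \<subseteq> alternating G n K"
  using ordered_simplexes_mono[of L K n] unfolding alternating_iff_antisym subset_iff by blast

lemma alternating_mult:
  "c \<in> alternating G n K \<Longrightarrow> d \<in> alternating G n K \<Longrightarrow> (\<lambda>\<sigma>. c \<sigma> \<otimes> d \<sigma>) \<in> alternating G n K"
  by (simp add: alternating_iff_antisym antisym_function_mult)

lemma alternating_inv: "c \<in> alternating G n K \<Longrightarrow> (\<lambda>\<sigma>. inv (c \<sigma>)) \<in> alternating G n K"
  by (simp add: alternating_iff_antisym antisym_function_inv)

lemma alternating_one: "(\<lambda>\<sigma>. \<one>) \<in> alternating G n K"
  by (simp add: alternating_iff_antisym antisym_function_def)

lemma comm_group_chain_group: "comm_group (chain_group G n K)"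
proof (rule comm_groupI)
  fix c d e
  assume c: "c \<in> carrier (chain_group G n K)" and d: "d \<in> carrier (chain_group G n K)"
  show "c \<otimes>\<^bsub>chain_group G n K\<^esub> d \<in> carrier (chain_group G n K)"
    using c d by (simp add: chain_group_def alternating_mult)
  show "c \<otimes>\<^bsub>chain_group G n K\<^esub> d = d \<otimes>\<^bsub>chain_group G n K\<^esub> c"
    using c d by (auto simp: chain_group_def alternating_closed m_comm intro!: ext)
  show "\<one>\<^bsub>chain_group G n K\<^esub> \<otimes>\<^bsub>chain_group G n K\<^esub> c = c"
    using c by (auto simp: chain_group_def alternating_closed intro!: ext)
  show "\<exists>y\<in>carrier (chain_group G n K). y \<otimes>\<^bsub>chain_group G n K\<^esub> c = \<one>\<^bsub>chain_group G n K\<^esub>"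
    using c alternating_inv
    by (intro bexI[of _ "\<lambda>\<sigma>. inv (c \<sigma>)"]) (auto simp: chain_group_def alternating_closed intro!: ext)
  assume e: "e \<in> carrier (chain_group G n K)"
  show "c \<otimes>\<^bsub>chain_group G n K\<^esub> d \<otimes>\<^bsub>chain_group G n K\<^esub> e =
      c \<otimes>\<^bsub>chain_group G n K\<^esub> (d \<otimes>\<^bsub>chain_group G n K\<^esub> e)"
    using c d e by (auto simp: chain_group_def alternating_closed m_assoc intro!: ext)
qed (simp add: chain_group_def alternating_one)

lemma inv_chain_group:
  assumes "c \<in> alternating G n K"
  shows "inv\<^bsub>chain_group G n K\<^esub> c = (\<lambda>\<sigma>. inv (c \<sigma>))"
proof -
  interpret C: comm_group "chain_group G n K" by (rule comm_group_chain_group)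
  show ?thesis
    using assms alternating_inv
    by (intro C.inv_equality) (auto simp: chain_group_def alternating_closed intro!: ext)
qed

lemma subgroup_chain_groupI:
  assumes "H \<subseteq> alternating G n K" "(\<lambda>\<sigma>. \<one>) \<in> H"
    and "\<And>c d. c \<in> H \<Longrightarrow> d \<in> H \<Longrightarrow> (\<lambda>\<sigma>. c \<sigma> \<otimes> d \<sigma>) \<in> H"
    and "\<And>c. c \<in> H \<Longrightarrow> (\<lambda>\<sigma>. inv (c \<sigma>)) \<in> H"
  shows "subgroup H (chain_group G n K)"
proof (rule subgroup.intro)
  show "inv\<^bsub>chain_group G n K\<^esub> c \<in> H" if "c \<in> H" for c
    using assms inv_chain_group[of c n K] that by auto
qed (use assms in \<open>auto simp: chain_group_def\<close>)

lemma hom_chain_groupI: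
  assumes "\<And>c. c \<in> alternating G n K \<Longrightarrow> h c \<in> alternating G m K'"
    and "\<And>c d \<sigma>. c \<in> alternating G n K \<Longrightarrow> d \<in> alternating G n K \<Longrightarrow>
           h (\<lambda>\<sigma>. c \<sigma> \<otimes> d \<sigma>) \<sigma> = h c \<sigma> \<otimes> h d \<sigma>"
  shows "h \<in> hom (chain_group G n K) (chain_group G m K')"
  using assms by (auto simp: hom_def chain_group_def)

lemma full_boundary_mult:
  assumes "\<And>\<sigma>. c \<sigma> \<in> carrier G" "\<And>\<sigma>. d \<sigma> \<in> carrier G"
  shows "full_boundary G V (\<lambda>\<sigma>. c \<sigma> \<otimes> d \<sigma>) \<tau> = full_boundary G V c \<tau> \<otimes> full_boundary G V d \<tau>"
  unfolding full_boundary_def using assms by (intro finprod_multf) auto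

lemma full_boundary_alternating:
  assumes "c \<in> alternating G (Suc n) K" "face_closed K"
  shows "full_boundary G V c \<in> alternating G n K"
proof (rule alternatingI)
  show "antisym_function G (full_boundary G V c)"
    by (intro antisym_function_full_boundary alternating_antisym[OF assms(1)])
  fix \<sigma> assume "full_boundary G V c \<sigma> \<noteq> \<one>"
  then obtain v where "c (v # \<sigma>) \<noteq> \<one>"
    unfolding full_boundary_def by (auto dest: finprod_neq_one)
  then have "v # \<sigma> \<in> ordered_simplexes (Suc n) K"
    by (rule alternating_support[OF assms(1)])
  then have "\<sigma> \<in> ordered_simplexes n K" by (rule ordered_simplexes_tl[OF assms(2)])
  then show "length \<sigma> = Suc n \<and> set \<sigma> \<in> K" by (auto simp: ordered_simplexes_def)
qed

text \<open>In degree at least one the augmentation is neutral, because one-vertex lists lie outside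
  the support; hence the two operators agree at the empty list too.\<close>

lemma boundary_eq_full_boundary:
  assumes "c \<in> alternating G (Suc n) K"
  shows "boundary G K c = full_boundary G (\<Union>K) c"
proof
  fix \<tau>
  have "full_boundary G (\<Union>K) c [] = \<one>"
    unfolding full_boundary_def using alternating_outside[OF assms]
    by (intro finprod_one_eqI) (auto simp: ordered_simplexes_def)
  then show "boundary G K c \<tau> = full_boundary G (\<Union>K) c \<tau>"
    by (auto simp: boundary_def full_boundary_def)
qed

lemma push_support:
  assumes "\<And>\<sigma>. c \<sigma> \<in> carrier G" "finite V" "push G V f c \<tau> \<noteq> \<one>"
  obtains \<sigma> where "map f \<sigma> = \<tau>" "c \<sigma> \<noteq> \<one>" "set \<sigma> \<subseteq> V"
proof -
  have "\<exists>\<sigma>\<in>{\<sigma> \<in> lists V. map f \<sigma> = \<tau>}. c \<sigma> \<noteq> \<one>"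
    using assms(3) unfolding push_eq_finprod[OF assms(2,1)] by (rule finprod_neq_one)
  with that show ?thesis by auto
qed

text \<open>A nontrivial value of the homotopy is traced back through two exterior factors and a
  push-forward to a simplex of the source. This is the stage for one exterior factor.\<close>

lemma wedge_support:
  assumes "wedge G S b \<tau> \<noteq> \<one>" "distinct \<tau>"
  obtains i \<rho> where "i \<in> S" "b \<rho> \<noteq> \<one>" "set \<tau> = insert i (set \<rho>)" "length \<tau> = Suc (length \<rho>)" "i \<notin> set \<rho>"
    "distinct \<rho>"
proof -
  obtain i where i: "i < length \<tau>" "\<tau> ! i \<in> S" "b (take i \<tau> @ drop (Suc i) \<tau>) \<noteq> \<one>"
    using wedge_eq_one[of \<tau> S b] assms(1) by blast
  show ?thesis
    by (rule that[of "\<tau> ! i" "take i \<tau> @ drop (Suc i) \<tau>"])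
      (use i set_take_drop_Suc[OF i(1)] distinct_take_drop_Suc[OF assms(2) i(1)] in auto)
qed

text \<open>Lifts of \<open>\<tau>\<close> that are not simplexes contribute the neutral element,
  and at lists with repetition the antisymmetry of \<open>push\<close> gives the value that
  \<open>chain_map\<close> has by definition.\<close>

lemma chain_map_eq_push:
  assumes "c \<in> alternating G n K" "finite V" "\<Union>K \<subseteq> V"
  shows "chain_map G n K f c = push G V f c"
proof
  fix \<tau>
  note cl = alternating_closed[OF assms(1)]
  have a: "antisym_function G (push G V f c)"
    by (intro antisym_function_push alternating_antisym[OF assms(1)] assms(2))
  show "chain_map G n K f c \<tau> = push G V f c \<tau>"
  proof (cases "distinct \<tau>")
    case True
    have "{\<sigma> \<in> lists V. map f \<sigma> = \<tau>} \<subseteq> {\<sigma>. set \<sigma> \<subseteq> V \<and> length \<sigma> = length \<tau>}" by auto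
    then have fin: "finite {\<sigma> \<in> lists V. map f \<sigma> = \<tau>}"
      using finite_lists_length_eq[OF assms(2)] finite_subset by blast
    have "push G V f c \<tau> = finprod G c {\<sigma> \<in> lists V. map f \<sigma> = \<tau>}"
      using assms(2) cl by (intro push_eq_finprod)
    also have "\<dots> = finprod G c {\<sigma> \<in> ordered_simplexes n K. map f \<sigma> = \<tau>}"
    proof (rule finprod_mono_neutral_cong_right[OF fin])
      show "{\<sigma> \<in> ordered_simplexes n K. map f \<sigma> = \<tau>} \<subseteq> {\<sigma> \<in> lists V. map f \<sigma> = \<tau>}"
        using assms(3) by (auto simp: ordered_simplexes_def)
    qed (use cl alternating_outside[OF assms(1)] in auto)
    finally show ?thesis using True by (simp add: chain_map_def)
  next
    case False
    then show ?thesis using antisym_function_not_distinct[OF a] by (simp add: chain_map_def)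
  qed
qed

lemma push_alternating:
  assumes "c \<in> alternating G n K" "finite V" "\<And>s. s \<in> K \<Longrightarrow> f ` s \<in> K'"
  shows "push G V f c \<in> alternating G n K'"
proof (rule alternatingI)
  show "antisym_function G (push G V f c)"
    by (intro antisym_function_push alternating_antisym[OF assms(1)] assms(2))
  fix \<tau> assume "push G V f c \<tau> \<noteq> \<one>"
  then obtain \<sigma> where \<sigma>: "map f \<sigma> = \<tau>" "c \<sigma> \<noteq> \<one>"
    using push_support[OF _ assms(2)] alternating_closed[OF assms(1)] by metis
  then have "\<sigma> \<in> ordered_simplexes n K" by (intro alternating_support[OF assms(1)])
  then show "length \<tau> = Suc n \<and> set \<tau> \<in> K'"
    using assms(3) \<sigma>(1) by (auto simp: ordered_simplexes_def)
qed

lemma chain_map_hom: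
  assumes "finite (\<Union>K)" "\<And>s. s \<in> K \<Longrightarrow> f ` s \<in> K'"
  shows "chain_map G n K f \<in> hom (chain_group G n K) (chain_group G n K')"
proof (rule hom_chain_groupI)
  fix c d \<sigma> assume c: "c \<in> alternating G n K" and d: "d \<in> alternating G n K"
  show "chain_map G n K f c \<in> alternating G n K'"
    using push_alternating[OF c assms] chain_map_eq_push[OF c assms(1), of f] by simp
  show "chain_map G n K f (\<lambda>\<sigma>. c \<sigma> \<otimes> d \<sigma>) \<sigma> = chain_map G n K f c \<sigma> \<otimes> chain_map G n K f d \<sigma>"
    using chain_map_eq_push[OF c assms(1), of f] chain_map_eq_push[OF d assms(1), of f]
      chain_map_eq_push[OF alternating_mult[OF c d] assms(1), of f] push_mult[of c d]
      alternating_closed[OF c] alternating_closed[OF d]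
    by simp
qed

section \<open>Relative homology\<close>

lemma boundary_hom:
  assumes "face_closed K"
  shows "boundary G K \<in> hom (chain_group G (Suc n) K) (chain_group G n K)"
proof (rule hom_chain_groupI)
  fix c d \<sigma> assume c: "c \<in> alternating G (Suc n) K" and d: "d \<in> alternating G (Suc n) K"
  show "boundary G K c \<in> alternating G n K"
    unfolding boundary_eq_full_boundary[OF c] by (rule full_boundary_alternating[OF c assms])
  show "boundary G K (\<lambda>\<sigma>. c \<sigma> \<otimes> d \<sigma>) \<sigma> = boundary G K c \<sigma> \<otimes> boundary G K d \<sigma>"
    unfolding boundary_eq_full_boundary[OF c] boundary_eq_full_boundary[OF d]
      boundary_eq_full_boundary[OF alternating_mult[OF c d]]
    using alternating_closed[OF c] alternating_closed[OF d] by (rule full_boundary_mult)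
qed

lemma subgroup_alternating:
  assumes "L \<subseteq> K"
  shows "subgroup (alternating G n L) (chain_group G n K)"
  using alternating_mono[OF assms] alternating_mult alternating_inv alternating_one
  by (intro subgroup_chain_groupI) auto

lemma subgroup_rel_boundaries:
  assumes "complex_pair K L"
  shows "subgroup (rel_boundaries G n K L) (chain_group G n K)"
proof -
  interpret C: comm_group "chain_group G n K" by (rule comm_group_chain_group)
  interpret C': comm_group "chain_group G (Suc n) K" by (rule comm_group_chain_group)
  have K: "face_closed K" "L \<subseteq> K" using assms by (auto simp: complex_pair_def)
  interpret h: group_hom "chain_group G (Suc n) K" "chain_group G n K" "boundary G K"
    using boundary_hom[OF K(1)] by unfold_locales
  have "carrier (chain_group G (Suc n) K) = alternating G (Suc n) K" by (simp add: chain_group_def)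
  then have "subgroup (boundary G K ` alternating G (Suc n) K) (chain_group G n K)"
    using h.img_is_subgroup by simp
  then show ?thesis
    unfolding rel_boundaries_def using C.mult_subgroups subgroup_alternating[OF K(2)] by blast
qed

lemma mem_rel_boundaries:
  "x \<in> rel_boundaries G n K L \<longleftrightarrow>
    (\<exists>d\<in>alternating G (Suc n) K. \<exists>l\<in>alternating G n L. x = (\<lambda>\<sigma>. boundary G K d \<sigma> \<otimes> l \<sigma>))"
  unfolding rel_boundaries_def set_mult_def by (auto simp: chain_group_def)

lemma rel_cycles_mult:
  assumes "complex_pair K L" "c \<in> rel_cycles G n K L" "d \<in> rel_cycles G n K L"
  shows "(\<lambda>\<sigma>. c \<sigma> \<otimes> d \<sigma>) \<in> rel_cycles G n K L"
proof (cases n)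
  case 0
  then show ?thesis using assms alternating_mult by (auto simp: rel_cycles_def)
next
  case (Suc m)
  have cd: "c \<in> alternating G (Suc m) K" "d \<in> alternating G (Suc m) K"
    using assms Suc by (auto simp: rel_cycles_def)
  have "boundary G K (\<lambda>\<sigma>. c \<sigma> \<otimes> d \<sigma>) = (\<lambda>\<sigma>. boundary G K c \<sigma> \<otimes> boundary G K d \<sigma>)"
    using hom_mult[OF boundary_hom[of K m], of c d] cd assms(1)
    by (simp add: chain_group_def complex_pair_def)
  then show ?thesis using assms Suc alternating_mult by (auto simp: rel_cycles_def)
qed

lemma rel_cycles_subset: "rel_cycles G n K L \<subseteq> alternating G n K"
  by (auto simp: rel_cycles_def)

lemma boundary_chain_map:
  assumes "c \<in> alternating G (Suc n) K" "complex_pair K L" "complex_pair K' L'"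
    and "simplicial_map K L K' L' f"
  shows "boundary G K' (chain_map G (Suc n) K f c) = chain_map G n K f (boundary G K c)"
proof -
  have fin: "finite (\<Union>K)" "finite (\<Union>K')" and fc: "face_closed K"
    and f: "\<And>s. s \<in> K \<Longrightarrow> f ` s \<in> K'"
    using assms by (auto simp: complex_pair_def simplicial_map_def)
  have 1: "chain_map G (Suc n) K f c = push G (\<Union>K) f c"
    by (intro chain_map_eq_push assms(1) fin) auto
  have 2: "chain_map G n K f (boundary G K c) = push G (\<Union>K) f (full_boundary G (\<Union>K) c)"
    unfolding boundary_eq_full_boundary[OF assms(1)]
    by (intro chain_map_eq_push full_boundary_alternating[OF assms(1) fc] fin) auto
  have "boundary G K' (push G (\<Union>K) f c) = full_boundary G (\<Union>K') (push G (\<Union>K) f c)"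
    by (rule boundary_eq_full_boundary[OF push_alternating[OF assms(1) fin(1) f]])
  also have "\<dots> = push G (\<Union>K) f (full_boundary G (\<Union>K) c)"
    using full_boundary_push[of c "\<Union>K" "\<Union>K'" f] alternating_closed[OF assms(1)] fin
      simplicial_map_vertices[OF assms(4)] by blast
  finally show ?thesis unfolding 1 2 .
qed

lemma chain_map_subcomplex:
  assumes "c \<in> alternating G n L" "complex_pair K L" "simplicial_map K L K' L' f"
  shows "chain_map G n K f c \<in> alternating G n L'"
proof -
  have K: "finite (\<Union>K)" "L \<subseteq> K" and f: "\<And>s. s \<in> L \<Longrightarrow> f ` s \<in> L'"
    using assms by (auto simp: complex_pair_def simplicial_map_def)
  have "c \<in> alternating G n K" using alternating_mono[OF K(2)] assms(1) by blast
  then have "chain_map G n K f c = push G (\<Union>K) f c" using K(1) by (intro chain_map_eq_push) auto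
  then show ?thesis using push_alternating[OF assms(1) K(1) f] by simp
qed

lemma chain_map_rel_cycles:
  assumes "c \<in> rel_cycles G n K L" "complex_pair K L" "complex_pair K' L'"
    and "simplicial_map K L K' L' f"
  shows "chain_map G n K f c \<in> rel_cycles G n K' L'"
proof -
  have c: "c \<in> alternating G n K" using assms(1) rel_cycles_subset by blast
  have fin: "finite (\<Union>K)" and f: "\<And>s. s \<in> K \<Longrightarrow> f ` s \<in> K'"
    using assms by (auto simp: complex_pair_def simplicial_map_def)
  have 1: "chain_map G n K f c \<in> alternating G n K'"
    using hom_in_carrier[OF chain_map_hom[OF fin f]] c by (simp add: chain_group_def)
  show ?thesis
  proof (cases n)
    case 0
    then show ?thesis using 1 by (simp add: rel_cycles_def)
  next
    case (Suc m)
    have "boundary G K c \<in> alternating G m L" using assms(1) Suc by (simp add: rel_cycles_def)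
    then have "chain_map G m K f (boundary G K c) \<in> alternating G m L'"
      using chain_map_subcomplex assms by blast
    then show ?thesis
      using 1 Suc c boundary_chain_map[OF _ assms(2-4), of c m] by (simp add: rel_cycles_def)
  qed
qed

lemma chain_map_rel_boundaries:
  assumes "complex_pair K L" "complex_pair K' L'" "simplicial_map K L K' L' f"
  shows "chain_map G n K f ` rel_boundaries G n K L \<subseteq> rel_boundaries G n K' L'"
proof
  fix y assume "y \<in> chain_map G n K f ` rel_boundaries G n K L"
  then obtain x where x: "x \<in> rel_boundaries G n K L" "y = chain_map G n K f x" by blast
  from x(1) obtain d l where d: "d \<in> alternating G (Suc n) K" and l: "l \<in> alternating G n L"
    and x': "x = (\<lambda>\<sigma>. boundary G K d \<sigma> \<otimes> l \<sigma>)"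
    unfolding mem_rel_boundaries by blast
  have y: "y = chain_map G n K f (\<lambda>\<sigma>. boundary G K d \<sigma> \<otimes> l \<sigma>)" using x(2) x' by simp
  have fin: "finite (\<Union>K)" and fc: "face_closed K" "L \<subseteq> K" and f: "\<And>s. s \<in> K \<Longrightarrow> f ` s \<in> K'"
    using assms by (auto simp: complex_pair_def simplicial_map_def)
  have "boundary G K d \<in> alternating G n K"
    using hom_in_carrier[OF boundary_hom[OF fc(1)]] d by (simp add: chain_group_def)
  moreover have "l \<in> alternating G n K" using alternating_mono[OF fc(2)] l by blast
  ultimately have "y = (\<lambda>\<sigma>. chain_map G n K f (boundary G K d) \<sigma> \<otimes> chain_map G n K f l \<sigma>)"
    using hom_mult[OF chain_map_hom[OF fin f], where x = "boundary G K d" and y = l] y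
    by (simp add: chain_group_def)
  also have "chain_map G n K f (boundary G K d) = boundary G K' (chain_map G (Suc n) K f d)"
    using boundary_chain_map[OF d assms] by simp
  finally show "y \<in> rel_boundaries G n K' L'"
    unfolding mem_rel_boundaries
    using hom_in_carrier[OF chain_map_hom[OF fin f]] d chain_map_subcomplex[OF l assms(1,3)]
    by (auto simp: chain_group_def)
qed

lemma simplicial_homology_carrier:
  "carrier (simplicial_homology G n K L) =
     (\<lambda>c. rel_boundaries G n K L #>\<^bsub>chain_group G n K\<^esub> c) ` rel_cycles G n K L"
  by (auto simp: simplicial_homology_def FactGroup_def RCOSETS_def r_coset_def)

text \<open>Products of cosets as sets are computed with the ambient operation. Restricting the
  carrier to cycles leaves them unchanged, so cosets can be handled in the full chain group.\<close>

lemma simplicial_homology_mult: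
  "monoid.mult (simplicial_homology G n K L) = set_mult (chain_group G n K)"
  by (auto simp: simplicial_homology_def FactGroup_def set_mult_def fun_eq_iff)

lemma r_coset_rel_boundaries_mult:
  assumes "complex_pair K L" "c \<in> alternating G n K" "d \<in> alternating G n K"
  shows "(rel_boundaries G n K L #>\<^bsub>chain_group G n K\<^esub> c) \<otimes>\<^bsub>simplicial_homology G n K L\<^esub>
      (rel_boundaries G n K L #>\<^bsub>chain_group G n K\<^esub> d) =
     rel_boundaries G n K L #>\<^bsub>chain_group G n K\<^esub> (\<lambda>\<sigma>. c \<sigma> \<otimes> d \<sigma>)"
proof -
  interpret C: comm_group "chain_group G n K" by (rule comm_group_chain_group)
  have "rel_boundaries G n K L \<lhd> chain_group G n K"
    using C.subgroup_imp_normal subgroup_rel_boundaries[OF assms(1)] by blast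
  from normal.rcos_sum[OF this, of c d] assms show ?thesis
    unfolding simplicial_homology_mult by (simp add: chain_group_def)
qed

lemma homology_map_r_coset:
  assumes "complex_pair K L" "complex_pair K' L'" "simplicial_map K L K' L' f"
    and "c \<in> alternating G n K"
  shows "homology_map G n K K' L' f (rel_boundaries G n K L #>\<^bsub>chain_group G n K\<^esub> c) =
     rel_boundaries G n K' L' #>\<^bsub>chain_group G n K'\<^esub> chain_map G n K f c"
proof -
  have fin: "finite (\<Union>K)" and f: "\<And>s. s \<in> K \<Longrightarrow> f ` s \<in> K'"
    using assms by (auto simp: complex_pair_def simplicial_map_def)
  show ?thesis
    unfolding homology_map_def
    using assms(4) by (intro homomorphic_image_r_coset comm_group_chain_group chain_map_hom fin f
        subgroup_rel_boundaries assms(1,2) chain_map_rel_boundaries[OF assms(1-3)])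
      (auto simp: chain_group_def)
qed

lemma simplicial_homology_closed:
  assumes "complex_pair K L" "x \<in> carrier (simplicial_homology G n K L)"
    "y \<in> carrier (simplicial_homology G n K L)"
  shows "x \<otimes>\<^bsub>simplicial_homology G n K L\<^esub> y \<in> carrier (simplicial_homology G n K L)"
proof -
  obtain c d where cd: "c \<in> rel_cycles G n K L" "d \<in> rel_cycles G n K L"
    and x: "x = rel_boundaries G n K L #>\<^bsub>chain_group G n K\<^esub> c"
    and y: "y = rel_boundaries G n K L #>\<^bsub>chain_group G n K\<^esub> d"
    using assms(2,3) unfolding simplicial_homology_carrier by blast
  then have "c \<in> alternating G n K" "d \<in> alternating G n K" using rel_cycles_subset by blast+
  then show ?thesis
    unfolding x y r_coset_rel_boundaries_mult[OF assms(1) \<open>c \<in> alternating G n K\<close> \<open>d \<in> alternating G n K\<close>]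
    using rel_cycles_mult[OF assms(1) cd] by (auto simp: simplicial_homology_carrier)
qed

lemma homology_map_hom:
  assumes "complex_pair K L" "complex_pair K' L'" "simplicial_map K L K' L' f"
  shows "homology_map G n K K' L' f \<in> hom (simplicial_homology G n K L) (simplicial_homology G n K' L')"
proof (rule homI)
  fix x assume "x \<in> carrier (simplicial_homology G n K L)"
  then obtain c where c: "c \<in> rel_cycles G n K L"
    and x: "x = rel_boundaries G n K L #>\<^bsub>chain_group G n K\<^esub> c"
    unfolding simplicial_homology_carrier by blast
  have ca: "c \<in> alternating G n K" using c rel_cycles_subset by blast
  show "homology_map G n K K' L' f x \<in> carrier (simplicial_homology G n K' L')"
    unfolding x homology_map_r_coset[OF assms ca] simplicial_homology_carrier
    using chain_map_rel_cycles[OF c assms] by blast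
  fix y assume "y \<in> carrier (simplicial_homology G n K L)"
  then obtain d where d: "d \<in> rel_cycles G n K L"
    and y: "y = rel_boundaries G n K L #>\<^bsub>chain_group G n K\<^esub> d"
    unfolding simplicial_homology_carrier by blast
  have da: "d \<in> alternating G n K" using d rel_cycles_subset by blast
  have fin: "finite (\<Union>K)" and f: "\<And>s. s \<in> K \<Longrightarrow> f ` s \<in> K'"
    using assms by (auto simp: complex_pair_def simplicial_map_def)
  have "chain_map G n K f (\<lambda>\<sigma>. c \<sigma> \<otimes> d \<sigma>) = (\<lambda>\<sigma>. chain_map G n K f c \<sigma> \<otimes> chain_map G n K f d \<sigma>)"
    using hom_mult[OF chain_map_hom[OF fin f], where x = c and y = d] ca da
    by (simp add: chain_group_def)
  moreover have "chain_map G n K f c \<in> alternating G n K'" "chain_map G n K f d \<in> alternating G n K'"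
    using hom_in_carrier[OF chain_map_hom[OF fin f]] ca da by (auto simp: chain_group_def)
  ultimately show "homology_map G n K K' L' f (x \<otimes>\<^bsub>simplicial_homology G n K L\<^esub> y) =
      homology_map G n K K' L' f x \<otimes>\<^bsub>simplicial_homology G n K' L'\<^esub> homology_map G n K K' L' f y"
    unfolding x y r_coset_rel_boundaries_mult[OF assms(1) ca da]
      homology_map_r_coset[OF assms ca] homology_map_r_coset[OF assms da]
      homology_map_r_coset[OF assms alternating_mult[OF ca da]]
    using r_coset_rel_boundaries_mult[OF assms(2)] by simp
qed

lemma homology_map_comp:
  assumes "complex_pair K L" "complex_pair K' L'" "complex_pair K'' L''"
    and f: "simplicial_map K L K' L' f" and g: "simplicial_map K' L' K'' L'' g"
    and "x \<in> carrier (simplicial_homology G n K L)"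
  shows "homology_map G n K' K'' L'' g (homology_map G n K K' L' f x) =
    homology_map G n K K'' L'' (g \<circ> f) x"
proof -
  obtain c where c: "c \<in> rel_cycles G n K L"
    and x: "x = rel_boundaries G n K L #>\<^bsub>chain_group G n K\<^esub> c"
    using assms(6) unfolding simplicial_homology_carrier by blast
  have ca: "c \<in> alternating G n K" using c rel_cycles_subset by blast
  have gf: "simplicial_map K L K'' L'' (g \<circ> f)"
    using f g unfolding simplicial_map_def by (simp only: image_comp[symmetric]) blast
  have fin: "finite (\<Union>K)" "finite (\<Union>K')" and fs: "\<And>s. s \<in> K \<Longrightarrow> f ` s \<in> K'"
    using assms by (auto simp: complex_pair_def simplicial_map_def)
  have ca': "chain_map G n K f c \<in> alternating G n K'"
    using hom_in_carrier[OF chain_map_hom[OF fin(1) fs]] ca by (simp add: chain_group_def)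
  have "push G (\<Union>K') g (push G (\<Union>K) f c) = push G (\<Union>K) (g \<circ> f) c"
    using push_push[of c "\<Union>K" "\<Union>K'" f g] alternating_closed[OF ca] fin
      simplicial_map_vertices[OF f] by blast
  then have "chain_map G n K' g (chain_map G n K f c) = chain_map G n K (g \<circ> f) c"
    using chain_map_eq_push[OF ca fin(1), of f] chain_map_eq_push[OF ca fin(1), of "g \<circ> f"]
      chain_map_eq_push[OF ca' fin(2), of g] by simp
  then show ?thesis
    unfolding x homology_map_r_coset[OF assms(1,2) f ca] homology_map_r_coset[OF assms(2,3) g ca']
      homology_map_r_coset[OF assms(1,3) gf ca] by simp
qed

lemma homology_map_cong:
  assumes "\<And>v. v \<in> \<Union>K \<Longrightarrow> f v = g v"
  shows "homology_map G n K K' L' f x = homology_map G n K K' L' g x"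
proof -
  have "{\<sigma> \<in> ordered_simplexes n K. map f \<sigma> = \<tau>} = {\<sigma> \<in> ordered_simplexes n K. map g \<sigma> = \<tau>}" for \<tau>
  proof -
    have "map f \<sigma> = map g \<sigma>" if "\<sigma> \<in> ordered_simplexes n K" for \<sigma>
      using that assms by (auto simp: ordered_simplexes_def)
    then show ?thesis by auto
  qed
  then have "chain_map G n K f = chain_map G n K g"
    by (intro ext) (simp add: chain_map_def)
  then show ?thesis by (simp add: homology_map_def)
qed

text \<open>The vertices of a list in the support are the two images of \<open>u\<close> and the
  images of the other vertices of a simplex through \<open>u\<close>; contiguity places this union
  in \<open>K'\<close>. It is applied to \<open>K\<close> and \<open>K'\<close> for the homotopy of
  a cycle, and to \<open>L\<close> and \<open>L'\<close> for the homotopy of its boundary.\<close>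

lemma homotopy_alternating:
  assumes "c \<in> alternating G n K" "finite V"
    and "\<And>s. s \<in> K \<Longrightarrow> u \<in> s \<Longrightarrow> p ` s \<union> p(u := w) ` s \<in> K'"
  shows "wedge G {p u} (wedge G {w} (push G V p (\<lambda>\<rho>. c (u # \<rho>)))) \<in> alternating G (Suc n) K'"
proof (rule alternatingI)
  have a: "antisym_function G (\<lambda>\<rho>. c (u # \<rho>))"
    by (intro antisym_function_Cons alternating_antisym[OF assms(1)])
  show "antisym_function G (wedge G {p u} (wedge G {w} (push G V p (\<lambda>\<rho>. c (u # \<rho>)))))"
    by (intro antisym_function_wedge antisym_function_push a assms(2))
  fix \<tau> assume \<tau>: "wedge G {p u} (wedge G {w} (push G V p (\<lambda>\<rho>. c (u # \<rho>)))) \<tau> \<noteq> \<one>" "distinct \<tau>"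
  obtain \<rho> where 1: "wedge G {w} (push G V p (\<lambda>\<rho>. c (u # \<rho>))) \<rho> \<noteq> \<one>"
    "set \<tau> = insert (p u) (set \<rho>)" "length \<tau> = Suc (length \<rho>)" "distinct \<rho>"
    using wedge_support[OF \<tau>] by (metis singletonD)
  obtain \<rho>' where 2: "push G V p (\<lambda>\<rho>. c (u # \<rho>)) \<rho>' \<noteq> \<one>"
    "set \<rho> = insert w (set \<rho>')" "length \<rho> = Suc (length \<rho>')"
    using wedge_support[OF 1(1,4)] by (metis singletonD)
  obtain \<sigma> where 3: "map p \<sigma> = \<rho>'" "c (u # \<sigma>) \<noteq> \<one>"
    using push_support[OF _ assms(2) 2(1)] antisym_function_closed[OF a] by metis
  have s: "u # \<sigma> \<in> ordered_simplexes n K" using alternating_support[OF assms(1) 3(2)] .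
  then have "u \<notin> set \<sigma>" by (simp add: ordered_simplexes_def)
  then have "p(u := w) ` set \<sigma> = p ` set \<sigma>" by (intro image_cong) auto
  then have "set \<tau> = p ` set (u # \<sigma>) \<union> p(u := w) ` set (u # \<sigma>)"
    using 1 2 3 by auto
  moreover have "set (u # \<sigma>) \<in> K" using s by (simp add: ordered_simplexes_def)
  ultimately have "set \<tau> \<in> K'" using assms(3)[of "set (u # \<sigma>)"] by simp
  moreover have "length \<tau> = Suc (Suc n)" using 1 2 3 s by (auto simp: ordered_simplexes_def)
  ultimately show "length \<tau> = Suc (Suc n) \<and> set \<tau> \<in> K'" by simp
qed

text \<open>The two images of a relative cycle differ by the boundary of \<open>D\<close> and by
  \<open>E\<close>. The latter lies in \<open>L'\<close>, being the homotopy applied to the boundary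
  of the cycle, which lies in \<open>L\<close>.\<close>

lemma homology_map_fun_upd:
  assumes KL: "complex_pair K L" and KL': "complex_pair K' L'"
    and cont: "contiguous K L K' L' p (p(u := w))" and u: "u \<in> \<Union>K"
    and ne: "{} \<notin> K"
    and x: "x \<in> carrier (simplicial_homology G n K L)"
  shows "homology_map G n K K' L' (p(u := w)) x = homology_map G n K K' L' p x"
proof -
  have fc: "face_closed K" "face_closed K'" "face_closed L'" "L \<subseteq> K" "L' \<subseteq> K'" "face_closed L"
    and fin: "finite (\<Union>K)" "finite (\<Union>K')"
    using KL KL' by (auto simp: complex_pair_def)
  have "{} \<notin> L" using ne fc(4) by blast
  note sm = contiguous_simplicial_map[OF fc(2,3) cont ne this]
  have sp: "simplicial_map K L K' L' p" and sq: "simplicial_map K L K' L' (p(u := w))"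
    by (rule sm(1), rule sm(2))
  obtain c where c: "c \<in> rel_cycles G n K L"
    and x: "x = rel_boundaries G n K L #>\<^bsub>chain_group G n K\<^esub> c"
    using x unfolding simplicial_homology_carrier by blast
  have ca: "c \<in> alternating G n K" using c rel_cycles_subset by blast
  let ?V = "\<Union>K" and ?V' = "\<Union>K'"
  define D where "D = wedge G {p u} (wedge G {w} (push G ?V p (\<lambda>\<rho>. c (u # \<rho>))))"
  define E where "E = wedge G {p u} (wedge G {w} (push G ?V p (\<lambda>\<rho>. full_boundary G ?V c (u # \<rho>))))"
  have K: "p ` s \<union> p(u := w) ` s \<in> K'" if "s \<in> K" for s using cont that by (simp add: contiguous_def)
  have L: "p ` s \<union> p(u := w) ` s \<in> L'" if "s \<in> L" for s using cont that by (simp add: contiguous_def)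
  \<comment> \<open>The derivation rule for \<open>full_boundary\<close> needs the new value to be a
    vertex of the target; contiguity supplies this from a simplex through \<open>u\<close>.\<close>
  have w: "w \<in> ?V'"
  proof -
    obtain s where s: "s \<in> K" "u \<in> s" using u by blast
    have "w \<in> p(u := w) ` s" by (rule image_eqI[OF _ s(2)]) simp
    then show ?thesis using K[OF s(1)] by blast
  qed
  have Da: "D \<in> alternating G (Suc n) K'"
    unfolding D_def by (rule homotopy_alternating[OF ca fin(1) K])
  have Ea: "E \<in> alternating G n L'"
  proof (cases n)
    case 0
    \<comment> \<open>Relative cycles of degree 0 carry no condition on the boundary. Here
      \<open>E\<close> is neutral because it reads \<open>c\<close> at lists with at least two
      entries.\<close>
    have "full_boundary G ?V c (u # \<rho>) = \<one>" for \<rho>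
      unfolding full_boundary_def using 0
      by (intro finprod_one_eqI alternating_outside[OF ca]) (auto simp: ordered_simplexes_def)
    then have "push G ?V p (\<lambda>\<rho>. full_boundary G ?V c (u # \<rho>)) = (\<lambda>\<rho>. \<one>)" by (intro ext) simp
    then have "E = (\<lambda>\<rho>. \<one>)" unfolding E_def by (intro ext) (simp add: wedge_eq_one)
    then show ?thesis by (simp add: alternating_one)
  next
    case (Suc m)
    have "boundary G K c \<in> alternating G m L" using c Suc by (simp add: rel_cycles_def)
    then have "full_boundary G ?V c \<in> alternating G m L"
      using boundary_eq_full_boundary[of c m K] ca Suc by simp
    then show ?thesis unfolding E_def Suc by (rule homotopy_alternating[OF _ fin(1) L])
  qed
  have pc: "chain_map G n K p c = push G ?V p c" "chain_map G n K (p(u := w)) c = push G ?V (p(u := w)) c"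
    using chain_map_eq_push[OF ca fin(1), of p] chain_map_eq_push[OF ca fin(1), of "p(u := w)"]
    by auto
  have alt: "chain_map G n K p c \<in> alternating G n K'" "chain_map G n K (p(u := w)) c \<in> alternating G n K'"
    using chain_map_rel_cycles[OF c KL KL' sp] chain_map_rel_cycles[OF c KL KL' sq] rel_cycles_subset
    by blast+
  have "(\<lambda>\<tau>. push G ?V (p(u := w)) c \<tau> \<otimes> inv (push G ?V p c \<tau>)) =
      (\<lambda>\<tau>. boundary G K' D \<tau> \<otimes> E \<tau>)"
    unfolding boundary_eq_full_boundary[OF Da]
    unfolding D_def E_def
    using simplicial_map_vertices[OF sp] w u fin alternating_antisym[OF ca]
    by (intro ext push_homotopy)
  then have "(\<lambda>\<tau>. push G ?V (p(u := w)) c \<tau> \<otimes> inv (push G ?V p c \<tau>)) \<in> rel_boundaries G n K' L'"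
    unfolding mem_rel_boundaries using Da Ea by blast
  moreover have "inv\<^bsub>chain_group G n K'\<^esub> chain_map G n K p c = (\<lambda>\<tau>. inv (push G ?V p c \<tau>))"
    using inv_chain_group[OF alt(1)] unfolding pc(1) .
  ultimately have "chain_map G n K (p(u := w)) c \<otimes>\<^bsub>chain_group G n K'\<^esub>
      inv\<^bsub>chain_group G n K'\<^esub> chain_map G n K p c \<in> rel_boundaries G n K' L'"
    unfolding pc(2) by (simp add: chain_group_def)
  then have "rel_boundaries G n K' L' #>\<^bsub>chain_group G n K'\<^esub> chain_map G n K (p(u := w)) c =
      rel_boundaries G n K' L' #>\<^bsub>chain_group G n K'\<^esub> chain_map G n K p c"
    using alt by (intro r_coset_eqI comm_group_chain_group subgroup_rel_boundaries KL')
      (auto simp: chain_group_def)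
  then show ?thesis
    unfolding x homology_map_r_coset[OF KL KL' sp ca] homology_map_r_coset[OF KL KL' sq ca] .
qed

section \<open>Relative cohomology\<close>

text \<open>Membership in \<open>ordered_simplexes n K\<close> depends only on the length, the
  absence of repetition and the vertex set, so truncation respects swaps. Both
  \<open>coboundary\<close> and \<open>cochain_map\<close> are such truncations.\<close>

lemma restrict_alternating:
  assumes "antisym_function G g"
  shows "(\<lambda>\<sigma>. if \<sigma> \<in> ordered_simplexes n K then g \<sigma> else \<one>) \<in> alternating G n K"
  unfolding alternating_iff_antisym
proof (intro conjI allI impI antisym_functionI)
  fix xs ys :: "'c list" and a b
  have "xs @ a # b # ys \<in> ordered_simplexes n K \<longleftrightarrow> xs @ b # a # ys \<in> ordered_simplexes n K"
    by (auto simp: ordered_simplexes_def insert_commute)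
  then show "(if xs @ a # b # ys \<in> ordered_simplexes n K then g (xs @ a # b # ys) else \<one>) =
      inv (if xs @ b # a # ys \<in> ordered_simplexes n K then g (xs @ b # a # ys) else \<one>)"
    using antisym_function_swap[OF assms, of xs a b ys] by (cases "xs @ a # b # ys \<in> ordered_simplexes n K") auto
  show "(if xs @ a # a # ys \<in> ordered_simplexes n K then g (xs @ a # a # ys) else \<one>) = \<one>"
    using antisym_function_eq[OF assms] by simp
qed (use antisym_function_closed[OF assms] in auto)

lemma coboundary_eq_restrict:
  assumes "c \<in> alternating G n K"
  shows "coboundary G n K c = (\<lambda>\<sigma>. if \<sigma> \<in> ordered_simplexes (Suc n) K then wedge G UNIV c \<sigma> else \<one>)"
  using coboundary_eq_wedge[of c n K] alternating_closed[OF assms] by blast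

lemma coboundary_alternating:
  assumes "c \<in> alternating G n K"
  shows "coboundary G n K c \<in> alternating G (Suc n) K"
  unfolding coboundary_eq_restrict[OF assms]
  by (intro restrict_alternating antisym_function_wedge alternating_antisym[OF assms])

lemma coboundary_mult:
  assumes "c \<in> alternating G n K" "d \<in> alternating G n K"
  shows "coboundary G n K (\<lambda>\<sigma>. c \<sigma> \<otimes> d \<sigma>) = (\<lambda>\<sigma>. coboundary G n K c \<sigma> \<otimes> coboundary G n K d \<sigma>)"
  unfolding coboundary_eq_restrict[OF assms(1)] coboundary_eq_restrict[OF assms(2)]
    coboundary_eq_restrict[OF alternating_mult[OF assms]]
  using wedge_mult[of c d] alternating_closed[OF assms(1)] alternating_closed[OF assms(2)] by auto

lemma coboundary_hom: "coboundary G n K \<in> hom (chain_group G n K) (chain_group G (Suc n) K)"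
  by (intro hom_chain_groupI coboundary_alternating) (simp_all add: coboundary_mult)

lemma subgroup_rel_cochains: "subgroup (rel_cochains G n K L) (chain_group G n K)"
  by (intro subgroup_chain_groupI)
    (auto simp: rel_cochains_def alternating_one alternating_mult alternating_inv)

lemma subgroup_rel_coboundaries:
  "subgroup (rel_coboundaries G n K L) (chain_group G n K)"
proof (cases n)
  case 0
  then show ?thesis
    by (auto simp: rel_coboundaries_def alternating_one intro!: subgroup_chain_groupI)
next
  case (Suc m)
  interpret C: comm_group "chain_group G m K" by (rule comm_group_chain_group)
  interpret C': comm_group "chain_group G (Suc m) K" by (rule comm_group_chain_group)
  interpret h: group_hom "chain_group G m K" "chain_group G (Suc m) K" "coboundary G m K"
    using coboundary_hom by unfold_locales
  show ?thesis
    using h.subgroup_img_is_subgroup[OF subgroup_rel_cochains] Suc by (simp add: rel_coboundaries_def)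
qed

lemma rel_cocycles_subset: "rel_cocycles G n K L \<subseteq> alternating G n K"
  by (auto simp: rel_cocycles_def rel_cochains_def)

lemma rel_cocycles_mult:
  assumes "c \<in> rel_cocycles G n K L" "d \<in> rel_cocycles G n K L"
  shows "(\<lambda>\<sigma>. c \<sigma> \<otimes> d \<sigma>) \<in> rel_cocycles G n K L"
proof -
  have a: "c \<in> alternating G n K" "d \<in> alternating G n K" using assms rel_cocycles_subset by blast+
  show ?thesis
    using assms alternating_mult[OF a] coboundary_mult[OF a]
    by (auto simp: rel_cocycles_def rel_cochains_def)
qed

lemma cochain_map_alternating:
  assumes "c \<in> alternating G n K'"
  shows "cochain_map G n K f c \<in> alternating G n K"
  unfolding cochain_map_def[abs_def]
  by (intro restrict_alternating antisym_function_map alternating_antisym[OF assms])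

lemma cochain_map_hom: "cochain_map G n K f \<in> hom (chain_group G n K') (chain_group G n K)"
  by (intro hom_chain_groupI cochain_map_alternating) (simp_all add: cochain_map_def)

text \<open>The coboundary at a simplex reads only its faces, and these belong to
  \<open>K\<close>.\<close>

lemma wedge_UNIV_restrict:
  assumes "face_closed K" "\<sigma> \<in> ordered_simplexes (Suc n) K"
  shows "wedge G UNIV (\<lambda>\<rho>. if \<rho> \<in> ordered_simplexes n K then g \<rho> else \<one>) \<sigma> = wedge G UNIV g \<sigma>"
  using ordered_simplexes_face[OF assms] by (intro wedge_cong) simp

lemma coboundary_cochain_map:
  assumes "c \<in> alternating G n K'" "complex_pair K L" "simplicial_map K L K' L' f"
  shows "coboundary G n K (cochain_map G n K f c) = cochain_map G (Suc n) K f (coboundary G n K' c)"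
proof
  fix \<sigma>
  note cl = alternating_closed[OF assms(1)]
  have fc: "face_closed K" and f: "\<And>s. s \<in> K \<Longrightarrow> f ` s \<in> K'"
    using assms by (auto simp: complex_pair_def simplicial_map_def)
  show "coboundary G n K (cochain_map G n K f c) \<sigma> = cochain_map G (Suc n) K f (coboundary G n K' c) \<sigma>"
  proof (cases "\<sigma> \<in> ordered_simplexes (Suc n) K")
    case False
    then show ?thesis by (simp add: coboundary_def cochain_map_def)
  next
    case True
    have "coboundary G n K (cochain_map G n K f c) \<sigma> =
        wedge G UNIV (\<lambda>\<rho>. if \<rho> \<in> ordered_simplexes n K then c (map f \<rho>) else \<one>) \<sigma>"
      unfolding coboundary_eq_restrict[OF cochain_map_alternating[OF assms(1)]]
      using True by (simp add: cochain_map_def[abs_def])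
    also have "\<dots> = wedge G UNIV c (map f \<sigma>)"
      by (simp only: wedge_UNIV_restrict[OF fc True] wedge_UNIV_map)
    also have "\<dots> = coboundary G n K' c (map f \<sigma>)"
    proof (cases "distinct (map f \<sigma>)")
      case d: True
      then have "map f \<sigma> \<in> ordered_simplexes (Suc n) K'"
        using True f by (auto simp: ordered_simplexes_def)
      then show ?thesis unfolding coboundary_eq_restrict[OF assms(1)] by simp
    next
      \<comment> \<open>At a degenerate image the right side is neutral by the truncation in
        \<open>coboundary\<close>, the left side by antisymmetry.\<close>
      case False
      then have "map f \<sigma> \<notin> ordered_simplexes (Suc n) K'" by (auto simp: ordered_simplexes_def)
      then show ?thesis
        unfolding coboundary_eq_restrict[OF assms(1)]
        using antisym_function_not_distinct[OF antisym_function_wedge[OF alternating_antisym[OF assms(1)]] False]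
        by simp
    qed
    finally show ?thesis using True by (simp add: cochain_map_def)
  qed
qed

lemma cochain_map_rel_cochains:
  assumes "c \<in> rel_cochains G n K' L'" "simplicial_map K L K' L' f"
  shows "cochain_map G n K f c \<in> rel_cochains G n K L"
proof -
  have c: "c \<in> alternating G n K'" "\<And>\<sigma>. \<sigma> \<in> ordered_simplexes n L' \<Longrightarrow> c \<sigma> = \<one>"
    and f: "\<And>s. s \<in> L \<Longrightarrow> f ` s \<in> L'"
    using assms by (auto simp: rel_cochains_def simplicial_map_def)
  have "c (map f \<sigma>) = \<one>" if "\<sigma> \<in> ordered_simplexes n L" for \<sigma>
  proof (cases "distinct (map f \<sigma>)")
    case True
    then show ?thesis using that f by (intro c(2)) (auto simp: ordered_simplexes_def)
  qed (rule antisym_function_not_distinct[OF alternating_antisym[OF c(1)]])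
  then show ?thesis
    using cochain_map_alternating[OF c(1)] by (simp add: rel_cochains_def cochain_map_def)
qed

lemma cochain_map_rel_cocycles:
  assumes "c \<in> rel_cocycles G n K' L'" "complex_pair K L" "simplicial_map K L K' L' f"
  shows "cochain_map G n K f c \<in> rel_cocycles G n K L"
proof -
  have c: "c \<in> rel_cochains G n K' L'" "coboundary G n K' c = (\<lambda>\<sigma>. \<one>)" "c \<in> alternating G n K'"
    using assms by (auto simp: rel_cocycles_def rel_cochains_def)
  have "coboundary G n K (cochain_map G n K f c) = (\<lambda>\<sigma>. \<one>)"
    unfolding coboundary_cochain_map[OF c(3) assms(2,3)] c(2) by (auto simp: cochain_map_def)
  then show ?thesis
    using cochain_map_rel_cochains[OF c(1) assms(3)] by (simp add: rel_cocycles_def)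
qed

lemma cochain_map_rel_coboundaries:
  assumes "complex_pair K L" "simplicial_map K L K' L' f"
  shows "cochain_map G n K f ` rel_coboundaries G n K' L' \<subseteq> rel_coboundaries G n K L"
proof (cases n)
  case 0
  then show ?thesis by (auto simp: rel_coboundaries_def cochain_map_def)
next
  case (Suc m)
  have "cochain_map G (Suc m) K f (coboundary G m K' c) \<in> coboundary G m K ` rel_cochains G m K L"
    if c: "c \<in> rel_cochains G m K' L'" for c
  proof -
    have "c \<in> alternating G m K'" using c by (simp add: rel_cochains_def)
    from coboundary_cochain_map[OF this assms] cochain_map_rel_cochains[OF c assms(2)]
    show ?thesis by (metis image_eqI)
  qed
  then show ?thesis using Suc by (auto simp: rel_coboundaries_def)
qed

lemma simplicial_cohomology_carrier:
  "carrier (simplicial_cohomology G n K L) =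
     (\<lambda>c. rel_coboundaries G n K L #>\<^bsub>chain_group G n K\<^esub> c) ` rel_cocycles G n K L"
  by (auto simp: simplicial_cohomology_def FactGroup_def RCOSETS_def r_coset_def)

lemma simplicial_cohomology_mult:
  "monoid.mult (simplicial_cohomology G n K L) = set_mult (chain_group G n K)"
  by (auto simp: simplicial_cohomology_def FactGroup_def set_mult_def fun_eq_iff)

lemma r_coset_rel_coboundaries_mult:
  assumes "c \<in> alternating G n K" "d \<in> alternating G n K"
  shows "(rel_coboundaries G n K L #>\<^bsub>chain_group G n K\<^esub> c) \<otimes>\<^bsub>simplicial_cohomology G n K L\<^esub>
      (rel_coboundaries G n K L #>\<^bsub>chain_group G n K\<^esub> d) =
     rel_coboundaries G n K L #>\<^bsub>chain_group G n K\<^esub> (\<lambda>\<sigma>. c \<sigma> \<otimes> d \<sigma>)"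
proof -
  interpret C: comm_group "chain_group G n K" by (rule comm_group_chain_group)
  have "rel_coboundaries G n K L \<lhd> chain_group G n K"
    using C.subgroup_imp_normal subgroup_rel_coboundaries by blast
  from normal.rcos_sum[OF this, of c d] assms show ?thesis
    unfolding simplicial_cohomology_mult by (simp add: chain_group_def)
qed

lemma cohomology_map_r_coset:
  assumes "complex_pair K L" "simplicial_map K L K' L' f" "c \<in> alternating G n K'"
  shows "cohomology_map G n K L f (rel_coboundaries G n K' L' #>\<^bsub>chain_group G n K'\<^esub> c) =
     rel_coboundaries G n K L #>\<^bsub>chain_group G n K\<^esub> cochain_map G n K f c"
  unfolding cohomology_map_def
  using assms(3) by (intro homomorphic_image_r_coset comm_group_chain_group cochain_map_hom
      subgroup_rel_coboundaries cochain_map_rel_coboundaries[OF assms(1,2)])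
    (auto simp: chain_group_def)

lemma simplicial_cohomology_closed:
  assumes "x \<in> carrier (simplicial_cohomology G n K L)" "y \<in> carrier (simplicial_cohomology G n K L)"
  shows "x \<otimes>\<^bsub>simplicial_cohomology G n K L\<^esub> y \<in> carrier (simplicial_cohomology G n K L)"
proof -
  obtain c d where cd: "c \<in> rel_cocycles G n K L" "d \<in> rel_cocycles G n K L"
    and x: "x = rel_coboundaries G n K L #>\<^bsub>chain_group G n K\<^esub> c"
    and y: "y = rel_coboundaries G n K L #>\<^bsub>chain_group G n K\<^esub> d"
    using assms unfolding simplicial_cohomology_carrier by blast
  then have "c \<in> alternating G n K" "d \<in> alternating G n K" using rel_cocycles_subset by blast+
  then show ?thesis
    unfolding x y r_coset_rel_coboundaries_mult[OF \<open>c \<in> alternating G n K\<close> \<open>d \<in> alternating G n K\<close>]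
    using rel_cocycles_mult[OF cd] by (auto simp: simplicial_cohomology_carrier)
qed

lemma cohomology_map_hom:
  assumes "complex_pair K L" "simplicial_map K L K' L' f"
  shows "cohomology_map G n K L f \<in>
    hom (simplicial_cohomology G n K' L') (simplicial_cohomology G n K L)"
proof (rule homI)
  fix x assume "x \<in> carrier (simplicial_cohomology G n K' L')"
  then obtain c where c: "c \<in> rel_cocycles G n K' L'"
    and x: "x = rel_coboundaries G n K' L' #>\<^bsub>chain_group G n K'\<^esub> c"
    unfolding simplicial_cohomology_carrier by blast
  have ca: "c \<in> alternating G n K'" using c rel_cocycles_subset by blast
  show "cohomology_map G n K L f x \<in> carrier (simplicial_cohomology G n K L)"
    unfolding x cohomology_map_r_coset[OF assms ca] simplicial_cohomology_carrier
    using cochain_map_rel_cocycles[OF c assms] by blast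
  fix y assume "y \<in> carrier (simplicial_cohomology G n K' L')"
  then obtain d where d: "d \<in> rel_cocycles G n K' L'"
    and y: "y = rel_coboundaries G n K' L' #>\<^bsub>chain_group G n K'\<^esub> d"
    unfolding simplicial_cohomology_carrier by blast
  have da: "d \<in> alternating G n K'" using d rel_cocycles_subset by blast
  have "cochain_map G n K f (\<lambda>\<sigma>. c \<sigma> \<otimes> d \<sigma>) =
      (\<lambda>\<sigma>. cochain_map G n K f c \<sigma> \<otimes> cochain_map G n K f d \<sigma>)"
    by (auto simp: cochain_map_def)
  then show "cohomology_map G n K L f (x \<otimes>\<^bsub>simplicial_cohomology G n K' L'\<^esub> y) =
      cohomology_map G n K L f x \<otimes>\<^bsub>simplicial_cohomology G n K L\<^esub> cohomology_map G n K L f y"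
    unfolding x y r_coset_rel_coboundaries_mult[OF ca da]
      cohomology_map_r_coset[OF assms ca] cohomology_map_r_coset[OF assms da]
      cohomology_map_r_coset[OF assms alternating_mult[OF ca da]]
    using r_coset_rel_coboundaries_mult[OF cochain_map_alternating[OF ca, of K f]
        cochain_map_alternating[OF da, of K f], of L]
    by simp
qed

lemma cohomology_map_comp:
  assumes "complex_pair K L" "complex_pair K' L'"
    and f: "simplicial_map K L K' L' f" and g: "simplicial_map K' L' K'' L'' g"
    and "x \<in> carrier (simplicial_cohomology G n K'' L'')"
  shows "cohomology_map G n K L f (cohomology_map G n K' L' g x) = cohomology_map G n K L (g \<circ> f) x"
proof -
  obtain c where c: "c \<in> rel_cocycles G n K'' L''"
    and x: "x = rel_coboundaries G n K'' L'' #>\<^bsub>chain_group G n K''\<^esub> c"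
    using assms(5) unfolding simplicial_cohomology_carrier by blast
  have ca: "c \<in> alternating G n K''" using c rel_cocycles_subset by blast
  have gf: "simplicial_map K L K'' L'' (g \<circ> f)"
    using f g unfolding simplicial_map_def by (simp only: image_comp[symmetric]) blast
  have fs: "\<And>s. s \<in> K \<Longrightarrow> f ` s \<in> K'" using f by (simp add: simplicial_map_def)
  note cg = cochain_map_alternating[OF ca, of K' g]
  have "cochain_map G n K f (cochain_map G n K' g c) \<sigma> = cochain_map G n K (g \<circ> f) c \<sigma>" for \<sigma>
  \<comment> \<open>If \<open>f\<close> collapses the simplex, the inner pullback is truncated to
    the neutral element. The composite agrees, because the image under \<open>g \<circ> f\<close>
    has a repetition as well.\<close>
  proof (cases "\<sigma> \<in> ordered_simplexes n K \<and> \<not> distinct (map f \<sigma>)")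
    case True
    then have "\<not> distinct (map (g \<circ> f) \<sigma>)"
      unfolding map_map[symmetric] using distinct_map by blast
    then have "c (map (g \<circ> f) \<sigma>) = \<one>"
      by (rule antisym_function_not_distinct[OF alternating_antisym[OF ca]])
    then show ?thesis using True by (auto simp: cochain_map_def ordered_simplexes_def)
  next
    case False
    then show ?thesis using fs by (auto simp: cochain_map_def ordered_simplexes_def)
  qed
  then have "cochain_map G n K f (cochain_map G n K' g c) = cochain_map G n K (g \<circ> f) c" by blast
  then show ?thesis
    unfolding x cohomology_map_r_coset[OF assms(2) g ca] cohomology_map_r_coset[OF assms(1) f cg]
      cohomology_map_r_coset[OF assms(1) gf ca] by simp
qed

lemma cohomology_map_cong:
  assumes "\<And>v. v \<in> \<Union>K \<Longrightarrow> f v = g v"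
  shows "cohomology_map G n K L f x = cohomology_map G n K L g x"
proof -
  have "cochain_map G n K f c \<sigma> = cochain_map G n K g c \<sigma>" for c \<sigma>
  proof (cases "\<sigma> \<in> ordered_simplexes n K")
    case True
    then have "map f \<sigma> = map g \<sigma>" using assms by (auto simp: ordered_simplexes_def)
    then show ?thesis by (simp only: cochain_map_def)
  qed (simp add: cochain_map_def)
  then have "cochain_map G n K f = cochain_map G n K g" by blast
  then show ?thesis by (simp add: cohomology_map_def)
qed

text \<open>Removing \<open>u\<close> from \<open>\<sigma>\<close> and prefixing \<open>p u\<close>
  and \<open>w\<close> gives a list with repetition or, by contiguity, an enumeration of a simplex
  of \<open>K'\<close>. It is used with the coboundary of a cocycle on \<open>K'\<close>, and with
  the cocycle itself on \<open>L'\<close>.\<close>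

lemma contiguous_pullback_eq_one:
  assumes "antisym_function G c" "\<And>\<rho>. \<rho> \<in> ordered_simplexes n K' \<Longrightarrow> c \<rho> = \<one>"
    and "\<sigma> \<in> ordered_simplexes m K" "n = Suc m"
    and "\<And>s. s \<in> K \<Longrightarrow> p ` s \<union> p(u := w) ` s \<in> K'"
  shows "wedge G {u} (\<lambda>\<rho>. c (p u # w # map p \<rho>)) \<sigma> = \<one>"
proof (rule wedge_eq_one)
  fix i assume i: "i < length \<sigma>" "\<sigma> ! i \<in> {u}"
  let ?\<rho> = "take i \<sigma> @ drop (Suc i) \<sigma>"
  have \<sigma>: "distinct \<sigma>" "length \<sigma> = Suc m" "set \<sigma> \<in> K"
    using assms(3) by (auto simp: ordered_simplexes_def)
  have s: "set \<sigma> = insert u (set ?\<rho>)" "u \<notin> set ?\<rho>"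
    using set_take_drop_Suc[OF i(1)] distinct_take_drop_Suc(2)[OF \<sigma>(1) i(1)] i(2) by auto
  have "p(u := w) ` set ?\<rho> = p ` set ?\<rho>" using s(2) by (intro image_cong) auto
  then have "p ` set \<sigma> \<union> p(u := w) ` set \<sigma> = insert (p u) (p ` set ?\<rho>) \<union> insert w (p ` set ?\<rho>)"
    unfolding s(1) image_insert by simp
  also have "\<dots> = set (p u # w # map p ?\<rho>)"
    unfolding list.set list.set_map by blast
  finally have "set (p u # w # map p ?\<rho>) = p ` set \<sigma> \<union> p(u := w) ` set \<sigma>" by (rule sym)
  then have K': "set (p u # w # map p ?\<rho>) \<in> K'" using assms(5)[OF \<sigma>(3)] by simp
  show "c (p u # w # map p ?\<rho>) = \<one>"
  proof (cases "distinct (p u # w # map p ?\<rho>)")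
    case True
    then show ?thesis
      using K' \<sigma>(2) assms(4) i(1) unfolding ordered_simplexes_def
      by (intro assms(2)) (simp add: ordered_simplexes_def)
  qed (rule antisym_function_not_distinct[OF assms(1)])
qed

text \<open>On simplexes of \<open>K\<close> the second term of \<open>pullback_homotopy\<close>
  vanishes because \<open>c\<close> is a cocycle. The difference of the pullbacks is thus the
  coboundary of the homotopy \<open>g\<close>, which vanishes on \<open>L\<close> because
  \<open>c\<close> vanishes on \<open>L'\<close>.\<close>

lemma cohomology_map_fun_upd:
  assumes KL: "complex_pair K L" and KL': "complex_pair K' L'"
    and cont: "contiguous K L K' L' p (p(u := w))" and ne: "{} \<notin> K"
    and x: "x \<in> carrier (simplicial_cohomology G n K' L')"
  shows "cohomology_map G n K L (p(u := w)) x = cohomology_map G n K L p x"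
proof -
  have fc: "face_closed K" "face_closed K'" "face_closed L'" "L \<subseteq> K" "L' \<subseteq> K'" "face_closed L"
    using KL KL' by (auto simp: complex_pair_def)
  have "{} \<notin> L" using ne fc(4) by blast
  note sm = contiguous_simplicial_map[OF fc(2,3) cont ne this]
  obtain c where c: "c \<in> rel_cocycles G n K' L'"
    and x: "x = rel_coboundaries G n K' L' #>\<^bsub>chain_group G n K'\<^esub> c"
    using x unfolding simplicial_cohomology_carrier by blast
  have ca: "c \<in> alternating G n K'" using c rel_cocycles_subset by blast
  note cl = alternating_closed[OF ca] and as = alternating_antisym[OF ca]
  have cL: "c \<rho> = \<one>" if "\<rho> \<in> ordered_simplexes n L'" for \<rho>
    using c that by (simp add: rel_cocycles_def rel_cochains_def)
  have dc: "wedge G UNIV c \<rho> = \<one>" if "\<rho> \<in> ordered_simplexes (Suc n) K'" for \<rho>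
    using c that fun_cong[OF coboundary_eq_restrict[OF ca], of \<rho>]
    by (simp add: rel_cocycles_def)
  have K: "p ` s \<union> p(u := w) ` s \<in> K'" if "s \<in> K" for s using cont that by (simp add: contiguous_def)
  have L: "p ` s \<union> p(u := w) ` s \<in> L'" if "s \<in> L" for s using cont that by (simp add: contiguous_def)
  define g where "g = wedge G {u} (\<lambda>\<rho>. c (p u # w # map p \<rho>))"
  have ag: "antisym_function G g"
    unfolding g_def
    by (intro antisym_function_wedge antisym_function_map[of G "\<lambda>\<rho>. c (p u # w # \<rho>)"]
        antisym_function_Cons[of G "\<lambda>\<rho>. c (p u # \<rho>)"] antisym_function_Cons[OF as])
  have eq: "c (map (p(u := w)) \<sigma>) \<otimes> inv (c (map p \<sigma>)) = wedge G UNIV g \<sigma>"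
    if "\<sigma> \<in> ordered_simplexes n K" for \<sigma>
  proof -
    have "wedge G {u} (\<lambda>\<rho>. wedge G UNIV c (p u # w # map p \<rho>)) \<sigma> = \<one>"
      by (rule contiguous_pullback_eq_one[OF antisym_function_wedge[OF as] dc that refl K])
    moreover have "wedge G UNIV g \<sigma> \<in> carrier G"
      using antisym_function_closed[OF ag] by (rule wedge_closed)
    moreover have "distinct \<sigma>" using that by (simp add: ordered_simplexes_def)
    ultimately show ?thesis
      using pullback_homotopy[OF as, of \<sigma> p u w] unfolding g_def by simp
  qed
  let ?d = "\<lambda>\<sigma>. cochain_map G n K (p(u := w)) c \<sigma> \<otimes> inv (cochain_map G n K p c \<sigma>)"
  have d: "?d \<sigma> = (if \<sigma> \<in> ordered_simplexes n K then wedge G UNIV g \<sigma> else \<one>)" for \<sigma>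
    using eq[of \<sigma>] by (simp add: cochain_map_def)
  have "?d \<in> rel_coboundaries G n K L"
  proof (cases n)
    case 0
    \<comment> \<open>There are no cochains of degree -1; the difference reduces to the value of
      \<open>g\<close> at the empty list, which is neutral.\<close>
    have "?d \<sigma> = \<one>" for \<sigma>
    proof (cases "\<sigma> \<in> ordered_simplexes n K")
      case True
      then obtain v where "\<sigma> = [v]" using 0 by (auto simp: ordered_simplexes_def length_Suc_conv)
      then show ?thesis using d[of \<sigma>] by (simp add: g_def)
    qed (simp add: d)
    then show ?thesis using 0 by (simp add: rel_coboundaries_def)
  next
    case (Suc m)
    \<comment> \<open>\<open>g\<close> need not be supported on \<open>K\<close>; its truncation has
      the same coboundary on simplexes of \<open>K\<close>.\<close>
    let ?h = "\<lambda>\<rho>. if \<rho> \<in> ordered_simplexes m K then g \<rho> else \<one>"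
    have h: "?h \<in> alternating G m K" using restrict_alternating[OF ag] .
    have "g \<rho> = \<one>" if "\<rho> \<in> ordered_simplexes m L" for \<rho>
      unfolding g_def by (rule contiguous_pullback_eq_one[OF as cL that Suc L])
    then have "?h \<in> rel_cochains G m K L" using h by (simp add: rel_cochains_def)
    moreover have "?d = coboundary G m K ?h"
    proof
      fix \<sigma>
      show "?d \<sigma> = coboundary G m K ?h \<sigma>"
        unfolding d coboundary_eq_restrict[OF h]
        using wedge_UNIV_restrict[OF fc(1), of \<sigma> m g] Suc by simp
    qed
    ultimately show ?thesis using Suc by (auto simp: rel_coboundaries_def)
  qed
  then have "cochain_map G n K (p(u := w)) c \<otimes>\<^bsub>chain_group G n K\<^esub>
      inv\<^bsub>chain_group G n K\<^esub> cochain_map G n K p c \<in> rel_coboundaries G n K L"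
    unfolding inv_chain_group[OF cochain_map_alternating[OF ca]] by (simp add: chain_group_def)
  then have "rel_coboundaries G n K L #>\<^bsub>chain_group G n K\<^esub> cochain_map G n K (p(u := w)) c =
      rel_coboundaries G n K L #>\<^bsub>chain_group G n K\<^esub> cochain_map G n K p c"
    using cochain_map_alternating[OF ca]
    by (intro r_coset_eqI comm_group_chain_group subgroup_rel_coboundaries)
      (auto simp: chain_group_def)
  then show ?thesis
    unfolding x cohomology_map_r_coset[OF KL sm(1) ca] cohomology_map_r_coset[OF KL sm(2) ca] .
qed

end

section \<open>Cofinal maps of directed systems\<close>

text \<open>Closure of the source under multiplication is all it takes to carry products back along
  the bijection. In this form the lemma applies to the limits, for which only closure is
  established.\<close>

lemma is_iso_sym_closed:
  assumes "M \<cong> N" and closed: "\<And>x y. x \<in> carrier M \<Longrightarrow> y \<in> carrier M \<Longrightarrow> x \<otimes>\<^bsub>M\<^esub> y \<in> carrier M"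
  shows "N \<cong> M"
proof -
  obtain k where k: "k \<in> hom M N" "bij_betw k (carrier M) (carrier N)"
    using assms(1) by (auto simp: is_iso_def iso_def)
  let ?k = "inv_into (carrier M) k"
  have k': "bij_betw ?k (carrier N) (carrier M)" using k(2) by (rule bij_betw_inv_into)
  have kc: "?k u \<in> carrier M" "k (?k u) = u" if "u \<in> carrier N" for u
    using that k(2) bij_betw_apply[OF k'] by (auto simp: bij_betw_inv_into_right)
  have "?k (u \<otimes>\<^bsub>N\<^esub> v) = ?k u \<otimes>\<^bsub>M\<^esub> ?k v" if c: "u \<in> carrier N" "v \<in> carrier N" for u v
  proof -
    have "u \<otimes>\<^bsub>N\<^esub> v = k (?k u \<otimes>\<^bsub>M\<^esub> ?k v)"
      using hom_mult[OF k(1) kc(1)[OF c(1)] kc(1)[OF c(2)]] kc(2)[OF c(1)] kc(2)[OF c(2)] by simp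
    then show ?thesis
      using bij_betw_inv_into_left[OF k(2) closed[OF kc(1)[OF c(1)] kc(1)[OF c(2)]]] by simp
  qed
  then have "?k \<in> hom N M" using kc by (intro homI)
  then show ?thesis using k' by (auto simp: is_iso_def iso_def)
qed

section \<open>Inverse limits\<close>

lemma inverse_limit_iff:
  "x \<in> carrier (inverse_limit I r H \<phi>) \<longleftrightarrow>
     x \<in> (\<Pi>\<^sub>E i\<in>I. carrier (H i)) \<and> (\<forall>i\<in>I. \<forall>j\<in>I. r i j \<longrightarrow> \<phi> i j (x j) = x i)"
  by (simp add: inverse_limit_def)

lemma inverse_limit_mult:
  "x \<otimes>\<^bsub>inverse_limit I r H \<phi>\<^esub> y = (\<lambda>i\<in>I. x i \<otimes>\<^bsub>H i\<^esub> y i)"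
  by (simp add: inverse_limit_def product_group_def)

lemma inverse_limit_closed:
  assumes hom: "\<And>i j. i \<in> I \<Longrightarrow> j \<in> I \<Longrightarrow> r i j \<Longrightarrow> \<phi> i j \<in> hom (H j) (H i)"
    and closed: "\<And>i x y. i \<in> I \<Longrightarrow> x \<in> carrier (H i) \<Longrightarrow> y \<in> carrier (H i) \<Longrightarrow> x \<otimes>\<^bsub>H i\<^esub> y \<in> carrier (H i)"
    and x: "x \<in> carrier (inverse_limit I r H \<phi>)" and y: "y \<in> carrier (inverse_limit I r H \<phi>)"
  shows "x \<otimes>\<^bsub>inverse_limit I r H \<phi>\<^esub> y \<in> carrier (inverse_limit I r H \<phi>)"
  unfolding inverse_limit_iff inverse_limit_mult
proof (intro conjI ballI impI)
  have xy: "x i \<in> carrier (H i)" "y i \<in> carrier (H i)" if "i \<in> I" for i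
    using x y that unfolding inverse_limit_iff by (auto dest: PiE_mem)
  then show "(\<lambda>i\<in>I. x i \<otimes>\<^bsub>H i\<^esub> y i) \<in> (\<Pi>\<^sub>E i\<in>I. carrier (H i))" using closed by auto
  fix i j assume ij: "i \<in> I" "j \<in> I" "r i j"
  have "\<phi> i j (x j) = x i" "\<phi> i j (y j) = y i" using ij x y unfolding inverse_limit_iff by auto
  then show "\<phi> i j ((\<lambda>i\<in>I. x i \<otimes>\<^bsub>H i\<^esub> y i) j) = (\<lambda>i\<in>I. x i \<otimes>\<^bsub>H i\<^esub> y i) i"
    using ij hom_mult[OF hom[OF ij] xy(1)[OF ij(2)] xy(2)[OF ij(2)]] by simp
qed

text \<open>Restriction along \<open>\<Psi>\<close> is injective because every coordinate is the
  image of a cofinal one. For surjectivity a compatible family on \<open>J\<close> is extended by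
  transport from any later index; directedness of \<open>J\<close> makes the result independent of
  that index. Transition maps are compared on carriers only, since as functions on sets they depend
  on the chosen projections.\<close>

lemma inverse_limit_cofinal:
  fixes \<Psi> :: "'j \<Rightarrow> 'i"
  assumes hom: "\<And>i j. i \<in> I \<Longrightarrow> j \<in> I \<Longrightarrow> r i j \<Longrightarrow> \<phi> i j \<in> hom (H j) (H i)"
    and comp: "\<And>i j k x. i \<in> I \<Longrightarrow> j \<in> I \<Longrightarrow> k \<in> I \<Longrightarrow> r i j \<Longrightarrow> r j k \<Longrightarrow> x \<in> carrier (H k) \<Longrightarrow>
            r i k \<and> \<phi> i j (\<phi> j k x) = \<phi> i k x"
    and directed: "\<And>j k. j \<in> J \<Longrightarrow> k \<in> J \<Longrightarrow> \<exists>l\<in>J. r' j l \<and> r' k l"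
    and refl: "\<And>j. j \<in> J \<Longrightarrow> r' j j"
    and \<Psi>: "\<And>j. j \<in> J \<Longrightarrow> \<Psi> j \<in> I"
    and mono: "\<And>j k. j \<in> J \<Longrightarrow> k \<in> J \<Longrightarrow> r' j k \<Longrightarrow> r (\<Psi> j) (\<Psi> k)"
    and cofinal: "\<And>i. i \<in> I \<Longrightarrow> \<exists>j\<in>J. r i (\<Psi> j)"
    and H': "\<And>j. j \<in> J \<Longrightarrow> H' j = H (\<Psi> j)"
    and \<phi>': "\<And>j k x. j \<in> J \<Longrightarrow> k \<in> J \<Longrightarrow> r' j k \<Longrightarrow> x \<in> carrier (H' k) \<Longrightarrow>
            \<phi>' j k x = \<phi> (\<Psi> j) (\<Psi> k) x"
  shows "(\<lambda>x. \<lambda>j\<in>J. x (\<Psi> j)) \<in> iso (inverse_limit I r H \<phi>) (inverse_limit J r' H' \<phi>')"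
    (is "?h \<in> iso ?A ?B")
proof -
  have A: "x i \<in> carrier (H i)" if "x \<in> carrier ?A" "i \<in> I" for x i
    using that unfolding inverse_limit_iff by (auto dest: PiE_mem)
  have Ac: "\<phi> i j (x j) = x i" if "x \<in> carrier ?A" "i \<in> I" "j \<in> I" "r i j" for x i j
    using that unfolding inverse_limit_iff by blast
  have B: "y j \<in> carrier (H (\<Psi> j))" if "y \<in> carrier ?B" "j \<in> J" for y j
    using that H'[OF that(2)] unfolding inverse_limit_iff by (auto dest: PiE_mem)
  have Bc: "\<phi> (\<Psi> j) (\<Psi> k) (y k) = y j" if "y \<in> carrier ?B" "j \<in> J" "k \<in> J" "r' j k" for y j k
    using \<phi>'[OF that(2-4), of "y k"] B[OF that(1,3)] H'[OF that(3)] that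
    unfolding inverse_limit_iff by simp
  have hom_h: "?h \<in> hom ?A ?B"
  proof (rule homI)
    fix x assume x: "x \<in> carrier ?A"
    show "?h x \<in> carrier ?B"
      unfolding inverse_limit_iff
    proof (intro conjI ballI impI)
      show "?h x \<in> (\<Pi>\<^sub>E j\<in>J. carrier (H' j))" using A[OF x] \<Psi> H' by auto
      fix j k assume jk: "j \<in> J" "k \<in> J" "r' j k"
      then show "\<phi>' j k (?h x k) = ?h x j"
        using \<phi>'[OF jk, of "x (\<Psi> k)"] A[OF x] \<Psi> H' Ac[OF x] mono by simp
    qed
    fix y assume y: "y \<in> carrier ?A"
    show "?h (x \<otimes>\<^bsub>?A\<^esub> y) = ?h x \<otimes>\<^bsub>?B\<^esub> ?h y"
      unfolding inverse_limit_mult using \<Psi> H' by (auto intro!: restrict_ext)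
  qed
  have "inj_on ?h (carrier ?A)"
  proof (rule inj_onI)
    fix x y assume x: "x \<in> carrier ?A" and y: "y \<in> carrier ?A" and eq: "?h x = ?h y"
    show "x = y"
    proof (rule PiE_ext)
      show "x \<in> (\<Pi>\<^sub>E i\<in>I. carrier (H i))" "y \<in> (\<Pi>\<^sub>E i\<in>I. carrier (H i))"
        using x y unfolding inverse_limit_iff by auto
      fix i assume i: "i \<in> I"
      then obtain j where j: "j \<in> J" "r i (\<Psi> j)" using cofinal by blast
      have "x (\<Psi> j) = y (\<Psi> j)" using fun_cong[OF eq, of j] j(1) by simp
      then show "x i = y i"
        using Ac[OF x i \<Psi>[OF j(1)] j(2)] Ac[OF y i \<Psi>[OF j(1)] j(2)] by simp
    qed
  qed
  moreover have "?h ` carrier ?A = carrier ?B"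
  proof (intro equalityI subsetI)
    show "y \<in> carrier ?B" if "y \<in> ?h ` carrier ?A" for y
      using that hom_in_carrier[OF hom_h] by blast
    fix y assume y: "y \<in> carrier ?B"
    define c where "c i = (SOME j. j \<in> J \<and> r i (\<Psi> j))" for i
    have c: "c i \<in> J" "r i (\<Psi> (c i))" if "i \<in> I" for i
      using someI_ex[of "\<lambda>j. j \<in> J \<and> r i (\<Psi> j)"] cofinal[OF that] unfolding c_def by auto
    define x where "x = (\<lambda>i\<in>I. \<phi> i (\<Psi> (c i)) (y (c i)))"
    have indep: "\<phi> i (\<Psi> j) (y j) = \<phi> i (\<Psi> k) (y k)"
      if i: "i \<in> I" and j: "j \<in> J" "r i (\<Psi> j)" and k: "k \<in> J" "r i (\<Psi> k)" for i j k
    proof -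
      obtain l where l: "l \<in> J" "r' j l" "r' k l" using directed[OF j(1) k(1)] by blast
      have *: "\<phi> i (\<Psi> m) (y m) = \<phi> i (\<Psi> l) (y l)" if "m \<in> J" "r i (\<Psi> m)" "r' m l" for m
        using comp[OF i \<Psi>[OF that(1)] \<Psi>[OF l(1)] that(2) mono[OF that(1) l(1) that(3)] B[OF y l(1)]]
          Bc[OF y that(1) l(1) that(3)] by simp
      show ?thesis using *[OF j l(2)] *[OF k l(3)] by simp
    qed
    have xi: "x i = \<phi> i (\<Psi> j) (y j)" if "i \<in> I" "j \<in> J" "r i (\<Psi> j)" for i j
      using indep[OF that(1) c[OF that(1)] that(2,3)] that(1) by (simp add: x_def)
    have "x \<in> carrier ?A"
      unfolding inverse_limit_iff
    proof (intro conjI ballI impI)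
      have "x i \<in> carrier (H i)" if "i \<in> I" for i
        using xi[OF that c[OF that]] hom_in_carrier[OF hom[OF that \<Psi>[OF c(1)[OF that]] c(2)[OF that]]]
          B[OF y c(1)[OF that]] by simp
      then show "x \<in> (\<Pi>\<^sub>E i\<in>I. carrier (H i))" by (auto simp: x_def)
      fix i k assume ik: "i \<in> I" "k \<in> I" "r i k"
      have *: "r i (\<Psi> (c k)) \<and> \<phi> i k (\<phi> k (\<Psi> (c k)) (y (c k))) = \<phi> i (\<Psi> (c k)) (y (c k))"
        by (rule comp[OF ik(1,2) \<Psi>[OF c(1)[OF ik(2)]] ik(3) c(2)[OF ik(2)] B[OF y c(1)[OF ik(2)]]])
      then show "\<phi> i k (x k) = x i"
        using xi[OF ik(2) c[OF ik(2)]] xi[OF ik(1) c(1)[OF ik(2)]] by simp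
    qed
    moreover have "?h x = y"
    proof (rule PiE_ext)
      show "y \<in> (\<Pi>\<^sub>E j\<in>J. carrier (H' j))" using y unfolding inverse_limit_iff by blast
      show "?h x \<in> (\<Pi>\<^sub>E j\<in>J. carrier (H' j))"
        using hom_in_carrier[OF hom_h calculation] unfolding inverse_limit_iff by blast
      fix j assume j: "j \<in> J"
      \<comment> \<open>The index \<open>j\<close> serves as its own later index:
        \<open>\<phi> (\<Psi> j) (\<Psi> j)\<close> fixes \<open>y j\<close> by compatibility of
        \<open>y\<close> along \<open>r' j j\<close>.\<close>
      show "?h x j = y j"
        using j xi[OF \<Psi>[OF j] j mono[OF j j refl[OF j]]] Bc[OF y j j refl[OF j]] by simp
    qed
    ultimately show "y \<in> ?h ` carrier ?A" by blast
  qed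
  ultimately show ?thesis using hom_h by (simp add: iso_def bij_betw_def)
qed

section \<open>Direct limits\<close>

locale direct_system =
  fixes I :: "'i set" and r :: "'i \<Rightarrow> 'i \<Rightarrow> bool" and H :: "'i \<Rightarrow> 'h monoid"
    and \<phi> :: "'i \<Rightarrow> 'i \<Rightarrow> 'h \<Rightarrow> 'h"
  assumes hom: "\<And>i j. i \<in> I \<Longrightarrow> j \<in> I \<Longrightarrow> r i j \<Longrightarrow> \<phi> i j \<in> hom (H i) (H j)"
    and transition_comp: "\<And>i j k x. i \<in> I \<Longrightarrow> j \<in> I \<Longrightarrow> k \<in> I \<Longrightarrow> r i j \<Longrightarrow> r j k \<Longrightarrow> x \<in> carrier (H i) \<Longrightarrow>
            \<phi> j k (\<phi> i j x) = \<phi> i k x"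
    and trans: "\<And>i j k. i \<in> I \<Longrightarrow> j \<in> I \<Longrightarrow> k \<in> I \<Longrightarrow> r i j \<Longrightarrow> r j k \<Longrightarrow> r i k"
    and refl: "\<And>i. i \<in> I \<Longrightarrow> r i i"
    and directed: "\<And>i j. i \<in> I \<Longrightarrow> j \<in> I \<Longrightarrow> \<exists>k\<in>I. r i k \<and> r j k"
    and closed: "\<And>i x y. i \<in> I \<Longrightarrow> x \<in> carrier (H i) \<Longrightarrow> y \<in> carrier (H i) \<Longrightarrow> x \<otimes>\<^bsub>H i\<^esub> y \<in> carrier (H i)"
begin

abbreviation rel where "rel \<equiv> direct_limit_rel I r H \<phi>"

lemma rel_iff:
  "((i, x), (j, y)) \<in> rel \<longleftrightarrow> i \<in> I \<and> j \<in> I \<and> x \<in> carrier (H i) \<and> y \<in> carrier (H j) \<and>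
     (\<exists>k\<in>I. r i k \<and> r j k \<and> \<phi> i k x = \<phi> j k y)"
  by (simp add: direct_limit_rel_def)

lemma equiv_rel: "equiv (SIGMA i:I. carrier (H i)) rel"
proof (rule equivI)
  show "rel \<subseteq> (SIGMA i:I. carrier (H i)) \<times> (SIGMA i:I. carrier (H i))"
    by (auto simp: direct_limit_rel_def)
  show "refl_on (SIGMA i:I. carrier (H i)) rel"
    using refl by (auto simp: refl_on_def direct_limit_rel_def)
  show "sym rel"
  proof (rule symI)
    fix a b assume "(a, b) \<in> rel"
    then show "(b, a) \<in> rel" by (cases a; cases b) (auto simp: rel_iff intro: sym)
  qed
  show "trans rel"
  proof (rule transI)
    fix a b c assume ab: "(a, b) \<in> rel" and bc: "(b, c) \<in> rel"
    obtain i x j y k z where [simp]: "a = (i, x)" "b = (j, y)" "c = (k, z)"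
      by (cases a; cases b; cases c)
    obtain l where l: "l \<in> I" "r i l" "r j l" "\<phi> i l x = \<phi> j l y"
      and ij: "i \<in> I" "j \<in> I" "x \<in> carrier (H i)" "y \<in> carrier (H j)"
      using ab by (auto simp: rel_iff)
    obtain m where m: "m \<in> I" "r j m" "r k m" "\<phi> j m y = \<phi> k m z"
      and k: "k \<in> I" "z \<in> carrier (H k)"
      using bc by (auto simp: rel_iff)
    \<comment> \<open>At a stage beyond both witnesses the two images of the middle element agree,
      which links the outer elements.\<close>
    obtain n where n: "n \<in> I" "r l n" "r m n" using directed l(1) m(1) by blast
    have "\<phi> i n x = \<phi> l n (\<phi> i l x)" using transition_comp[OF ij(1) l(1) n(1) l(2) n(2) ij(3)] by simp
    also have "\<dots> = \<phi> j n y" using transition_comp[OF ij(2) l(1) n(1) l(3) n(2) ij(4)] l(4) by simp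
    also have "\<dots> = \<phi> m n (\<phi> j m y)" using transition_comp[OF ij(2) m(1) n(1) m(2) n(3) ij(4)] by simp
    also have "\<dots> = \<phi> k n z" using transition_comp[OF k(1) m(1) n(1) m(3) n(3) k(2)] m(4) by simp
    finally have "\<phi> i n x = \<phi> k n z" .
    moreover have "r i n" "r k n"
      using trans[OF ij(1) l(1) n(1) l(2) n(2)] trans[OF k(1) m(1) n(1) m(3) n(3)] by auto
    ultimately show "(a, c) \<in> rel" using ij k n(1) by (auto simp: rel_iff)
  qed
qed

definition cls where "cls i x = rel `` {(i, x)}"

lemma carrier_direct_limit:
  "carrier (direct_limit I r H \<phi>) = {cls i x | i x. i \<in> I \<and> x \<in> carrier (H i)}"
  by (auto simp: direct_limit_def quotient_def cls_def)

lemma cls_eq_iff: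
  assumes "i \<in> I" "x \<in> carrier (H i)" "j \<in> I" "y \<in> carrier (H j)"
  shows "cls i x = cls j y \<longleftrightarrow> (\<exists>k\<in>I. r i k \<and> r j k \<and> \<phi> i k x = \<phi> j k y)"
  unfolding cls_def using eq_equiv_class_iff[OF equiv_rel, of "(i, x)" "(j, y)"] assms
  by (simp add: rel_iff)

lemma cls_transition:
  assumes "i \<in> I" "x \<in> carrier (H i)" "j \<in> I" "r i j"
  shows "cls j (\<phi> i j x) = cls i x"
proof -
  have "\<phi> i j x \<in> carrier (H j)" using hom_in_carrier[OF hom[OF assms(1,3,4)]] assms(2) .
  \<comment> \<open>The elements are compared at stage \<open>j\<close> itself: going from
    \<open>i\<close> to \<open>j\<close> and then along \<open>r j j\<close> is again going from
    \<open>i\<close> to \<open>j\<close>.\<close>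
  then have "cls i x = cls j (\<phi> i j x)"
    using cls_eq_iff[OF assms(1,2,3)] transition_comp[OF assms(1,3,3,4) refl[OF assms(3)] assms(2)]
      assms refl by metis
  then show ?thesis by (rule sym)
qed

text \<open>In \<open>direct_limit\<close> a product is the saturation of the set of all admissible
  products of representatives. This is a single class once all of them are related to one.\<close>

lemma Image_rel_eq_cls:
  assumes "s \<in> S" "\<And>t. t \<in> S \<Longrightarrow> (s, t) \<in> rel" "s = (i, x)"
  shows "rel `` S = cls i x"
proof -
  have "(\<Union>t\<in>S. rel `` {t}) = rel `` {s}"
  proof (rule SUP_eq_const)
    show "S \<noteq> {}" using assms(1) by blast
    show "rel `` {t} = rel `` {s}" if "t \<in> S" for t
      using equiv_class_eq[OF equiv_rel assms(2)[OF that]] by (rule sym)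
  qed
  moreover have "rel `` S = (\<Union>t\<in>S. rel `` {t})" by blast
  ultimately have "rel `` S = rel `` {s}" by (simp only:)
  then show ?thesis using assms(3) by (simp add: cls_def)
qed

lemma mem_cls: "(j, y) \<in> cls i x \<longleftrightarrow> ((i, x), (j, y)) \<in> rel"
  by (simp add: cls_def)

text \<open>Contains the well-definedness of the product: other representatives and another stage
  lead to a related element.\<close>

lemma cls_mult:
  assumes i: "i \<in> I" "x \<in> carrier (H i)" and j: "j \<in> I" "y \<in> carrier (H j)"
    and k: "k \<in> I" "r i k" "r j k"
  shows "cls i x \<otimes>\<^bsub>direct_limit I r H \<phi>\<^esub> cls j y = cls k (\<phi> i k x \<otimes>\<^bsub>H k\<^esub> \<phi> j k y)"
proof -
  let ?S = "{(k, \<phi> i' k x' \<otimes>\<^bsub>H k\<^esub> \<phi> j' k y') | i' x' j' y' k.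
           (i', x') \<in> cls i x \<and> (j', y') \<in> cls j y \<and> k \<in> I \<and> r i' k \<and> r j' k}"
  have "rel `` ?S = cls k (\<phi> i k x \<otimes>\<^bsub>H k\<^esub> \<phi> j k y)"
  proof (rule Image_rel_eq_cls)
    have "(i, x) \<in> cls i x" "(j, y) \<in> cls j y"
      using i j refl by (auto simp: mem_cls rel_iff)
    then show "(k, \<phi> i k x \<otimes>\<^bsub>H k\<^esub> \<phi> j k y) \<in> ?S" using k by blast
    fix t assume "t \<in> ?S"
    then obtain i' x' j' y' k' where t: "t = (k', \<phi> i' k' x' \<otimes>\<^bsub>H k'\<^esub> \<phi> j' k' y')"
      and "(i', x') \<in> cls i x" "(j', y') \<in> cls j y" and k': "k' \<in> I" "r i' k'" "r j' k'"
      by blast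
    then obtain a b where i': "i' \<in> I" "x' \<in> carrier (H i')" and j': "j' \<in> I" "y' \<in> carrier (H j')"
      and a: "a \<in> I" "r i a" "r i' a" "\<phi> i a x = \<phi> i' a x'"
      and b: "b \<in> I" "r j b" "r j' b" "\<phi> j b y = \<phi> j' b y'"
      by (auto simp: mem_cls rel_iff)
    \<comment> \<open>\<open>m\<close> lies beyond \<open>a\<close> and \<open>b\<close>, where the
      representatives agree, and beyond \<open>k\<close> and \<open>k'\<close>, where the products
      are formed.\<close>
    obtain m where m: "m \<in> I" "r a m" "r b m" "r k m" "r k' m"
    proof -
      obtain m1 where m1: "m1 \<in> I" "r a m1" "r b m1" using directed a(1) b(1) by blast
      obtain m2 where m2: "m2 \<in> I" "r k m2" "r k' m2" using directed k(1) k'(1) by blast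
      obtain m where m: "m \<in> I" "r m1 m" "r m2 m" using directed m1(1) m2(1) by blast
      show ?thesis
        using that[OF m(1)] trans[OF a(1) m1(1) m(1) m1(2) m(2)] trans[OF b(1) m1(1) m(1) m1(3) m(2)]
          trans[OF k(1) m2(1) m(1) m2(2) m(3)] trans[OF k'(1) m2(1) m(1) m2(3) m(3)] by blast
    qed
    have eqx: "\<phi> i m x = \<phi> i' m x'"
      using transition_comp[OF i(1) a(1) m(1) a(2) m(2) i(2)]
        transition_comp[OF i'(1) a(1) m(1) a(3) m(2) i'(2)] a(4) by simp
    have eqy: "\<phi> j m y = \<phi> j' m y'"
      using transition_comp[OF j(1) b(1) m(1) b(2) m(3) j(2)]
        transition_comp[OF j'(1) b(1) m(1) b(3) m(3) j'(2)] b(4) by simp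
    have kc: "\<phi> i k x \<in> carrier (H k)" "\<phi> j k y \<in> carrier (H k)"
      using hom_in_carrier[OF hom[OF i(1) k(1,2)] i(2)] hom_in_carrier[OF hom[OF j(1) k(1,3)] j(2)]
      by auto
    have kc': "\<phi> i' k' x' \<in> carrier (H k')" "\<phi> j' k' y' \<in> carrier (H k')"
      using hom_in_carrier[OF hom[OF i'(1) k'(1,2)] i'(2)]
        hom_in_carrier[OF hom[OF j'(1) k'(1,3)] j'(2)] by auto
    have "\<phi> k m (\<phi> i k x \<otimes>\<^bsub>H k\<^esub> \<phi> j k y) = \<phi> i m x \<otimes>\<^bsub>H m\<^esub> \<phi> j m y"
      using hom_mult[OF hom[OF k(1) m(1,4)] kc]
        transition_comp[OF i(1) k(1) m(1) k(2) m(4) i(2)]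
        transition_comp[OF j(1) k(1) m(1) k(3) m(4) j(2)] by simp
    moreover have "\<phi> k' m (\<phi> i' k' x' \<otimes>\<^bsub>H k'\<^esub> \<phi> j' k' y') = \<phi> i' m x' \<otimes>\<^bsub>H m\<^esub> \<phi> j' m y'"
      using hom_mult[OF hom[OF k'(1) m(1,5)] kc']
        transition_comp[OF i'(1) k'(1) m(1) k'(2) m(5) i'(2)]
        transition_comp[OF j'(1) k'(1) m(1) k'(3) m(5) j'(2)] by simp
    ultimately have e: "\<phi> k m (\<phi> i k x \<otimes>\<^bsub>H k\<^esub> \<phi> j k y) = \<phi> k' m (\<phi> i' k' x' \<otimes>\<^bsub>H k'\<^esub> \<phi> j' k' y')"
      using eqx eqy by simp
    show "((k, \<phi> i k x \<otimes>\<^bsub>H k\<^esub> \<phi> j k y), t) \<in> rel"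
      unfolding t rel_iff
      using k(1) k'(1) closed[OF k(1) kc] closed[OF k'(1) kc'] m(1,4,5) e by blast
  qed (rule HOL.refl)
  then show ?thesis by (simp add: direct_limit_def)
qed

lemma direct_limit_closed:
  assumes "C \<in> carrier (direct_limit I r H \<phi>)" "D \<in> carrier (direct_limit I r H \<phi>)"
  shows "C \<otimes>\<^bsub>direct_limit I r H \<phi>\<^esub> D \<in> carrier (direct_limit I r H \<phi>)"
proof -
  obtain i x where i: "i \<in> I" "x \<in> carrier (H i)" "C = cls i x"
    using assms(1) unfolding carrier_direct_limit by blast
  obtain j y where j: "j \<in> I" "y \<in> carrier (H j)" "D = cls j y"
    using assms(2) unfolding carrier_direct_limit by blast
  obtain k where k: "k \<in> I" "r i k" "r j k" using directed i(1) j(1) by blast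
  have "\<phi> i k x \<otimes>\<^bsub>H k\<^esub> \<phi> j k y \<in> carrier (H k)"
    using hom_in_carrier[OF hom[OF i(1) k(1,2)] i(2)] hom_in_carrier[OF hom[OF j(1) k(1,3)] j(2)]
    by (intro closed k(1))
  then show ?thesis
    unfolding i(3) j(3) cls_mult[OF i(1,2) j(1,2) k] carrier_direct_limit using k(1) by blast
qed

end

text \<open>The map goes from the cofinal system to the whole one, opposite to the case of inverse
  limits. For surjectivity an element is moved to a later index of the form \<open>\<Psi> j\<close>;
  for injectivity an equality at a stage of \<open>I\<close> has to be brought back to a stage of
  \<open>J\<close>.\<close>

lemma direct_limit_cofinal:
  fixes \<Psi> :: "'j \<Rightarrow> 'i"
  assumes "direct_system I r H \<phi>" and "direct_system J r' H' \<phi>'"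
    and \<Psi>: "\<And>j. j \<in> J \<Longrightarrow> \<Psi> j \<in> I"
    and mono: "\<And>j k. j \<in> J \<Longrightarrow> k \<in> J \<Longrightarrow> r' j k \<Longrightarrow> r (\<Psi> j) (\<Psi> k)"
    and cofinal: "\<And>i. i \<in> I \<Longrightarrow> \<exists>j\<in>J. r i (\<Psi> j)"
    and H': "\<And>j. j \<in> J \<Longrightarrow> H' j = H (\<Psi> j)"
    and \<phi>': "\<And>j k x. j \<in> J \<Longrightarrow> k \<in> J \<Longrightarrow> r' j k \<Longrightarrow> x \<in> carrier (H' j) \<Longrightarrow>
            \<phi>' j k x = \<phi> (\<Psi> j) (\<Psi> k) x"
  shows "\<exists>h. h \<in> iso (direct_limit J r' H' \<phi>') (direct_limit I r H \<phi>)"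
proof -
  interpret I: direct_system I r H \<phi> by fact
  interpret J: direct_system J r' H' \<phi>' by fact
  let ?A = "direct_limit J r' H' \<phi>'" and ?B = "direct_limit I r H \<phi>"
  define h where "h C = I.rel `` ((\<lambda>(j, x). (\<Psi> j, x)) ` C)" for C
  have h: "h (J.cls j x) = I.cls (\<Psi> j) x" if j: "j \<in> J" "x \<in> carrier (H' j)" for j x
    unfolding h_def
  proof (rule I.Image_rel_eq_cls)
    have "(j, x) \<in> J.cls j x" using that J.refl by (auto simp: J.mem_cls J.rel_iff)
    then show "(\<Psi> j, x) \<in> (\<lambda>(j, x). (\<Psi> j, x)) ` J.cls j x" by force
    fix t assume "t \<in> (\<lambda>(j, x). (\<Psi> j, x)) ` J.cls j x"
    then obtain k y where t: "t = (\<Psi> k, y)" and "(k, y) \<in> J.cls j x" by auto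
    then obtain l where k: "k \<in> J" "y \<in> carrier (H' k)"
      and l: "l \<in> J" "r' j l" "r' k l" "\<phi>' j l x = \<phi>' k l y"
      by (auto simp: J.mem_cls J.rel_iff)
    have "\<phi> (\<Psi> j) (\<Psi> l) x = \<phi> (\<Psi> k) (\<Psi> l) y"
      using \<phi>'[OF j(1) l(1,2) j(2)] \<phi>'[OF k(1) l(1,3) k(2)] l(4) by simp
    then show "((\<Psi> j, x), t) \<in> I.rel"
      unfolding t I.rel_iff
      using \<Psi>[OF j(1)] \<Psi>[OF k(1)] \<Psi>[OF l(1)] mono[OF j(1) l(1,2)] mono[OF k(1) l(1,3)] j k H'
      by auto
  qed (rule HOL.refl)
  have Hc: "x \<in> carrier (H (\<Psi> j))" if "j \<in> J" "x \<in> carrier (H' j)" for j x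
    using that H' by simp
  have hom_h: "h \<in> hom ?A ?B"
  proof (rule homI)
    fix C assume "C \<in> carrier ?A"
    then obtain j x where j: "j \<in> J" "x \<in> carrier (H' j)" and C: "C = J.cls j x"
      unfolding J.carrier_direct_limit by blast
    show "h C \<in> carrier ?B"
      unfolding C h[OF j] I.carrier_direct_limit using \<Psi>[OF j(1)] Hc[OF j] by blast
    fix D assume "D \<in> carrier ?A"
    then obtain k y where k: "k \<in> J" "y \<in> carrier (H' k)" and D: "D = J.cls k y"
      unfolding J.carrier_direct_limit by blast
    obtain l where l: "l \<in> J" "r' j l" "r' k l" using J.directed j(1) k(1) by blast
    have "\<phi>' j l x \<otimes>\<^bsub>H' l\<^esub> \<phi>' k l y \<in> carrier (H' l)"
      using hom_in_carrier[OF J.hom[OF j(1) l(1,2)] j(2)] hom_in_carrier[OF J.hom[OF k(1) l(1,3)] k(2)]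
      by (intro J.closed l(1))
    then have "h (C \<otimes>\<^bsub>?A\<^esub> D) = I.cls (\<Psi> l) (\<phi>' j l x \<otimes>\<^bsub>H' l\<^esub> \<phi>' k l y)"
      unfolding C D J.cls_mult[OF j k l] by (intro h l(1))
    also have "\<dots> = I.cls (\<Psi> l) (\<phi> (\<Psi> j) (\<Psi> l) x \<otimes>\<^bsub>H (\<Psi> l)\<^esub> \<phi> (\<Psi> k) (\<Psi> l) y)"
      using \<phi>'[OF j(1) l(1,2) j(2)] \<phi>'[OF k(1) l(1,3) k(2)] H'[OF l(1)] by simp
    also have "\<dots> = h C \<otimes>\<^bsub>?B\<^esub> h D"
      unfolding C D h[OF j] h[OF k]
      by (rule I.cls_mult[symmetric])
        (use \<Psi> j k l Hc mono in auto)
    finally show "h (C \<otimes>\<^bsub>?A\<^esub> D) = h C \<otimes>\<^bsub>?B\<^esub> h D" .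
  qed
  have "inj_on h (carrier ?A)"
  proof (rule inj_onI)
    fix C D assume "C \<in> carrier ?A" "D \<in> carrier ?A" and eq: "h C = h D"
    then obtain j x k y where j: "j \<in> J" "x \<in> carrier (H' j)" and C: "C = J.cls j x"
      and k: "k \<in> J" "y \<in> carrier (H' k)" and D: "D = J.cls k y"
      unfolding J.carrier_direct_limit by blast
    have "I.cls (\<Psi> j) x = I.cls (\<Psi> k) y" using eq unfolding C D h[OF j] h[OF k] .
    then obtain i where i: "i \<in> I" "r (\<Psi> j) i" "r (\<Psi> k) i" "\<phi> (\<Psi> j) i x = \<phi> (\<Psi> k) i y"
      using I.cls_eq_iff[OF \<Psi>[OF j(1)] Hc[OF j] \<Psi>[OF k(1)] Hc[OF k]] by auto
    \<comment> \<open>The stage \<open>l\<close> is chosen beyond \<open>j\<close>, \<open>k\<close>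
      and an \<open>m\<close> with \<open>\<Psi> m\<close> beyond \<open>i\<close>, so that the
      equality at \<open>i\<close> passes on to \<open>\<Psi> l\<close>.\<close>
    obtain m where m: "m \<in> J" "r i (\<Psi> m)" using cofinal i(1) by blast
    obtain l1 where l1: "l1 \<in> J" "r' j l1" "r' k l1" using J.directed j(1) k(1) by blast
    obtain l where l: "l \<in> J" "r' l1 l" "r' m l" using J.directed l1(1) m(1) by blast
    have jl: "r' j l" "r' k l"
      using J.trans[OF j(1) l1(1) l(1) l1(2) l(2)] J.trans[OF k(1) l1(1) l(1) l1(3) l(2)] by auto
    have il: "r i (\<Psi> l)"
      using I.trans[OF i(1) \<Psi>[OF m(1)] \<Psi>[OF l(1)] m(2) mono[OF m(1) l(1,3)]] .
    have "\<phi>' j l x = \<phi>' k l y"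
      using \<phi>'[OF j(1) l(1) jl(1) j(2)] \<phi>'[OF k(1) l(1) jl(2) k(2)] i(4)
        I.transition_comp[OF \<Psi>[OF j(1)] i(1) \<Psi>[OF l(1)] i(2) il Hc[OF j]]
        I.transition_comp[OF \<Psi>[OF k(1)] i(1) \<Psi>[OF l(1)] i(3) il Hc[OF k]] by simp
    then show "C = D"
      unfolding C D J.cls_eq_iff[OF j k] using l(1) jl by blast
  qed
  moreover have "h ` carrier ?A = carrier ?B"
  proof (intro equalityI subsetI)
    show "D \<in> carrier ?B" if "D \<in> h ` carrier ?A" for D
      using that hom_in_carrier[OF hom_h] by blast
    fix D assume "D \<in> carrier ?B"
    then obtain i x where i: "i \<in> I" "x \<in> carrier (H i)" and D: "D = I.cls i x"
      unfolding I.carrier_direct_limit by blast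
    obtain j where j: "j \<in> J" "r i (\<Psi> j)" using cofinal i(1) by blast
    have y: "\<phi> i (\<Psi> j) x \<in> carrier (H' j)"
      using hom_in_carrier[OF I.hom[OF i(1) \<Psi>[OF j(1)] j(2)] i(2)] H'[OF j(1)] by simp
    have "h (J.cls j (\<phi> i (\<Psi> j) x)) = D"
      unfolding D h[OF j(1) y] by (rule I.cls_transition[OF i \<Psi>[OF j(1)] j(2)])
    moreover have "J.cls j (\<phi> i (\<Psi> j) x) \<in> carrier ?A"
      unfolding J.carrier_direct_limit using j(1) y by blast
    ultimately show "D \<in> h ` carrier ?A" by blast
  qed
  ultimately have "h \<in> iso ?A ?B" using hom_h by (simp add: iso_def bij_betw_def)
  then show ?thesis by blast
qed

section \<open>Nerves and refinement projections\<close>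

text \<open>The part of \<open>finite_open_family\<close> that involves no topology, so that covers
  of the space and of its remainder are treated alike.\<close>

definition finite_family :: "'a family \<Rightarrow> bool" where
  "finite_family \<alpha> \<longleftrightarrow> finite (index \<alpha>) \<and> subindex \<alpha> \<subseteq> index \<alpha>"

lemma family_carrier_antimono: "t \<subseteq> s \<Longrightarrow> family_carrier \<alpha> s \<subseteq> family_carrier \<alpha> t"
  by (auto simp: family_carrier_def)

lemma nerve_vertices: "\<Union>(nerve \<alpha>) \<subseteq> index \<alpha>"
  by (auto simp: nerve_def)

lemma empty_not_in_nerve: "{} \<notin> nerve \<alpha>"
  by (simp add: nerve_def)

lemma complex_pair_nerve:
  assumes "finite_family \<alpha>"
  shows "complex_pair (nerve \<alpha>) (subnerve A \<alpha>)"
  unfolding complex_pair_def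
proof (intro conjI)
  show "finite (\<Union>(nerve \<alpha>))"
    by (rule finite_subset[OF nerve_vertices]) (use assms in \<open>simp add: finite_family_def\<close>)
  show "subnerve A \<alpha> \<subseteq> nerve \<alpha>"
    using assms by (auto simp: nerve_def subnerve_def finite_family_def)
  show "face_closed (nerve \<alpha>)"
    unfolding face_closed_def
  proof (intro ballI allI impI)
    fix s t assume s: "s \<in> nerve \<alpha>" and t: "t \<subseteq> s \<and> t \<noteq> {}"
    then have "family_carrier \<alpha> t \<noteq> {}" using family_carrier_antimono[of t s \<alpha>] by (auto simp: nerve_def)
    then show "t \<in> nerve \<alpha>" using s t by (auto simp: nerve_def intro: finite_subset)
  qed
  show "face_closed (subnerve A \<alpha>)"
    unfolding face_closed_def
  proof (intro ballI allI impI)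
    fix s t assume s: "s \<in> subnerve A \<alpha>" and t: "t \<subseteq> s \<and> t \<noteq> {}"
    then have "family_carrier \<alpha> t \<inter> A \<noteq> {}"
      using family_carrier_antimono[of t s \<alpha>] by (auto simp: subnerve_def)
    then show "t \<in> subnerve A \<alpha>" using s t by (auto simp: subnerve_def intro: finite_subset)
  qed
qed

lemma refinement_projectionD:
  assumes "refinement_projection \<alpha> \<beta> p"
  shows "v \<in> index \<beta> \<Longrightarrow> p v \<in> index \<alpha>" "v \<in> subindex \<beta> \<Longrightarrow> p v \<in> subindex \<alpha>"
    "v \<in> index \<beta> \<Longrightarrow> member \<beta> v \<subseteq> member \<alpha> (p v)"
  using assms by (auto simp: refinement_projection_def)

lemma refinement_projectionI:
  assumes "\<And>v. v \<in> index \<beta> \<Longrightarrow> p v \<in> index \<alpha>" "\<And>v. v \<in> subindex \<beta> \<Longrightarrow> p v \<in> subindex \<alpha>"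
    "\<And>v. v \<in> index \<beta> \<Longrightarrow> member \<beta> v \<subseteq> member \<alpha> (p v)"
  shows "refinement_projection \<alpha> \<beta> p"
  using assms by (simp add: refinement_projection_def image_subset_iff)

text \<open>A point common to the members indexed by \<open>s\<close> lies in the members indexed by
  either image of \<open>s\<close>, so the union of the images has nonempty carrier. For
  \<open>subnerve\<close> the same point lies in \<open>A\<close>.\<close>

lemma refinement_projection_contiguous:
  assumes p: "refinement_projection \<alpha> \<beta> p" and q: "refinement_projection \<alpha> \<beta> q"
    and \<beta>: "finite_family \<beta>"
  shows "contiguous (nerve \<beta>) (subnerve A \<beta>) (nerve \<alpha>) (subnerve A \<alpha>) p q"
proof -
  have sub: "family_carrier \<beta> s \<subseteq> family_carrier \<alpha> (p ` s \<union> q ` s)" if s: "s \<subseteq> index \<beta>" for s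
  proof
    fix x assume "x \<in> family_carrier \<beta> s"
    then have x: "x \<in> member \<beta> v" if "v \<in> s" for v using that by (auto simp: family_carrier_def)
    have "x \<in> member \<alpha> (p v)" "x \<in> member \<alpha> (q v)" if "v \<in> s" for v
      using x[OF that] refinement_projectionD(3)[OF p subsetD[OF s that]]
        refinement_projectionD(3)[OF q subsetD[OF s that]] by auto
    then show "x \<in> family_carrier \<alpha> (p ` s \<union> q ` s)" by (auto simp: family_carrier_def)
  qed
  have "p ` s \<union> q ` s \<in> nerve \<alpha>" if s: "s \<in> nerve \<beta>" for s
  proof -
    have i: "s \<subseteq> index \<beta>" using s by (simp add: nerve_def)
    then have "p ` s \<union> q ` s \<subseteq> index \<alpha>"
      using refinement_projectionD(1)[OF p] refinement_projectionD(1)[OF q] by auto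
    then show ?thesis using sub[OF i] s by (auto simp: nerve_def)
  qed
  moreover have "p ` s \<union> q ` s \<in> subnerve A \<alpha>" if s: "s \<in> subnerve A \<beta>" for s
  proof -
    have i: "s \<subseteq> subindex \<beta>" using s by (simp add: subnerve_def)
    then have "p ` s \<union> q ` s \<subseteq> subindex \<alpha>"
      using refinement_projectionD(2)[OF p] refinement_projectionD(2)[OF q] by auto
    moreover have "s \<subseteq> index \<beta>" using i \<beta> by (auto simp: finite_family_def)
    ultimately show ?thesis using sub[of s] s by (auto simp: subnerve_def)
  qed
  ultimately show ?thesis by (simp add: contiguous_def)
qed

lemma refinement_projection_simplicial:
  assumes "refinement_projection \<alpha> \<beta> p" "finite_family \<beta>"
  shows "simplicial_map (nerve \<beta>) (subnerve A \<beta>) (nerve \<alpha>) (subnerve A \<alpha>) p"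
  using refinement_projection_contiguous[OF assms(1,1,2), of A]
  unfolding contiguous_def simplicial_map_def Un_absorb .

lemma refinement_projection_id: "refinement_projection \<alpha> \<alpha> id"
  by (auto simp: refinement_projection_def)

lemma refinement_projection_comp:
  assumes "refinement_projection \<alpha> \<beta> p" "refinement_projection \<beta> \<gamma> q"
  shows "refinement_projection \<alpha> \<gamma> (p \<circ> q)"
proof (rule refinement_projectionI)
  note p = refinement_projectionD[OF assms(1)] and q = refinement_projectionD[OF assms(2)]
  show "(p \<circ> q) v \<in> index \<alpha>" if "v \<in> index \<gamma>" for v using that p q by simp
  show "(p \<circ> q) v \<in> subindex \<alpha>" if "v \<in> subindex \<gamma>" for v using that p q by simp
  show "member \<gamma> v \<subseteq> member \<alpha> ((p \<circ> q) v)" if "v \<in> index \<gamma>" for v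
    using q(3)[OF that] p(3)[OF q(1)[OF that]] by simp
qed

lemma refined_by_refl: "refined_by \<alpha> \<alpha>"
  unfolding refined_by_def using refinement_projection_id by blast

lemma refined_by_trans: "refined_by \<alpha> \<beta> \<Longrightarrow> refined_by \<beta> \<gamma> \<Longrightarrow> refined_by \<alpha> \<gamma>"
  unfolding refined_by_def using refinement_projection_comp by blast

lemma chosen_projection: "refined_by \<alpha> \<beta> \<Longrightarrow> refinement_projection \<alpha> \<beta> (chosen_projection \<alpha> \<beta>)"
  unfolding refined_by_def chosen_projection_def
  using someI_ex[of "refinement_projection \<alpha> \<beta>"] .

text \<open>The conditions concern one vertex at a time, so two projections can be mixed freely;
  this yields the intermediate maps between them.\<close>

lemma refinement_projection_mix:
  assumes "refinement_projection \<alpha> \<beta> p" "refinement_projection \<alpha> \<beta> q"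
  shows "refinement_projection \<alpha> \<beta> (\<lambda>v. if v \<in> S then q v else p v)"
  using refinement_projectionD[OF assms(1)] refinement_projectionD[OF assms(2)]
  by (intro refinement_projectionI) auto

text \<open>Two refinement projections differ by finitely many changes of the value at one vertex, and all
  intermediate maps are refinement projections.\<close>

lemma refinement_projection_invariant:
  assumes p: "refinement_projection \<alpha> \<beta> p" and q: "refinement_projection \<alpha> \<beta> q"
    and \<beta>: "finite_family \<beta>"
    and cong: "\<And>f g. (\<And>v. v \<in> \<Union>(nerve \<beta>) \<Longrightarrow> f v = g v) \<Longrightarrow> F f = F g"
    and step: "\<And>f u w. contiguous (nerve \<beta>) (subnerve A \<beta>) (nerve \<alpha>) (subnerve A \<alpha>) f (f(u := w)) \<Longrightarrow>
      u \<in> \<Union>(nerve \<beta>) \<Longrightarrow> F (f(u := w)) = F f"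
  shows "F p = F q"
proof -
  \<comment> \<open>Follows \<open>q\<close> on \<open>S\<close> and \<open>p\<close> elsewhere.
    \<open>S\<close> grows to the set of vertices of the nerve; indices with empty member are no
    vertices, and \<open>cong\<close> disregards them.\<close>
  let ?m = "\<lambda>S v. if v \<in> S then q v else p v"
  have "F (?m S) = F p" if "finite S" "S \<subseteq> \<Union>(nerve \<beta>)" for S
    using that
  proof (induction S rule: finite_induct)
    case (insert u S)
    have eq: "?m (insert u S) = (?m S)(u := q u)" by auto
    have "contiguous (nerve \<beta>) (subnerve A \<beta>) (nerve \<alpha>) (subnerve A \<alpha>) (?m S) ((?m S)(u := q u))"
      unfolding eq[symmetric]
      by (intro refinement_projection_contiguous refinement_projection_mix p q \<beta>)
    then have "F ((?m S)(u := q u)) = F (?m S)" by (rule step) (use insert.prems in blast)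
    moreover have "F (?m S) = F p" using insert by blast
    ultimately show ?case unfolding eq by simp
  qed simp
  moreover have "finite (\<Union>(nerve \<beta>))"
    using complex_pair_nerve[OF \<beta>] by (simp add: complex_pair_def)
  ultimately have "F (?m (\<Union>(nerve \<beta>))) = F p" by blast
  moreover have "F (?m (\<Union>(nerve \<beta>))) = F q" by (rule cong) simp
  ultimately show ?thesis by simp
qed

context comm_group
begin

lemma homology_map_refinement_projection:
  assumes "refinement_projection \<alpha> \<beta> p" "refinement_projection \<alpha> \<beta> q"
    and "finite_family \<alpha>" "finite_family \<beta>"
    and x: "x \<in> carrier (simplicial_homology G n (nerve \<beta>) (subnerve A \<beta>))"
  shows "homology_map G n (nerve \<beta>) (nerve \<alpha>) (subnerve A \<alpha>) p x =
    homology_map G n (nerve \<beta>) (nerve \<alpha>) (subnerve A \<alpha>) q x"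
proof (rule refinement_projection_invariant[OF assms(1,2,4), where A = A])
  show "homology_map G n (nerve \<beta>) (nerve \<alpha>) (subnerve A \<alpha>) (f(u := w)) x =
      homology_map G n (nerve \<beta>) (nerve \<alpha>) (subnerve A \<alpha>) f x"
    if "contiguous (nerve \<beta>) (subnerve A \<beta>) (nerve \<alpha>) (subnerve A \<alpha>) f (f(u := w))"
      and "u \<in> \<Union>(nerve \<beta>)" for f u w
    by (rule homology_map_fun_upd[OF complex_pair_nerve complex_pair_nerve that empty_not_in_nerve x])
      (rule assms)+
qed (rule homology_map_cong)

lemma cohomology_map_refinement_projection:
  assumes "refinement_projection \<alpha> \<beta> p" "refinement_projection \<alpha> \<beta> q"
    and "finite_family \<alpha>" "finite_family \<beta>"
    and x: "x \<in> carrier (simplicial_cohomology G n (nerve \<alpha>) (subnerve A \<alpha>))"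
  shows "cohomology_map G n (nerve \<beta>) (subnerve A \<beta>) p x =
    cohomology_map G n (nerve \<beta>) (subnerve A \<beta>) q x"
proof (rule refinement_projection_invariant[OF assms(1,2,4), where A = A])
  show "cohomology_map G n (nerve \<beta>) (subnerve A \<beta>) (f(u := w)) x =
      cohomology_map G n (nerve \<beta>) (subnerve A \<beta>) f x"
    if "contiguous (nerve \<beta>) (subnerve A \<beta>) (nerve \<alpha>) (subnerve A \<alpha>) f (f(u := w))" for f u w
    by (rule cohomology_map_fun_upd[OF complex_pair_nerve complex_pair_nerve that empty_not_in_nerve x])
      (rule assms)+
qed (rule cohomology_map_cong)

lemma nerve_homology_transition:
  assumes "finite_family \<alpha>" "finite_family \<beta>" "refined_by \<alpha> \<beta>"
  shows "homology_map G n (nerve \<beta>) (nerve \<alpha>) (subnerve A \<alpha>) (chosen_projection \<alpha> \<beta>) \<in>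
    hom (simplicial_homology G n (nerve \<beta>) (subnerve A \<beta>))
      (simplicial_homology G n (nerve \<alpha>) (subnerve A \<alpha>))"
  by (intro homology_map_hom complex_pair_nerve refinement_projection_simplicial chosen_projection assms)

lemma nerve_cohomology_transition:
  assumes "finite_family \<alpha>" "finite_family \<beta>" "refined_by \<alpha> \<beta>"
  shows "cohomology_map G n (nerve \<beta>) (subnerve A \<beta>) (chosen_projection \<alpha> \<beta>) \<in>
    hom (simplicial_cohomology G n (nerve \<alpha>) (subnerve A \<alpha>))
      (simplicial_cohomology G n (nerve \<beta>) (subnerve A \<beta>))"
  by (intro cohomology_map_hom complex_pair_nerve refinement_projection_simplicial chosen_projection assms)

text \<open>The composite of two chosen projections is a refinement projection but need not be the
  chosen one, so functoriality appears only in homology.\<close>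

lemma nerve_homology_transition_comp:
  assumes fam: "finite_family \<alpha>" "finite_family \<beta>" "finite_family \<gamma>"
    and ref: "refined_by \<alpha> \<beta>" "refined_by \<beta> \<gamma>"
    and x: "x \<in> carrier (simplicial_homology G n (nerve \<gamma>) (subnerve A \<gamma>))"
  shows "homology_map G n (nerve \<beta>) (nerve \<alpha>) (subnerve A \<alpha>) (chosen_projection \<alpha> \<beta>)
      (homology_map G n (nerve \<gamma>) (nerve \<beta>) (subnerve A \<beta>) (chosen_projection \<beta> \<gamma>) x) =
    homology_map G n (nerve \<gamma>) (nerve \<alpha>) (subnerve A \<alpha>) (chosen_projection \<alpha> \<gamma>) x"
proof -
  note p = chosen_projection[OF ref(1)] and q = chosen_projection[OF ref(2)]
  have "homology_map G n (nerve \<beta>) (nerve \<alpha>) (subnerve A \<alpha>) (chosen_projection \<alpha> \<beta>)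
      (homology_map G n (nerve \<gamma>) (nerve \<beta>) (subnerve A \<beta>) (chosen_projection \<beta> \<gamma>) x) =
    homology_map G n (nerve \<gamma>) (nerve \<alpha>) (subnerve A \<alpha>)
      (chosen_projection \<alpha> \<beta> \<circ> chosen_projection \<beta> \<gamma>) x"
    using fam by (intro homology_map_comp[OF _ _ _ _ _ x] complex_pair_nerve
        refinement_projection_simplicial p q)
  also have "\<dots> = homology_map G n (nerve \<gamma>) (nerve \<alpha>) (subnerve A \<alpha>) (chosen_projection \<alpha> \<gamma>) x"
    by (intro homology_map_refinement_projection refinement_projection_comp[OF p q]
        chosen_projection refined_by_trans[OF ref] fam x)
  finally show ?thesis .
qed

lemma nerve_cohomology_transition_comp:
  assumes fam: "finite_family \<alpha>" "finite_family \<beta>" "finite_family \<gamma>"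
    and ref: "refined_by \<alpha> \<beta>" "refined_by \<beta> \<gamma>"
    and x: "x \<in> carrier (simplicial_cohomology G n (nerve \<alpha>) (subnerve A \<alpha>))"
  shows "cohomology_map G n (nerve \<gamma>) (subnerve A \<gamma>) (chosen_projection \<beta> \<gamma>)
      (cohomology_map G n (nerve \<beta>) (subnerve A \<beta>) (chosen_projection \<alpha> \<beta>) x) =
    cohomology_map G n (nerve \<gamma>) (subnerve A \<gamma>) (chosen_projection \<alpha> \<gamma>) x"
proof -
  note p = chosen_projection[OF ref(1)] and q = chosen_projection[OF ref(2)]
  have "cohomology_map G n (nerve \<gamma>) (subnerve A \<gamma>) (chosen_projection \<beta> \<gamma>)
      (cohomology_map G n (nerve \<beta>) (subnerve A \<beta>) (chosen_projection \<alpha> \<beta>) x) =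
    cohomology_map G n (nerve \<gamma>) (subnerve A \<gamma>) (chosen_projection \<alpha> \<beta> \<circ> chosen_projection \<beta> \<gamma>) x"
    using fam by (intro cohomology_map_comp[OF _ _ _ _ x] complex_pair_nerve
        refinement_projection_simplicial p q)
  also have "\<dots> = cohomology_map G n (nerve \<gamma>) (subnerve A \<gamma>) (chosen_projection \<alpha> \<gamma>) x"
    by (intro cohomology_map_refinement_projection[where \<alpha> = \<alpha>] refinement_projection_comp[OF p q]
        chosen_projection refined_by_trans[OF ref] fam x)
  finally show ?thesis .
qed

lemma nerve_direct_system:
  assumes fam: "\<And>\<alpha>. \<alpha> \<in> \<C> \<Longrightarrow> finite_family \<alpha>"
    and directed: "\<And>\<alpha> \<beta>. \<alpha> \<in> \<C> \<Longrightarrow> \<beta> \<in> \<C> \<Longrightarrow> \<exists>\<gamma>\<in>\<C>. refined_by \<alpha> \<gamma> \<and> refined_by \<beta> \<gamma>"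
  shows "direct_system \<C> refined_by
    (\<lambda>\<alpha>. simplicial_cohomology G n (nerve \<alpha>) (subnerve A \<alpha>))
    (\<lambda>\<alpha> \<beta>. cohomology_map G n (nerve \<beta>) (subnerve A \<beta>) (chosen_projection \<alpha> \<beta>))"
proof (unfold_locales, goal_cases)
  case 1 then show ?case using fam by (intro nerve_cohomology_transition)
next
  case 2 then show ?case using fam by (intro nerve_cohomology_transition_comp)
next
  case 3 then show ?case using refined_by_trans by blast
next
  case 4 then show ?case by (intro refined_by_refl)
next
  case 5 then show ?case by (intro directed)
next
  case 6 then show ?case by (intro simplicial_cohomology_closed)
qed

end

section \<open>Comparison of limits along a cofinal map that preserves nerves\<close>

text \<open>\<open>\<Psi>\<close> preserves nerves and keeps every refinement projection, with the
  same vertex map. It is interpreted twice with \<open>nonvanishing_covers\<close> as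
  \<open>\<D>\<close>: by the identity into the border covers, and by
  \<open>remainder_family\<close> into the covers of the remainder.\<close>

locale nerve_equivalence = comm_group G
  for G :: "('g, 'm) monoid_scheme" (structure) +
  fixes \<C> :: "'a family set" and A :: "'a set" and \<D> :: "'b family set" and B :: "'b set"
    and \<Psi> :: "'b family \<Rightarrow> 'a family"
  assumes family: "\<And>\<alpha>. \<alpha> \<in> \<C> \<Longrightarrow> finite_family \<alpha>" "\<And>\<beta>. \<beta> \<in> \<D> \<Longrightarrow> finite_family \<beta>"
    and directed_source: "\<And>\<alpha> \<beta>. \<alpha> \<in> \<D> \<Longrightarrow> \<beta> \<in> \<D> \<Longrightarrow> \<exists>\<gamma>\<in>\<D>. refined_by \<alpha> \<gamma> \<and> refined_by \<beta> \<gamma>"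
    and in_target: "\<And>\<beta>. \<beta> \<in> \<D> \<Longrightarrow> \<Psi> \<beta> \<in> \<C>"
    and projection: "\<And>\<alpha> \<beta> p. \<alpha> \<in> \<D> \<Longrightarrow> \<beta> \<in> \<D> \<Longrightarrow> refinement_projection \<alpha> \<beta> p \<Longrightarrow>
      refinement_projection (\<Psi> \<alpha>) (\<Psi> \<beta>) p"
    and cofinal: "\<And>\<alpha>. \<alpha> \<in> \<C> \<Longrightarrow> \<exists>\<beta>\<in>\<D>. refined_by \<alpha> (\<Psi> \<beta>)"
    and nerve: "\<And>\<beta>. \<beta> \<in> \<D> \<Longrightarrow> nerve (\<Psi> \<beta>) = nerve \<beta>"
    and subnerve: "\<And>\<beta>. \<beta> \<in> \<D> \<Longrightarrow> subnerve A (\<Psi> \<beta>) = subnerve B \<beta>"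
begin

lemma refined: "\<alpha> \<in> \<D> \<Longrightarrow> \<beta> \<in> \<D> \<Longrightarrow> refined_by \<alpha> \<beta> \<Longrightarrow> refined_by (\<Psi> \<alpha>) (\<Psi> \<beta>)"
  unfolding refined_by_def using projection by blast

text \<open>Directedness passes along cofinality: two members of the target are refined by images
  from the source, and their originals have a common refinement there.\<close>

lemma directed_target:
  assumes "\<alpha> \<in> \<C>" "\<beta> \<in> \<C>"
  shows "\<exists>\<gamma>\<in>\<C>. refined_by \<alpha> \<gamma> \<and> refined_by \<beta> \<gamma>"
proof -
  obtain \<alpha>' \<beta>' where 1: "\<alpha>' \<in> \<D>" "refined_by \<alpha> (\<Psi> \<alpha>')" "\<beta>' \<in> \<D>" "refined_by \<beta> (\<Psi> \<beta>')"
    using cofinal assms by meson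
  obtain \<gamma> where 2: "\<gamma> \<in> \<D>" "refined_by \<alpha>' \<gamma>" "refined_by \<beta>' \<gamma>"
    using directed_source 1 by meson
  show ?thesis
    using in_target[OF 2(1)] refined_by_trans[OF 1(2) refined[OF 1(1) 2(1,2)]]
      refined_by_trans[OF 1(4) refined[OF 1(3) 2(1,3)]] by blast
qed

lemma homology_iso:
  "\<exists>h. h \<in> iso (nerve_homology_limit G n \<C> A) (nerve_homology_limit G n \<D> B)"
  unfolding nerve_homology_limit_def
proof (rule exI, rule inverse_limit_cofinal[where \<Psi> = \<Psi>], goal_cases)
  case (1 i j) then show ?case using family by (intro nerve_homology_transition)
next
  case (2 i j k x) then show ?case
    using family refined_by_trans[of i j k] by (intro conjI nerve_homology_transition_comp)
next
  case 3 then show ?case by (rule directed_source)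
next
  case 4 then show ?case by (intro refined_by_refl)
next
  case 5 then show ?case by (rule in_target)
next
  case 6 then show ?case by (rule refined)
next
  case 7 then show ?case by (rule cofinal)
next
  case 8 then show ?case by (simp add: nerve subnerve)
next
  case (9 j k x)
  \<comment> \<open>The projection chosen for \<open>j\<close> and \<open>k\<close> is also one for
    their images, but need not be the one chosen there; in homology the difference
    disappears.\<close>
  have "homology_map G n (nerve (\<Psi> k)) (nerve (\<Psi> j)) (subnerve A (\<Psi> j)) (chosen_projection j k) x =
    homology_map G n (nerve (\<Psi> k)) (nerve (\<Psi> j)) (subnerve A (\<Psi> j)) (chosen_projection (\<Psi> j) (\<Psi> k)) x"
    using 9 by (intro homology_map_refinement_projection projection chosen_projection refined
        family in_target) (auto simp: nerve subnerve)
  with 9 show ?case by (simp add: nerve subnerve)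
qed

lemma cohomology_iso:
  "\<exists>h. h \<in> iso (nerve_cohomology_limit G n \<D> B) (nerve_cohomology_limit G n \<C> A)"
  unfolding nerve_cohomology_limit_def
proof (rule direct_limit_cofinal[where \<Psi> = \<Psi>], goal_cases)
  case 1 then show ?case using family(1) directed_target by (rule nerve_direct_system)
next
  case 2 then show ?case using family(2) directed_source by (rule nerve_direct_system)
next
  case 3 then show ?case by (rule in_target)
next
  case 4 then show ?case by (rule refined)
next
  case 5 then show ?case by (rule cofinal)
next
  case 6 then show ?case by (simp add: nerve subnerve)
next
  case (7 j k x)
  have "cohomology_map G n (nerve (\<Psi> k)) (subnerve A (\<Psi> k)) (chosen_projection j k) x =
    cohomology_map G n (nerve (\<Psi> k)) (subnerve A (\<Psi> k)) (chosen_projection (\<Psi> j) (\<Psi> k)) x"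
    using 7 by (intro cohomology_map_refinement_projection[where \<alpha> = "\<Psi> j"] projection chosen_projection refined
        family in_target) (auto simp: nerve subnerve)
  with 7 show ?case by (simp add: nerve subnerve)
qed

lemma homology_closed:
  "x \<in> carrier (nerve_homology_limit G n \<C> A) \<Longrightarrow> y \<in> carrier (nerve_homology_limit G n \<C> A) \<Longrightarrow>
    x \<otimes>\<^bsub>nerve_homology_limit G n \<C> A\<^esub> y \<in> carrier (nerve_homology_limit G n \<C> A)"
  unfolding nerve_homology_limit_def
  by (rule inverse_limit_closed)
    (auto intro: family nerve_homology_transition simplicial_homology_closed complex_pair_nerve)

lemma cohomology_closed_source:
  "x \<in> carrier (nerve_cohomology_limit G n \<D> B) \<Longrightarrow> y \<in> carrier (nerve_cohomology_limit G n \<D> B) \<Longrightarrow>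
    x \<otimes>\<^bsub>nerve_cohomology_limit G n \<D> B\<^esub> y \<in> carrier (nerve_cohomology_limit G n \<D> B)"
  unfolding nerve_cohomology_limit_def
  by (rule direct_system.direct_limit_closed[OF nerve_direct_system[OF family(2) directed_source]])

end

section \<open>Compactifications with disjoint closures\<close>

no_notation eq_closure_of (\<open>closure'_of\<index>\<close>)

section \<open>Uniform neighbourhoods of compact sets and shrinking of covers\<close>

text \<open>The sets \<open>U n\<close> increase and cover \<open>K\<close>, so compactness puts
  \<open>K\<close> into a single \<open>U m\<close>, and the lower bound on the radii in
  \<open>U m\<close> becomes a radius valid along all of \<open>K\<close>.\<close>

lemma (in Metric_space) compact_subset_open_uniform:
  assumes "compactin mtopology K" "openin mtopology W" "K \<subseteq> W"
  obtains m :: nat where "(\<Union>k\<in>K. mball k (inverse (real (Suc m)))) \<subseteq> W"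
proof -
  \<comment> \<open>The ball of doubled radius lies in \<open>W\<close>, which leaves room for a
    second ball around any point of the first.\<close>
  define U where "U n = \<Union>{mball k r | k r. k \<in> K \<and> inverse (real (Suc n)) \<le> r \<and> mball k (2 * r) \<subseteq> W}"
    for n :: nat
  have U_mono: "U i \<subseteq> U j" if "i \<le> j" for i j
  proof -
    have "inverse (real (Suc j)) \<le> inverse (real (Suc i))" using that by (simp add: field_simps)
    note le = this
    show ?thesis
      unfolding U_def
    proof (rule Union_mono, rule subsetI)
      fix S assume "S \<in> {mball k r | k r. k \<in> K \<and> inverse (real (Suc i)) \<le> r \<and> mball k (2 * r) \<subseteq> W}"
      then obtain k r where S: "S = mball k r" "k \<in> K" "inverse (real (Suc i)) \<le> r" "mball k (2 * r) \<subseteq> W"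
        by blast
      have "inverse (real (Suc j)) \<le> r" using le S(3) by (rule order_trans)
      with S show "S \<in> {mball k r | k r. k \<in> K \<and> inverse (real (Suc j)) \<le> r \<and> mball k (2 * r) \<subseteq> W}"
        by blast
    qed
  qed
  have KM: "K \<subseteq> M" using compactin_subset_topspace[OF assms(1)] by simp
  have open_U: "openin mtopology (U n)" for n
    unfolding U_def by (rule openin_Union) (auto simp: openin_mball)
  have cover: "K \<subseteq> \<Union>(range U)"
  proof
    fix k assume k: "k \<in> K"
    then obtain r where r: "r > 0" "mball k r \<subseteq> W"
      using assms(2,3) unfolding openin_mtopology by blast
    obtain n where n: "inverse (real (Suc n)) < r / 2"
      using reals_Archimedean[of "r / 2"] r(1) by auto
    have "k \<in> mball k (r / 2)" using k KM r(1) by auto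
    moreover have "mball k (r / 2) \<subseteq> U n"
      unfolding U_def
    proof (rule Union_upper, rule CollectI, intro exI conjI)
      show "inverse (real (Suc n)) \<le> r / 2" using n by simp
      show "mball k (2 * (r / 2)) \<subseteq> W" using r(2) by simp
    qed (rule refl, rule k)
    ultimately show "k \<in> \<Union>(range U)" by blast
  qed
  have "\<exists>\<F>. finite \<F> \<and> \<F> \<subseteq> range U \<and> K \<subseteq> \<Union>\<F>"
    using open_U by (intro compactinD[OF assms(1) _ cover]) auto
  then obtain \<F> where \<F>: "finite \<F>" "\<F> \<subseteq> range U" "K \<subseteq> \<Union>\<F>" by blast
  obtain N where N: "finite N" "\<F> = U ` N"
    using finite_subset_image[OF \<F>(1,2)] by blast
  \<comment> \<open>Inserting 0 keeps the maximum defined when the finite subcover is empty.\<close>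
  define m where "m = Max (insert 0 N)"
  have KU: "K \<subseteq> U m"
  proof
    fix k assume "k \<in> K"
    then obtain i where i: "i \<in> N" "k \<in> U i" using \<F>(3) N(2) by blast
    have "i \<le> m" unfolding m_def using N(1) i(1) by simp
    then show "k \<in> U m" using U_mono i(2) by blast
  qed
  have "(\<Union>k\<in>K. mball k (inverse (real (Suc m)))) \<subseteq> W"
  proof
    fix x assume "x \<in> (\<Union>k\<in>K. mball k (inverse (real (Suc m))))"
    then obtain k' where k': "k' \<in> K" "x \<in> mball k' (inverse (real (Suc m)))" by blast
    obtain k r where k: "k' \<in> mball k r" "inverse (real (Suc m)) \<le> r" "mball k (2 * r) \<subseteq> W"
      using subsetD[OF KU k'(1)] unfolding U_def by blast
    have "d k x \<le> d k k' + d k' x" using k k' by (intro triangle) auto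
    then have "x \<in> mball k (2 * r)" using k k' by auto
    then show "x \<in> W" using k(3) by blast
  qed
  then show ?thesis using that by blast
qed

lemma normal_space_altD:
  "normal_space W \<Longrightarrow> closedin W S \<Longrightarrow> openin W U \<Longrightarrow> S \<subseteq> U \<Longrightarrow>
    \<exists>V. openin W V \<and> S \<subseteq> V \<and> W closure_of V \<subseteq> U"
  unfolding normal_space_alt by simp

text \<open>One member is treated at a time. The part of \<open>C\<close> missed by the others is
  closed and lies in \<open>U i\<close>, so normality gives a smaller open set around it; what is
  left of \<open>C\<close> is covered by the remaining members.\<close>

lemma normal_space_shrink_cover:
  assumes "normal_space W" "finite I" "\<And>i. i \<in> I \<Longrightarrow> openin W (U i)" "closedin W C"
    and "C \<subseteq> (\<Union>i\<in>I. U i)"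
  shows "\<exists>V. (\<forall>i\<in>I. openin W (V i) \<and> W closure_of V i \<subseteq> U i) \<and> C \<subseteq> (\<Union>i\<in>I. V i)"
  using assms(2-)
proof (induction I arbitrary: C rule: finite_induct)
  case (insert i I)
  have "openin W (\<Union>j\<in>I. U j)" using insert.prems(1) by (intro openin_Union) auto
  then have "closedin W (C - (\<Union>j\<in>I. U j))" using insert.prems(2) by (rule closedin_diff[rotated])
  moreover have "openin W (U i)" "C - (\<Union>j\<in>I. U j) \<subseteq> U i" using insert.prems by auto
  ultimately have "\<exists>V. openin W V \<and> C - (\<Union>j\<in>I. U j) \<subseteq> V \<and> W closure_of V \<subseteq> U i"
    by (intro normal_space_altD[OF assms(1)])
  then obtain V0 where V0: "openin W V0" "C - (\<Union>j\<in>I. U j) \<subseteq> V0" "W closure_of V0 \<subseteq> U i"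
    by blast
  have "closedin W (C - V0)" using insert.prems(2) V0(1) by (rule closedin_diff)
  moreover have "C - V0 \<subseteq> (\<Union>j\<in>I. U j)" using V0(2) by blast
  moreover have "\<And>j. j \<in> I \<Longrightarrow> openin W (U j)" using insert.prems(1) by blast
  ultimately obtain V where V: "\<forall>j\<in>I. openin W (V j) \<and> W closure_of V j \<subseteq> U j" "C - V0 \<subseteq> (\<Union>j\<in>I. V j)"
    using insert.IH[of "C - V0"] by blast
  let ?V = "\<lambda>j. if j = i then V0 else V j"
  have "\<forall>j\<in>insert i I. openin W (?V j) \<and> W closure_of ?V j \<subseteq> U j"
    using V(1) V0(1,3) by simp
  moreover have "C \<subseteq> (\<Union>j\<in>insert i I. ?V j)"
  proof
    fix x assume x: "x \<in> C"
    show "x \<in> (\<Union>j\<in>insert i I. ?V j)"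
    proof (cases "x \<in> V0")
      case False
      then obtain j where "j \<in> I" "x \<in> V j" using x V(2) by blast
      then show ?thesis using insert.hyps(2) by (intro UN_I[of j]) auto
    qed auto
  qed
  ultimately show ?case by (intro exI[of _ ?V] conjI)
qed simp

section \<open>Closures and extensions of open sets in a compactification\<close>

text \<open>For normal \<open>X\<close>, disjointness of closures singles out the Stone-Cech
  compactification among the Hausdorff ones. All later arguments use it in this form, away from the
  cube.\<close>

locale normal_compactification =
  fixes X :: "'a topology" and Z :: "'z topology" and e :: "'a \<Rightarrow> 'z"
  assumes compact: "compact_space Z" and Hausdorff: "Hausdorff_space Z"
    and embedding: "embedding_map X Z e"
    and dense: "Z closure_of (e ` topspace X) = topspace Z"
    and disjoint_closures: "\<And>F F'. closedin X F \<Longrightarrow> closedin X F' \<Longrightarrow> F \<inter> F' = {} \<Longrightarrow>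
      Z closure_of (e ` F) \<inter> Z closure_of (e ` F') = {}"
begin

abbreviation cl where "cl S \<equiv> Z closure_of (e ` S)"

lemma homeo: "homeomorphic_map X (subtopology Z (e ` topspace X)) e"
  using embedding by (simp add: embedding_map_def)

lemma continuous: "continuous_map X Z e"
  using homeomorphic_imp_continuous_map[OF homeo] by (simp add: continuous_map_in_subtopology)

lemma injective: "inj_on e (topspace X)"
  using homeomorphic_imp_injective_map[OF homeo] .

lemma image_subset: "S \<subseteq> topspace X \<Longrightarrow> e ` S \<subseteq> topspace Z"
  using continuous_map_image_subset_topspace[OF continuous] by blast

lemma subset_cl: "S \<subseteq> topspace X \<Longrightarrow> e ` S \<subseteq> cl S"
  using image_subset by (intro closure_of_subset)

lemma cl_Int_space:
  assumes "closedin X F"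
  shows "cl F \<inter> e ` topspace X = e ` F"
proof -
  have F: "F \<subseteq> topspace X" using assms by (rule closedin_subset)
  have "closedin (subtopology Z (e ` topspace X)) (e ` F)"
    using homeomorphic_map_closedness[OF homeo F] assms by blast
  then have "subtopology Z (e ` topspace X) closure_of (e ` F) = e ` F"
    by (simp add: closure_of_closedin)
  moreover have "e ` topspace X \<inter> e ` F = e ` F" using F by blast
  ultimately show ?thesis by (simp add: closure_of_subtopology Int_commute)
qed

lemma open_preimage: "openin Z W \<Longrightarrow> openin X {x \<in> topspace X. e x \<in> W}"
  using openin_continuous_map_preimage[OF continuous] .

lemma closed_preimage: "closedin Z W \<Longrightarrow> closedin X {x \<in> topspace X. e x \<in> W}"
  using closedin_continuous_map_preimage[OF continuous] .

lemma compact_image: "compactin X K \<Longrightarrow> closedin Z (e ` K)"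
  using image_compactin[OF _ continuous] compactin_imp_closedin[OF Hausdorff] by blast

lemma cl_compact: "compactin X K \<Longrightarrow> cl K = e ` K"
  using compact_image by (simp add: closure_of_closedin)

lemma compact_preimage:
  assumes "closedin Z C" "C \<subseteq> e ` topspace X"
  shows "compactin X {x \<in> topspace X. e x \<in> C}"
proof -
  have "e ` {x \<in> topspace X. e x \<in> C} = C" using assms(2) by auto
  moreover have "compactin (subtopology Z (e ` topspace X)) C"
    using closedin_compact_space[OF compact assms(1)] assms(2) by (simp add: compactin_subtopology)
  ultimately show ?thesis using homeomorphic_map_compactness_eq[OF homeo] by auto
qed

text \<open>Localizes \<open>disjoint_closures\<close>: near a point outside the closure of
  \<open>F \<inter> F'\<close> both sets can be cut down to disjoint closed sets without losing the
  point from their closures.\<close>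

lemma cl_Int:
  assumes F: "closedin X F" and F': "closedin X F'"
  shows "cl F \<inter> cl F' \<subseteq> cl (F \<inter> F')"
proof
  fix y assume y: "y \<in> cl F \<inter> cl F'"
  then have yZ: "y \<in> topspace Z" using closure_of_subset_topspace by fastforce
  show "y \<in> cl (F \<inter> F')"
  proof (rule ccontr)
    assume "y \<notin> cl (F \<inter> F')"
    moreover have "regular_space Z"
      using compact Hausdorff compact_Hausdorff_imp_regular_space by blast
    ultimately obtain U V where U: "openin Z U" "openin Z V" "y \<in> U" "cl (F \<inter> F') \<subseteq> V" "disjnt U V"
      using yZ unfolding regular_space_def by (meson DiffI closedin_closure_of)
    \<comment> \<open>The closure of \<open>U\<close> is taken, rather than \<open>U\<close>, so
      that \<open>F \<inter> T\<close> and \<open>F' \<inter> T\<close> are closed.\<close>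
    define T where "T = {x \<in> topspace X. e x \<in> Z closure_of U}"
    have T: "closedin X T" unfolding T_def by (intro closed_preimage) simp
    have "Z closure_of U \<inter> V = {}"
      using U(2,5) openin_Int_closure_of_eq_empty[OF U(2), of U] by (auto simp: disjnt_def)
    moreover have "e ` (F \<inter> F') \<subseteq> V"
      using subset_cl[of "F \<inter> F'"] closedin_subset[OF F] U(4) by blast
    ultimately have dis: "(F \<inter> T) \<inter> (F' \<inter> T) = {}" unfolding T_def by blast
    have "y \<in> cl (E \<inter> T)" if "y \<in> cl E" "closedin X E" for E
      unfolding in_closure_of
    proof (intro conjI allI impI yZ)
      fix N assume N: "y \<in> N \<and> openin Z N"
      then have "y \<in> N \<inter> U \<and> openin Z (N \<inter> U)" using U by blast
      moreover have "\<forall>T. y \<in> T \<and> openin Z T \<longrightarrow> (\<exists>z. z \<in> e ` E \<and> z \<in> T)"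
        using that(1) unfolding in_closure_of by (rule conjunct2)
      ultimately obtain x where x: "x \<in> E" "e x \<in> N" "e x \<in> U" by blast
      have "e x \<in> Z closure_of U"
        using closure_of_subset[OF openin_subset[OF U(1)]] x(3) by (rule subsetD)
      then have "x \<in> E \<inter> T" using x(1) closedin_subset[OF that(2)] by (auto simp: T_def)
      then have "e x \<in> e ` (E \<inter> T)" by (rule imageI)
      then show "\<exists>z. z \<in> e ` (E \<inter> T) \<and> z \<in> N" using x(2) by blast
    qed
    then have "y \<in> cl (F \<inter> T)" "y \<in> cl (F' \<inter> T)" using y F F' by auto
    then show False
      using disjoint_closures[OF closedin_Int[OF F T] closedin_Int[OF F' T] dis] by blast
  qed
qed

definition ext where "ext U = topspace Z - cl (topspace X - U)"

definition rest where "rest = topspace Z - e ` topspace X"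

lemma open_ext: "openin Z (ext U)"
  unfolding ext_def by (intro openin_diff) auto

lemma ext_mono: "U \<subseteq> V \<Longrightarrow> ext U \<subseteq> ext V"
  unfolding ext_def by (intro Diff_mono closure_of_mono image_mono order_refl)

text \<open>Complements turn the intersection into a union, and closure commutes with finite
  unions.\<close>

lemma ext_Int: "ext (U \<inter> V) = ext U \<inter> ext V"
proof -
  have "topspace X - U \<inter> V = (topspace X - U) \<union> (topspace X - V)" by blast
  then have "cl (topspace X - U \<inter> V) = cl (topspace X - U) \<union> cl (topspace X - V)"
    by (simp add: image_Un)
  then show ?thesis unfolding ext_def by blast
qed

lemma ext_INT: "finite s \<Longrightarrow> s \<noteq> {} \<Longrightarrow> ext (\<Inter>v\<in>s. U v) = (\<Inter>v\<in>s. ext (U v))"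
  by (induction s rule: finite_ne_induct) (simp_all add: ext_Int)

lemma ext_empty: "ext {} = {}"
  unfolding ext_def using dense by simp

lemma ext_subset_cl:
  assumes "U \<subseteq> topspace X"
  shows "ext U \<subseteq> cl U"
proof -
  have "topspace X = U \<union> (topspace X - U)" using assms by blast
  then have "topspace Z = cl U \<union> cl (topspace X - U)"
    using dense by (metis closure_of_Un image_Un)
  then show ?thesis unfolding ext_def by blast
qed

lemma rest_closed:
  assumes "closedin X A"
  shows "cl A - e ` A = cl A \<inter> rest"
  using cl_Int_space[OF assms] closure_of_subset_topspace[of Z "e ` A"] closedin_subset[OF assms]
  unfolding rest_def by blast

text \<open>By contraposition: if \<open>U\<close> misses \<open>A\<close>, the closure of
  \<open>A\<close> lies in the closure of the complement of \<open>U\<close>, which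
  \<open>ext U\<close> avoids.\<close>

lemma ext_Int_closed_nonempty:
  assumes "closedin X A" "ext U \<inter> cl A \<noteq> {}"
  shows "U \<inter> A \<noteq> {}"
proof
  assume "U \<inter> A = {}"
  then have "cl A \<subseteq> cl (topspace X - U)"
    using closedin_subset[OF assms(1)] by (intro closure_of_mono image_mono) blast
  then show False using assms(2) unfolding ext_def by blast
qed

text \<open>Members are removed one at a time. A point in the closure of \<open>A\<close> outside
  \<open>ext (U v)\<close> lies in the closures of \<open>A\<close> and of the complement of
  \<open>U v\<close>, hence by \<open>cl_Int\<close> in the closure of \<open>A\<close> minus
  \<open>U v\<close>, where the other members take over. In a general compactification this fails:
  two overlapping half-lines cover the real line, but neither extends over the point at
  infinity.\<close>

lemma cl_subset_ext_cover:
  assumes "finite S" "\<And>v. v \<in> S \<Longrightarrow> openin X (U v)" "compactin X K" "closedin X A"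
    and "A - K \<subseteq> (\<Union>v\<in>S. U v)"
  shows "cl A - e ` K \<subseteq> (\<Union>v\<in>S. ext (U v))"
  using assms(1,2,4,5)
proof (induction S arbitrary: A rule: finite_induct)
  case empty
  then have "cl A \<subseteq> cl K" by (intro closure_of_mono image_mono) blast
  then show ?case using cl_compact[OF assms(3)] by blast
next
  case (insert v S)
  let ?A = "A \<inter> (topspace X - U v)"
  have c: "closedin X (topspace X - U v)" using insert.prems(1) by (intro closedin_diff) auto
  have "cl ?A - e ` K \<subseteq> (\<Union>v\<in>S. ext (U v))"
  proof (rule insert.IH)
    show "closedin X ?A" using insert.prems(2) c by (rule closedin_Int)
    show "?A - K \<subseteq> (\<Union>v\<in>S. U v)" using insert.prems(3) by blast
  qed (use insert.prems(1) in blast)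
  moreover have "cl A - ext (U v) \<subseteq> cl ?A"
    using cl_Int[OF insert.prems(2) c] closure_of_subset_topspace[of Z "e ` A"]
    unfolding ext_def by blast
  ultimately show ?case by blast
qed

text \<open>Removing \<open>K\<close> enlarges the closure of the complement only by the image of
  \<open>K\<close>, which does not meet the remainder.\<close>

lemma ext_diff_compact:
  assumes "compactin X K" "U \<subseteq> topspace X"
  shows "ext (U - K) \<inter> rest = ext U \<inter> rest"
proof -
  have K: "K \<subseteq> topspace X" using compactin_subset_topspace[OF assms(1)] .
  then have "topspace X - (U - K) = (topspace X - U) \<union> K" using assms(2) by blast
  then have "cl (topspace X - (U - K)) = cl (topspace X - U) \<union> e ` K"
    using cl_compact[OF assms(1)] by (simp add: image_Un)
  moreover have "e ` K \<inter> rest = {}" using K unfolding rest_def by blast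
  ultimately show ?thesis unfolding ext_def by blast
qed

end

lemma finite_open_familyD:
  assumes "finite_open_family T \<alpha>"
  shows "finite (index \<alpha>)" "subindex \<alpha> \<subseteq> index \<alpha>" "v \<in> index \<alpha> \<Longrightarrow> openin T (member \<alpha> v)"
    "finite (subindex \<alpha>)" "v \<in> subindex \<alpha> \<Longrightarrow> openin T (member \<alpha> v)" "finite_family \<alpha>"
  using assms finite_subset unfolding finite_open_family_def finite_family_def by auto

section \<open>Border covers and covers of the remainder\<close>

locale metrizable_compactification = normal_compactification X Z e
  for X :: "'a topology" and Z :: "'z topology" and e :: "'a \<Rightarrow> 'z" +
  assumes metrizable: "metrizable_space X"
begin

lemma Hausdorff_base: "Hausdorff_space X"
  using metrizable by (rule metrizable_imp_Hausdorff_space)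

text \<open>A non-compact closure contains an infinite closed discrete set, which has limit points in the
  remainder.\<close>

lemma compact_closure_if_ext_disjoint:
  assumes U: "openin X U" and A: "closedin X A" and disj: "ext U \<inter> (cl A \<inter> rest) = {}"
  shows "compactin X (X closure_of (U \<inter> A))"
proof -
  obtain M d where M: "Metric_space M d" "X = Metric_space.mtopology M d"
    using metrizable unfolding metrizable_space_def by blast
  interpret Metric_space M d by fact
  have "X derived_set_of T \<noteq> {}" if T: "infinite T" "T \<subseteq> U \<inter> A" "T \<subseteq> topspace X" for T
  proof
    assume der: "X derived_set_of T = {}"
    have Tc: "closedin X T" using T(3) der by (simp add: closedin_contains_derived_set)
    have "closedin X (topspace X - U)" using U by blast
    \<comment> \<open>\<open>T\<close> and the complement of \<open>U\<close> are disjoint closed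
      sets, so the closure of \<open>T\<close> stays in \<open>ext U\<close>, and it lies in the
      closure of \<open>A\<close>. It therefore misses the remainder, \<open>T\<close> is closed in
      the compactification, hence compact, and an infinite compact set has a limit point.\<close>
    then have "cl T \<inter> cl (topspace X - U) = {}"
      using T(2) by (intro disjoint_closures[OF Tc]) auto
    then have "cl T \<subseteq> ext U" using closure_of_subset_topspace[of Z "e ` T"] unfolding ext_def by blast
    moreover have "cl T \<subseteq> cl A" using T(2) by (intro closure_of_mono image_mono) blast
    ultimately have "cl T \<inter> rest = {}" using disj by blast
    then have "cl T \<subseteq> e ` topspace X"
      using closure_of_subset_topspace[of Z "e ` T"] unfolding rest_def by blast
    then have "cl T = e ` T" using cl_Int_space[OF Tc] by blast
    then have "closedin Z (e ` T)" by (metis closedin_closure_of)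
    then have "compactin X {x \<in> topspace X. e x \<in> e ` T}"
      using T(3) by (intro compact_preimage) auto
    moreover have "{x \<in> topspace X. e x \<in> e ` T} = T"
      using T(3) injective by (auto simp: inj_on_def)
    ultimately have "compactin X T" by simp
    then show False using compactin_imp_Bolzano_Weierstrass[OF _ conjI[OF T(1) order_refl]] der by blast
  qed
  then have "\<forall>T. infinite T \<and> T \<subseteq> U \<inter> A \<and> T \<subseteq> M \<longrightarrow> mtopology derived_set_of T \<noteq> {}"
    using M(2) by auto
  then show ?thesis unfolding M(2) compact_closure_of_eq_Bolzano_Weierstrass .
qed

text \<open>A compact subset of a metrizable space has a countable neighbourhood base, so its complement
  in the compactification is an \<open>F\<^sub>\<sigma>\<close> set.\<close>

lemma normal_space_complement_compact:
  assumes K: "compactin X K"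
  shows "normal_space (subtopology Z (topspace Z - e ` K))"
proof (rule normal_space_fsigma_subtopology)
  show "normal_space Z" using compact Hausdorff compact_Hausdorff_or_regular_imp_normal_space by blast
  obtain M d where M: "Metric_space M d" "X = Metric_space.mtopology M d"
    using metrizable unfolding metrizable_space_def by blast
  interpret Metric_space M d by fact
  have top: "topspace X = M" using M(2) by simp
  have KM: "K \<subseteq> topspace X" using compactin_subset_topspace[OF K] .
  define Q where "Q m = (\<Union>k\<in>K. mball k (inverse (real (Suc m))))" for m
  have Q: "openin X (Q m)" for m
    unfolding Q_def M(2) by (intro openin_Union) auto
  have KQ: "K \<subseteq> Q m" for m
  proof
    fix k assume "k \<in> K"
    moreover have "k \<in> mball k (inverse (real (Suc m)))" using calculation KM top by auto
    ultimately show "k \<in> Q m" unfolding Q_def by blast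
  qed
  have QX: "Q m \<subseteq> topspace X" for m using openin_subset[OF Q] .
  \<comment> \<open>For the second inclusion the point is separated from the image of
    \<open>K\<close> by open sets, and some \<open>Q m\<close> maps into the one around that image.
    By density a point outside the closure of \<open>Q m\<close> lies in the closure of its
    complement.\<close>
  have "(\<Union>m. cl (topspace X - Q m)) = topspace Z - e ` K"
  proof (intro equalityI subsetI)
    fix y assume "y \<in> (\<Union>m. cl (topspace X - Q m))"
    then obtain m where m: "y \<in> cl (topspace X - Q m)" by blast
    have "closedin X (topspace X - Q m)" using Q by blast
    then have "cl (topspace X - Q m) \<inter> e ` topspace X = e ` (topspace X - Q m)" by (rule cl_Int_space)
    moreover have "e ` (topspace X - Q m) \<inter> e ` K = {}"
      using injective KM KQ[of m] by (auto simp: inj_on_def)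
    moreover have "e ` K \<subseteq> e ` topspace X" using KM by blast
    ultimately have "y \<notin> e ` K" using m by blast
    moreover have "y \<in> topspace Z" using m closure_of_subset_topspace[of Z] by blast
    ultimately show "y \<in> topspace Z - e ` K" by blast
  next
    fix y assume y: "y \<in> topspace Z - e ` K"
    have "regular_space Z" using compact Hausdorff compact_Hausdorff_imp_regular_space by blast
    then obtain V W where V: "openin Z V" "openin Z W" "y \<in> V" "e ` K \<subseteq> W" "disjnt V W"
      using y compact_image[OF K] unfolding regular_space_def by meson
    have "openin mtopology {x \<in> topspace X. e x \<in> W}" using open_preimage[OF V(2)] M(2) by simp
    moreover have "compactin mtopology K" using K M(2) by simp
    moreover have "K \<subseteq> {x \<in> topspace X. e x \<in> W}" using KM V(4) by blast
    ultimately obtain m where m: "Q m \<subseteq> {x \<in> topspace X. e x \<in> W}"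
      using compact_subset_open_uniform[of K "{x \<in> topspace X. e x \<in> W}"] unfolding Q_def by blast
    have "V \<inter> Z closure_of W = {}"
      using V(5) openin_Int_closure_of_eq_empty[OF V(1), of W] by (simp add: disjnt_def)
    moreover have "cl (Q m) \<subseteq> Z closure_of W" using m by (intro closure_of_mono) blast
    ultimately have "y \<notin> cl (Q m)" using V(3) by blast
    moreover have "topspace X = Q m \<union> (topspace X - Q m)" using QX[of m] by blast
    then have "topspace Z = cl (Q m) \<union> cl (topspace X - Q m)"
      using dense by (metis closure_of_Un image_Un)
    ultimately show "y \<in> (\<Union>m. cl (topspace X - Q m))" using y by blast
  qed
  moreover have "fsigma_in Z (\<Union>(range (\<lambda>m. cl (topspace X - Q m))))"
    by (intro fsigma_in_Union) (auto intro: closed_imp_fsigma_in)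
  ultimately show "fsigma_in Z (topspace Z - e ` K)" by simp
qed

definition remainder_family :: "'a family \<Rightarrow> 'z family" where
  "remainder_family \<alpha> = \<lparr>index = index \<alpha>, subindex = subindex \<alpha>,
     member = (\<lambda>v\<in>index \<alpha>. ext (member \<alpha> v) \<inter> rest)\<rparr>"

lemma index_remainder_family [simp]:
  "index (remainder_family \<alpha>) = index \<alpha>" "subindex (remainder_family \<alpha>) = subindex \<alpha>"
  "v \<in> index \<alpha> \<Longrightarrow> member (remainder_family \<alpha>) v = ext (member \<alpha> v) \<inter> rest"
  by (simp_all add: remainder_family_def)

lemma border_coversE:
  assumes "\<alpha> \<in> border_covers X A"
  obtains K where "compactin X K" "topspace X - K = (\<Union>v\<in>index \<alpha>. member \<alpha> v)"
    "A - K \<subseteq> (\<Union>v\<in>subindex \<alpha>. member \<alpha> v)" "finite_open_family X \<alpha>"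
  using assms unfolding border_covers_def by blast

text \<open>\<open>cl_subset_ext_cover\<close> is applied to the whole space and to
  \<open>A\<close>. The exceptional compact set stays inside the image of \<open>X\<close>, so it
  leaves no gap on the remainder.\<close>

lemma remainder_family_cover:
  assumes "\<alpha> \<in> border_covers X A" "closedin X A"
  shows "remainder_family \<alpha> \<in> finite_open_covers (subtopology Z rest) (cl A - e ` A)"
proof -
  obtain K where K: "compactin X K" "topspace X - K = (\<Union>v\<in>index \<alpha>. member \<alpha> v)"
    "A - K \<subseteq> (\<Union>v\<in>subindex \<alpha>. member \<alpha> v)" "finite_open_family X \<alpha>"
    using assms(1) by (rule border_coversE)
  note fam = finite_open_familyD[OF K(4)]
  have eK: "e ` K \<inter> rest = {}"
    using compactin_subset_topspace[OF K(1)] unfolding rest_def by blast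
  have top: "topspace (subtopology Z rest) = rest" unfolding rest_def by auto
  have "finite_open_family (subtopology Z rest) (remainder_family \<alpha>)"
    unfolding finite_open_family_def
    using fam by (auto simp: remainder_family_def intro!: openin_subtopology_Int open_ext)
  moreover have "(\<Union>v\<in>index \<alpha>. ext (member \<alpha> v) \<inter> rest) = rest"
  proof -
    have "cl (topspace X) - e ` K \<subseteq> (\<Union>v\<in>index \<alpha>. ext (member \<alpha> v))"
      using K(2) by (intro cl_subset_ext_cover fam K(1)) auto
    moreover have "rest \<subseteq> cl (topspace X) - e ` K"
      using eK unfolding dense unfolding rest_def by blast
    ultimately show ?thesis by blast
  qed
  moreover have "cl A - e ` A \<subseteq> (\<Union>v\<in>subindex \<alpha>. ext (member \<alpha> v) \<inter> rest)"
  proof -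
    have "cl A - e ` K \<subseteq> (\<Union>v\<in>subindex \<alpha>. ext (member \<alpha> v))"
      using K(3) by (intro cl_subset_ext_cover fam K(1) assms(2))
    then show ?thesis unfolding rest_closed[OF assms(2)] using eK by blast
  qed
  moreover have "(\<Union>v\<in>S. member (remainder_family \<alpha>) v) = (\<Union>v\<in>S. ext (member \<alpha> v) \<inter> rest)"
    if "S \<subseteq> index \<alpha>" for S
    using that by (intro SUP_cong) auto
  ultimately show ?thesis
    unfolding finite_open_covers_def top using fam(2) by simp
qed

lemma remainder_family_projection:
  assumes "refinement_projection \<alpha> \<beta> p"
  shows "refinement_projection (remainder_family \<alpha>) (remainder_family \<beta>) p"
proof (rule refinement_projectionI)
  fix v assume "v \<in> index (remainder_family \<beta>)"
  then have v: "v \<in> index \<beta>" by simp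
  show "member (remainder_family \<beta>) v \<subseteq> member (remainder_family \<alpha>) (p v)"
    using ext_mono[OF refinement_projectionD(3)[OF assms v]] v refinement_projectionD(1)[OF assms v]
    by auto
qed (use refinement_projectionD(1,2)[OF assms] in auto)

lemma border_covers_directed:
  assumes "\<alpha> \<in> border_covers X A" "\<beta> \<in> border_covers X A"
  shows "\<exists>\<gamma>\<in>border_covers X A. refined_by \<alpha> \<gamma> \<and> refined_by \<beta> \<gamma>"
proof -
  obtain K where K: "compactin X K" "topspace X - K = (\<Union>v\<in>index \<alpha>. member \<alpha> v)"
    "A - K \<subseteq> (\<Union>v\<in>subindex \<alpha>. member \<alpha> v)" "finite_open_family X \<alpha>"
    using assms(1) by (rule border_coversE)
  obtain L where L: "compactin X L" "topspace X - L = (\<Union>v\<in>index \<beta>. member \<beta> v)"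
    "A - L \<subseteq> (\<Union>v\<in>subindex \<beta>. member \<beta> v)" "finite_open_family X \<beta>"
    using assms(2) by (rule border_coversE)
  note fK = finite_open_familyD[OF K(4)] and fL = finite_open_familyD[OF L(4)]
  \<comment> \<open>Pairs of indices are coded as natural numbers, the index type of
    families.\<close>
  let ?l = "\<lambda>v. fst (prod_decode v)" and ?r = "\<lambda>v. snd (prod_decode v)"
  define \<gamma> where "\<gamma> = \<lparr>index = prod_encode ` (index \<alpha> \<times> index \<beta>),
    subindex = prod_encode ` (subindex \<alpha> \<times> subindex \<beta>),
    member = (\<lambda>v\<in>prod_encode ` (index \<alpha> \<times> index \<beta>). member \<alpha> (?l v) \<inter> member \<beta> (?r v))\<rparr>"
  have fam: "finite_open_family X \<gamma>"
    unfolding finite_open_family_def \<gamma>_def using fK fL by (auto intro!: finite_imageI)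
  have un: "(\<Union>v\<in>prod_encode ` (S \<times> T). member \<gamma> v) = (\<Union>v\<in>S. member \<alpha> v) \<inter> (\<Union>v\<in>T. member \<beta> v)"
    if "S \<subseteq> index \<alpha>" "T \<subseteq> index \<beta>" for S T
  proof -
    have "(\<Union>v\<in>prod_encode ` (S \<times> T). member \<gamma> v) = (\<Union>p\<in>S \<times> T. member \<gamma> (prod_encode p))"
      by (simp add: image_image)
    also have "\<dots> = (\<Union>p\<in>S \<times> T. member \<alpha> (fst p) \<inter> member \<beta> (snd p))"
      using that by (intro SUP_cong refl) (auto simp: \<gamma>_def)
    also have "\<dots> = (\<Union>v\<in>S. member \<alpha> v) \<inter> (\<Union>v\<in>T. member \<beta> v)" by auto
    finally show ?thesis .
  qed
  have "\<gamma> \<in> border_covers X A"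
    unfolding border_covers_def
  proof (intro CollectI conjI fam exI[of _ "K \<union> L"])
    show "compactin X (K \<union> L)" using K(1) L(1) by (rule compactin_Un)
    have "(\<Union>v\<in>index \<gamma>. member \<gamma> v) = (topspace X - K) \<inter> (topspace X - L)"
      using un[of "index \<alpha>" "index \<beta>"] K(2) L(2) by (simp add: \<gamma>_def)
    then show "topspace X - (K \<union> L) = (\<Union>v\<in>index \<gamma>. member \<gamma> v)" by blast
    have u: "(\<Union>v\<in>subindex \<gamma>. member \<gamma> v) = (\<Union>v\<in>subindex \<alpha>. member \<alpha> v) \<inter> (\<Union>v\<in>subindex \<beta>. member \<beta> v)"
      using un[of "subindex \<alpha>" "subindex \<beta>"] fK fL by (simp add: \<gamma>_def)
    have "A - (K \<union> L) \<subseteq> (A - K) \<inter> (A - L)" by blast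
    also have "\<dots> \<subseteq> (\<Union>v\<in>subindex \<gamma>. member \<gamma> v)" unfolding u using K(3) L(3) by (rule Int_mono)
    finally show "A - (K \<union> L) \<subseteq> (\<Union>v\<in>subindex \<gamma>. member \<gamma> v)" .
  qed
  moreover have "refinement_projection \<alpha> \<gamma> ?l" "refinement_projection \<beta> \<gamma> ?r"
    by (rule refinement_projectionI; auto simp: \<gamma>_def)+
  ultimately show ?thesis unfolding refined_by_def by blast
qed

lemma family_carrier_remainder_family:
  assumes "finite s" "s \<noteq> {}" "s \<subseteq> index \<alpha>"
  shows "family_carrier (remainder_family \<alpha>) s = ext (family_carrier \<alpha> s) \<inter> rest"
proof -
  have "family_carrier (remainder_family \<alpha>) s = (\<Inter>v\<in>s. ext (member \<alpha> v) \<inter> rest)"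
    unfolding family_carrier_def using assms(3) by (intro INF_cong) auto
  also have "\<dots> = (\<Inter>v\<in>s. ext (member \<alpha> v)) \<inter> rest" using assms(2) by blast
  finally show ?thesis unfolding family_carrier_def ext_INT[OF assms(1,2)] .
qed

text \<open>Nonempty carriers that do not reach the remainder are invisible in the nerve of the
  remainder family. They have compact closure, so they disappear from a finer border cover.\<close>

definition nonvanishing_covers :: "'a set \<Rightarrow> 'a family set" where
  "nonvanishing_covers A = {\<alpha> \<in> border_covers X A.
     (\<forall>s\<in>nerve \<alpha>. ext (family_carrier \<alpha> s) \<inter> rest \<noteq> {}) \<and>
     (\<forall>s\<in>subnerve A \<alpha>. ext (family_carrier \<alpha> s) \<inter> (cl A \<inter> rest) \<noteq> {})}"

text \<open>Passing to the remainder can only lose simplexes: \<open>ext\<close> of an empty carrier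
  is empty, and \<open>ext\<close> of a set that misses \<open>A\<close> misses the closure of
  \<open>A\<close>. The conditions in \<open>nonvanishing_covers\<close> say that none is
  lost.\<close>

lemma nerve_remainder_family:
  assumes "\<alpha> \<in> nonvanishing_covers A" "closedin X A"
  shows "nerve (remainder_family \<alpha>) = nerve \<alpha>"
    and "subnerve (cl A - e ` A) (remainder_family \<alpha>) = subnerve A \<alpha>"
proof -
  have n1: "\<And>s. s \<in> nerve \<alpha> \<Longrightarrow> ext (family_carrier \<alpha> s) \<inter> rest \<noteq> {}"
    and n2: "\<And>s. s \<in> subnerve A \<alpha> \<Longrightarrow> ext (family_carrier \<alpha> s) \<inter> (cl A \<inter> rest) \<noteq> {}"
    and b: "\<alpha> \<in> border_covers X A"
    using assms(1) unfolding nonvanishing_covers_def by auto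
  have si: "subindex \<alpha> \<subseteq> index \<alpha>"
    using b by (auto simp: border_covers_def finite_open_family_def)
  show "nerve (remainder_family \<alpha>) = nerve \<alpha>"
  proof (intro equalityI subsetI)
    fix s assume s: "s \<in> nerve (remainder_family \<alpha>)"
    then have "finite s" "s \<noteq> {}" "s \<subseteq> index \<alpha>" by (auto simp: nerve_def)
    moreover from this have "ext (family_carrier \<alpha> s) \<inter> rest \<noteq> {}"
      using s family_carrier_remainder_family[of s \<alpha>] by (auto simp: nerve_def)
    then have "family_carrier \<alpha> s \<noteq> {}" using ext_empty by force
    ultimately show "s \<in> nerve \<alpha>" by (simp add: nerve_def)
  next
    fix s assume s: "s \<in> nerve \<alpha>"
    then have "finite s" "s \<noteq> {}" "s \<subseteq> index \<alpha>" by (auto simp: nerve_def)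
    then show "s \<in> nerve (remainder_family \<alpha>)"
      using n1[OF s] family_carrier_remainder_family[of s \<alpha>] by (simp add: nerve_def)
  qed
  show "subnerve (cl A - e ` A) (remainder_family \<alpha>) = subnerve A \<alpha>"
  proof (intro equalityI subsetI)
    fix s assume s: "s \<in> subnerve (cl A - e ` A) (remainder_family \<alpha>)"
    then have f: "finite s" "s \<noteq> {}" "s \<subseteq> subindex \<alpha>" by (auto simp: subnerve_def)
    then have "family_carrier (remainder_family \<alpha>) s = ext (family_carrier \<alpha> s) \<inter> rest"
      using si by (intro family_carrier_remainder_family) auto
    moreover have "family_carrier (remainder_family \<alpha>) s \<inter> (cl A \<inter> rest) \<noteq> {}"
      using s unfolding rest_closed[OF assms(2)] by (simp add: subnerve_def)
    ultimately have "ext (family_carrier \<alpha> s) \<inter> cl A \<noteq> {}" by blast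
    then have "family_carrier \<alpha> s \<inter> A \<noteq> {}" by (rule ext_Int_closed_nonempty[OF assms(2)])
    then show "s \<in> subnerve A \<alpha>" using f by (simp add: subnerve_def)
  next
    fix s assume s: "s \<in> subnerve A \<alpha>"
    then have f: "finite s" "s \<noteq> {}" "s \<subseteq> subindex \<alpha>" by (auto simp: subnerve_def)
    then have "family_carrier (remainder_family \<alpha>) s = ext (family_carrier \<alpha> s) \<inter> rest"
      using si by (intro family_carrier_remainder_family) auto
    then have "family_carrier (remainder_family \<alpha>) s \<inter> (cl A \<inter> rest) \<noteq> {}"
      using n2[OF s] by blast
    then show "s \<in> subnerve (cl A - e ` A) (remainder_family \<alpha>)"
      unfolding rest_closed[OF assms(2)] using f by (simp add: subnerve_def)
  qed
qed

lemma border_covers_diff_compact: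
  assumes "\<alpha> \<in> border_covers X A" "compactin X L"
  shows "\<alpha>\<lparr>member := \<lambda>v\<in>index \<alpha>. member \<alpha> v - L\<rparr> \<in> border_covers X A"
proof -
  obtain K where K: "compactin X K" "topspace X - K = (\<Union>v\<in>index \<alpha>. member \<alpha> v)"
    "A - K \<subseteq> (\<Union>v\<in>subindex \<alpha>. member \<alpha> v)" "finite_open_family X \<alpha>"
    using assms(1) by (rule border_coversE)
  note fam = finite_open_familyD[OF K(4)]
  have "closedin X L" using Hausdorff_base assms(2) by (rule compactin_imp_closedin)
  then have op: "finite_open_family X (\<alpha>\<lparr>member := \<lambda>v\<in>index \<alpha>. member \<alpha> v - L\<rparr>)"
    unfolding finite_open_family_def using fam by (auto intro!: openin_diff)
  have un: "(\<Union>v\<in>S. (\<lambda>v\<in>index \<alpha>. member \<alpha> v - L) v) = (\<Union>v\<in>S. member \<alpha> v) - L" if "S \<subseteq> index \<alpha>" for S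
    using that by auto
  show ?thesis
    unfolding border_covers_def
  proof (intro CollectI conjI op exI[of _ "K \<union> L"])
    show "compactin X (K \<union> L)" using K(1) assms(2) by (rule compactin_Un)
    show "topspace X - (K \<union> L) =
        (\<Union>v\<in>index (\<alpha>\<lparr>member := \<lambda>v\<in>index \<alpha>. member \<alpha> v - L\<rparr>).
          member (\<alpha>\<lparr>member := \<lambda>v\<in>index \<alpha>. member \<alpha> v - L\<rparr>) v)"
      using un[of "index \<alpha>"] K(2) by auto
    have "A - (K \<union> L) \<subseteq> (\<Union>v\<in>subindex \<alpha>. member \<alpha> v) - L" using K(3) by blast
    then show "A - (K \<union> L) \<subseteq>
        (\<Union>v\<in>subindex (\<alpha>\<lparr>member := \<lambda>v\<in>index \<alpha>. member \<alpha> v - L\<rparr>).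
          member (\<alpha>\<lparr>member := \<lambda>v\<in>index \<alpha>. member \<alpha> v - L\<rparr>) v)"
      using un[OF fam(2)] by simp
  qed
qed

text \<open>The carriers that miss the remainder, and the parts in \<open>A\<close> of those that
  miss the remainder of \<open>A\<close>, have compact closures with compact union \<open>L\<close>.
  Subtracting \<open>L\<close> from all members empties them and keeps every trace of
  \<open>ext\<close> on the remainder, so no further carrier starts to vanish.\<close>

lemma nonvanishing_covers_cofinal:
  assumes "\<alpha> \<in> border_covers X A" "closedin X A"
  shows "\<exists>\<beta>\<in>nonvanishing_covers A. refined_by \<alpha> \<beta>"
proof -
  have "finite_open_family X \<alpha>" using assms(1) by (simp add: border_covers_def)
  note fam = finite_open_familyD[OF this]
  let ?c = "family_carrier \<alpha>"
  define S where "S = {s. s \<noteq> {} \<and> s \<subseteq> index \<alpha> \<and> ext (?c s) \<inter> rest = {}}"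
  \<comment> \<open>A carrier may miss the remainder of \<open>A\<close> and still reach the
    remainder elsewhere, so for \<open>T\<close> only its part in \<open>A\<close> is
    removed.\<close>
  define T where "T = {s. s \<noteq> {} \<and> s \<subseteq> index \<alpha> \<and> ext (?c s) \<inter> (cl A \<inter> rest) = {}}"
  define L where "L = \<Union>((\<lambda>s. X closure_of ?c s) ` S \<union> (\<lambda>s. X closure_of (?c s \<inter> A)) ` T)"
  define \<beta> where "\<beta> = \<alpha>\<lparr>member := \<lambda>v\<in>index \<alpha>. member \<alpha> v - L\<rparr>"
  have fin: "finite S" "finite T"
    unfolding S_def T_def using fam(1) by (auto intro: finite_subset[of _ "Pow (index \<alpha>)"])
  have c_open: "openin X (?c s)" if "s \<noteq> {}" "s \<subseteq> index \<alpha>" for s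
    unfolding family_carrier_def
    using finite_subset[OF that(2) fam(1)] that fam(3) by (intro openin_INT2) auto
  have "compactin X (X closure_of ?c s)" if "s \<in> S" for s
  proof -
    have s: "openin X (?c s)" using that c_open unfolding S_def by blast
    \<comment> \<open>The condition in \<open>S\<close> is the case of the whole space, whose
      closure is everything.\<close>
    have "ext (?c s) \<inter> (cl (topspace X) \<inter> rest) = {}" using that unfolding S_def by blast
    from compact_closure_if_ext_disjoint[OF s closedin_topspace this]
    show ?thesis using openin_subset[OF s] by (simp add: Int_absorb2)
  qed
  moreover have "compactin X (X closure_of (?c s \<inter> A))" if "s \<in> T" for s
    using that c_open unfolding T_def by (intro compact_closure_if_ext_disjoint assms(2)) auto
  ultimately have L: "compactin X L"
    unfolding L_def using fin by (intro compactin_Union) auto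
  have \<beta>b: "\<beta> \<in> border_covers X A"
    unfolding \<beta>_def by (rule border_covers_diff_compact[OF assms(1) L])
  have ix: "index \<beta> = index \<alpha>" "subindex \<beta> = subindex \<alpha>" by (simp_all add: \<beta>_def)
  have car: "family_carrier \<beta> s = ?c s - L" if "s \<noteq> {}" "s \<subseteq> index \<alpha>" for s
  proof -
    have "family_carrier \<beta> s = (\<Inter>v\<in>s. member \<alpha> v - L)"
      unfolding family_carrier_def \<beta>_def using that(2) by (intro INF_cong) auto
    then show ?thesis using that(1) unfolding family_carrier_def by blast
  qed
  have ext_car: "ext (family_carrier \<beta> s) \<inter> rest = ext (?c s) \<inter> rest" if "s \<noteq> {}" "s \<subseteq> index \<alpha>" for s
    unfolding car[OF that] by (intro ext_diff_compact L openin_subset c_open that)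
  have "ext (family_carrier \<beta> s) \<inter> rest \<noteq> {}" if "s \<in> nerve \<beta>" for s
  proof -
    have s: "s \<noteq> {}" "s \<subseteq> index \<alpha>" "?c s - L \<noteq> {}"
      using that car[of s] by (auto simp: nerve_def ix)
    have "?c s \<subseteq> X closure_of ?c s" by (intro closure_of_subset openin_subset c_open s)
    then have "s \<notin> S" using s(3) unfolding L_def by blast
    then show ?thesis unfolding ext_car[OF s(1,2)] using s unfolding S_def by blast
  qed
  moreover have "ext (family_carrier \<beta> s) \<inter> (cl A \<inter> rest) \<noteq> {}" if "s \<in> subnerve A \<beta>" for s
  proof -
    have s: "s \<noteq> {}" "s \<subseteq> index \<alpha>" "(?c s - L) \<inter> A \<noteq> {}"
      using that car[of s] fam(2) by (auto simp: subnerve_def ix)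
    have "?c s \<inter> A \<subseteq> X closure_of (?c s \<inter> A)"
      using closedin_subset[OF assms(2)] by (intro closure_of_subset) blast
    then have "s \<notin> T" using s(3) unfolding L_def by blast
    then have "ext (?c s) \<inter> (cl A \<inter> rest) \<noteq> {}" using s unfolding T_def by blast
    then show ?thesis using ext_car[OF s(1,2)] by blast
  qed
  ultimately have "\<beta> \<in> nonvanishing_covers A" using \<beta>b unfolding nonvanishing_covers_def by blast
  moreover have "refinement_projection \<alpha> \<beta> id"
    by (rule refinement_projectionI) (auto simp: \<beta>_def)
  ultimately show ?thesis unfolding refined_by_def by blast
qed

lemma nonvanishing_covers_directed:
  assumes "\<alpha> \<in> nonvanishing_covers A" "\<beta> \<in> nonvanishing_covers A" "closedin X A"
  shows "\<exists>\<gamma>\<in>nonvanishing_covers A. refined_by \<alpha> \<gamma> \<and> refined_by \<beta> \<gamma>"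
proof -
  obtain \<gamma> where g: "\<gamma> \<in> border_covers X A" "refined_by \<alpha> \<gamma>" "refined_by \<beta> \<gamma>"
    using border_covers_directed[of \<alpha> A \<beta>] assms unfolding nonvanishing_covers_def by blast
  obtain \<delta> where d: "\<delta> \<in> nonvanishing_covers A" "refined_by \<gamma> \<delta>"
    using nonvanishing_covers_cofinal[OF g(1) assms(3)] by blast
  show ?thesis
    using d(1) refined_by_trans[OF g(2) d(2)] refined_by_trans[OF g(3) d(2)] by blast
qed

text \<open>A cover of the remainder is thickened to open sets of the compactification, shrunk
  there, and traced on \<open>X\<close>. Shrinking comes in because \<open>ext\<close> of a trace is
  controlled only by the closure of the set that is traced.\<close>

lemma remainder_covers_cofinal:
  assumes \<gamma>: "\<gamma> \<in> finite_open_covers (subtopology Z rest) (cl A - e ` A)" and A: "closedin X A"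
  shows "\<exists>\<alpha>\<in>border_covers X A. refined_by \<gamma> (remainder_family \<alpha>)"
proof -
  have "finite_open_family (subtopology Z rest) \<gamma>"
    and cover: "(\<Union>v\<in>index \<gamma>. member \<gamma> v) = topspace (subtopology Z rest)"
    and subcover: "cl A - e ` A \<subseteq> (\<Union>v\<in>subindex \<gamma>. member \<gamma> v)"
    using \<gamma> by (auto simp: finite_open_covers_def)
  note fam = finite_open_familyD[OF this(1)]
  have top: "topspace (subtopology Z rest) = rest" unfolding rest_def by auto
  have "\<exists>W. openin Z W \<and> member \<gamma> v = W \<inter> rest" if "v \<in> index \<gamma>" for v
    using fam(3)[OF that] by (simp add: openin_subtopology)
  then obtain W where W: "\<And>v. v \<in> index \<gamma> \<Longrightarrow> openin Z (W v)"
    "\<And>v. v \<in> index \<gamma> \<Longrightarrow> member \<gamma> v = W v \<inter> rest"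
    by metis
  \<comment> \<open>Collects the points where the thickened sets fail to cover the whole space, or
    the distinguished ones fail to cover the closure of \<open>A\<close>. Neither happens on the
    remainder, so \<open>C\<close> lies in the image of \<open>X\<close> and, being closed, comes
    from a compact set.\<close>
  define C where "C = (topspace Z - (\<Union>v\<in>index \<gamma>. W v)) \<union> (cl A - (\<Union>v\<in>subindex \<gamma>. W v))"
  have "openin Z (\<Union>v\<in>index \<gamma>. W v)" "openin Z (\<Union>v\<in>subindex \<gamma>. W v)"
    using W(1) fam(2) by (intro openin_Union; blast)+
  then have C: "closedin Z C"
    unfolding C_def by (intro closedin_Un closedin_diff) auto
  have in_W: "x \<in> (\<Union>v\<in>S. W v)" if "x \<in> (\<Union>v\<in>S. member \<gamma> v)" "S \<subseteq> index \<gamma>" for x S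
    using that W(2) by blast
  have C_space: "C \<subseteq> e ` topspace X"
  proof
    fix x assume x: "x \<in> C"
    have xZ: "x \<in> topspace Z" using closedin_subset[OF C] x by blast
    show "x \<in> e ` topspace X"
    proof (rule ccontr)
      assume "x \<notin> e ` topspace X"
      then have r: "x \<in> rest" using xZ by (simp add: rest_def)
      then have "x \<in> (\<Union>v\<in>index \<gamma>. W v)" using cover top by (intro in_W) auto
      moreover have "x \<in> (\<Union>v\<in>subindex \<gamma>. W v)" if "x \<in> cl A"
      proof (rule in_W[OF _ fam(2)])
        have "x \<in> cl A - e ` A" using that r unfolding rest_closed[OF A] by blast
        then show "x \<in> (\<Union>v\<in>subindex \<gamma>. member \<gamma> v)" using subcover by blast
      qed
      ultimately show False using x unfolding C_def by blast
    qed
  qed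
  define K where "K = {x \<in> topspace X. e x \<in> C}"
  have K: "compactin X K" unfolding K_def by (rule compact_preimage[OF C C_space])
  have eK: "e ` K = C" using C_space unfolding K_def by auto
  define N where "N = subtopology Z (topspace Z - C)"
  have N: "normal_space N" "topspace N = topspace Z - C"
    using normal_space_complement_compact[OF K] unfolding eK N_def by auto
  have openN: "openin N (W v - C)" if "v \<in> index \<gamma>" for v
  proof -
    have "openin Z (topspace Z - C)" using C by blast
    moreover have "W v - C \<subseteq> topspace Z - C" using openin_subset[OF W(1)[OF that]] by blast
    ultimately show ?thesis
      unfolding N_def using openin_diff[OF W(1)[OF that] C] by (simp add: openin_open_subtopology)
  qed
  have "\<exists>V. (\<forall>v\<in>index \<gamma>. openin N (V v) \<and> N closure_of V v \<subseteq> W v - C) \<and> topspace N \<subseteq> (\<Union>v\<in>index \<gamma>. V v)"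
    using fam(1) openN closedin_topspace
  proof (rule normal_space_shrink_cover[OF N(1)])
    show "topspace N \<subseteq> (\<Union>v\<in>index \<gamma>. W v - C)" unfolding N(2) C_def by blast
  qed
  then obtain V where V: "\<And>v. v \<in> index \<gamma> \<Longrightarrow> openin N (V v)" "\<And>v. v \<in> index \<gamma> \<Longrightarrow> N closure_of V v \<subseteq> W v - C"
    "topspace N \<subseteq> (\<Union>v\<in>index \<gamma>. V v)" by blast
  have "closedin N (cl A - C)"
    unfolding N_def closedin_subtopology using closure_of_subset_topspace[of Z "e ` A"]
    by (intro exI[of _ "cl A"]) auto
  \<comment> \<open>A second shrinking for the distinguished members, because the first gives no
    control over how these cover the closure of \<open>A\<close>.\<close>
  from fam(4) _ this have "\<exists>V. (\<forall>v\<in>subindex \<gamma>. openin N (V v) \<and> N closure_of V v \<subseteq> W v - C) \<and> cl A - C \<subseteq> (\<Union>v\<in>subindex \<gamma>. V v)"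
  proof (rule normal_space_shrink_cover[OF N(1)])
    show "openin N (W v - C)" if "v \<in> subindex \<gamma>" for v using openN fam(2) that by blast
    show "cl A - C \<subseteq> (\<Union>v\<in>subindex \<gamma>. W v - C)" unfolding C_def by blast
  qed
  then obtain V' where V': "\<And>v. v \<in> subindex \<gamma> \<Longrightarrow> openin N (V' v)"
    "\<And>v. v \<in> subindex \<gamma> \<Longrightarrow> N closure_of V' v \<subseteq> W v - C"
    "cl A - C \<subseteq> (\<Union>v\<in>subindex \<gamma>. V' v)" by blast
  \<comment> \<open>The union of the two shrinkings serves both purposes, and its closure in
    \<open>N\<close> still lies in \<open>W v\<close>.\<close>
  define V'' where "V'' v = (if v \<in> subindex \<gamma> then V v \<union> V' v else V v)" for v
  have V'': "openin N (V'' v)" "N closure_of V'' v \<subseteq> W v" if "v \<in> index \<gamma>" for v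
    using V(1,2)[OF that] V'(1,2)[of v] unfolding V''_def by auto
  have V''Z: "openin Z (V'' v)" "V'' v \<inter> C = {}" if "v \<in> index \<gamma>" for v
  proof -
    have "openin Z (topspace Z - C)" using C by blast
    then have "openin Z (V'' v) \<and> V'' v \<subseteq> topspace Z - C"
      using V''(1)[OF that] unfolding N_def by (simp add: openin_open_subtopology)
    then show "openin Z (V'' v)" "V'' v \<inter> C = {}" by auto
  qed
  define \<alpha> where "\<alpha> = \<lparr>index = index \<gamma>, subindex = subindex \<gamma>,
    member = (\<lambda>v\<in>index \<gamma>. {x \<in> topspace X. e x \<in> V'' v})\<rparr>"
  have \<alpha>: "\<alpha> \<in> border_covers X A"
    unfolding border_covers_def
  proof (intro CollectI conjI exI[of _ K] K)
    show "finite_open_family X \<alpha>"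
      unfolding finite_open_family_def \<alpha>_def using fam(1,2) V''Z(1) by (auto intro: open_preimage)
    show "topspace X - K = (\<Union>v\<in>index \<alpha>. member \<alpha> v)"
    proof (intro equalityI subsetI)
      fix x assume x: "x \<in> topspace X - K"
      then have "e x \<in> topspace N" using image_subset[of "{x}"] unfolding N(2) K_def by auto
      then obtain v where "v \<in> index \<gamma>" "e x \<in> V'' v" using V(3) unfolding V''_def by auto
      then show "x \<in> (\<Union>v\<in>index \<alpha>. member \<alpha> v)" using x by (auto simp: \<alpha>_def)
    next
      fix x assume "x \<in> (\<Union>v\<in>index \<alpha>. member \<alpha> v)"
      then obtain v where "v \<in> index \<gamma>" "x \<in> topspace X" "e x \<in> V'' v" by (auto simp: \<alpha>_def)
      then show "x \<in> topspace X - K" using V''Z(2)[of v] unfolding K_def by auto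
    qed
    show "A - K \<subseteq> (\<Union>v\<in>subindex \<alpha>. member \<alpha> v)"
    proof
      fix x assume x: "x \<in> A - K"
      then have xX: "x \<in> topspace X" using closedin_subset[OF A] by blast
      have "e x \<in> cl A" using subset_cl[OF closedin_subset[OF A]] x by blast
      then have "e x \<in> cl A - C" using x xX unfolding K_def by blast
      then obtain v where "v \<in> subindex \<gamma>" "e x \<in> V' v" using V'(3) by blast
      then show "x \<in> (\<Union>v\<in>subindex \<alpha>. member \<alpha> v)"
        using xX fam(2) by (auto simp: \<alpha>_def V''_def intro!: bexI[of _ v])
    qed
  qed
  have "refinement_projection \<gamma> (remainder_family \<alpha>) id"
  proof (rule refinement_projectionI)
    fix v assume "v \<in> index (remainder_family \<alpha>)"
    then have v: "v \<in> index \<gamma>" by (simp add: \<alpha>_def)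
    let ?U = "{x \<in> topspace X. e x \<in> V'' v}"
    have "ext ?U \<subseteq> cl ?U" by (rule ext_subset_cl) blast
    also have "\<dots> \<subseteq> Z closure_of V'' v" by (intro closure_of_mono) blast
    finally have "ext ?U \<inter> rest \<subseteq> Z closure_of V'' v \<inter> rest" by blast
    \<comment> \<open>Closures are controlled in \<open>N\<close> only, which suffices because the
      remainder lies in \<open>N\<close>.\<close>
    moreover have "Z closure_of V'' v \<inter> (topspace Z - C) \<subseteq> N closure_of V'' v"
    proof -
      have "V'' v \<subseteq> topspace Z - C" using openin_subset[OF V''(1)[OF v]] unfolding N(2) .
      then have "(topspace Z - C) \<inter> V'' v = V'' v" by blast
      then show ?thesis unfolding N_def closure_of_subtopology by auto
    qed
    moreover have "rest \<subseteq> topspace Z - C" using C_space unfolding rest_def by blast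
    ultimately have "ext ?U \<inter> rest \<subseteq> W v \<inter> rest" using V''(2)[OF v] by blast
    then show "member (remainder_family \<alpha>) v \<subseteq> member \<gamma> (id v)"
      using v W(2)[OF v] by (simp add: \<alpha>_def)
  qed (auto simp: \<alpha>_def)
  then show ?thesis using \<alpha> unfolding refined_by_def by blast
qed

lemma finite_family_covers:
  "\<alpha> \<in> border_covers X A \<Longrightarrow> finite_family \<alpha>"
  "\<beta> \<in> finite_open_covers T B \<Longrightarrow> finite_family \<beta>"
  by (auto simp: border_covers_def finite_open_covers_def intro: finite_open_familyD)

text \<open>Each limit is compared with the one over \<open>nonvanishing_covers\<close>. In homology
  the isomorphisms are restrictions into that limit, in cohomology they start from it; so the border
  comparison is inverted in the first case and the remainder comparison in the second.\<close>

lemma remainder_iso: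
  assumes "closedin X A" "comm_group G"
  shows "nerve_homology_limit G n (finite_open_covers (subtopology Z rest) (cl A - e ` A)) (cl A - e ` A)
      \<cong> nerve_homology_limit G n (border_covers X A) A"
    and "nerve_cohomology_limit G n (finite_open_covers (subtopology Z rest) (cl A - e ` A)) (cl A - e ` A)
      \<cong> nerve_cohomology_limit G n (border_covers X A) A"
proof -
  have sub: "nonvanishing_covers A \<subseteq> border_covers X A" unfolding nonvanishing_covers_def by blast
  interpret comm_group G by fact
  interpret border: nerve_equivalence G "border_covers X A" A "nonvanishing_covers A" A id
  proof (unfold_locales, goal_cases)
    case 1 then show ?case by (rule finite_family_covers)
  next
    case 2 then show ?case using sub finite_family_covers by blast
  next
    case 3 then show ?case using nonvanishing_covers_directed assms(1) by blast
  next
    case 4 then show ?case using sub by auto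
  next
    case 5 then show ?case by simp
  next
    case 6 then show ?case using nonvanishing_covers_cofinal assms(1) by simp
  qed simp_all
  interpret rest: nerve_equivalence G "finite_open_covers (subtopology Z rest) (cl A - e ` A)"
    "cl A - e ` A" "nonvanishing_covers A" A remainder_family
  proof (unfold_locales, goal_cases)
    case 1 then show ?case by (rule finite_family_covers)
  next
    case 2 then show ?case using sub finite_family_covers by blast
  next
    case 3 then show ?case using nonvanishing_covers_directed assms(1) by blast
  next
    case 4 then show ?case using sub remainder_family_cover assms(1) by blast
  next
    case 5 then show ?case by (intro remainder_family_projection)
  next
    \<comment> \<open>Cofinality in two steps: a border cover first, then a nonvanishing cover
      refining it.\<close>
    case (6 \<gamma>)
    obtain \<alpha> where a: "\<alpha> \<in> border_covers X A" "refined_by \<gamma> (remainder_family \<alpha>)"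
      using remainder_covers_cofinal[OF 6 assms(1)] by blast
    obtain \<beta> where b: "\<beta> \<in> nonvanishing_covers A" "refined_by \<alpha> \<beta>"
      using nonvanishing_covers_cofinal[OF a(1) assms(1)] by blast
    have "refined_by (remainder_family \<alpha>) (remainder_family \<beta>)"
      using b(2) remainder_family_projection unfolding refined_by_def by blast
    then show ?case using b(1) refined_by_trans[OF a(2)] by blast
  next
    case 7 then show ?case using nerve_remainder_family(1) assms(1) by blast
  next
    case 8 then show ?case using nerve_remainder_family(2) assms(1) by blast
  qed
  have is_iso: "M \<cong> M'" if "\<exists>h. h \<in> iso M M'" for M M' using that by (auto simp: is_iso_def)
  have trans: "M \<cong> M''" if "M \<cong> M'" "M' \<cong> M''" for M M' M''
    using that iso_set_trans unfolding is_iso_def by blast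
  show "nerve_homology_limit G n (finite_open_covers (subtopology Z rest) (cl A - e ` A)) (cl A - e ` A)
      \<cong> nerve_homology_limit G n (border_covers X A) A"
    by (rule trans[OF is_iso[OF rest.homology_iso] is_iso_sym_closed[OF is_iso[OF border.homology_iso]]])
      (rule border.homology_closed)
  show "nerve_cohomology_limit G n (finite_open_covers (subtopology Z rest) (cl A - e ` A)) (cl A - e ` A)
      \<cong> nerve_cohomology_limit G n (border_covers X A) A"
    by (rule trans[OF is_iso_sym_closed[OF is_iso[OF rest.cohomology_iso]] is_iso[OF border.cohomology_iso]])
      (rule rest.cohomology_closed_source)
qed

end

section \<open>The Stone-Cech compactification of a metrizable space\<close>

text \<open>The standard cube embedding is indexed by a metric space of bounded continuous
  functions; boundedness here follows from the values lying in the unit interval.\<close>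

lemma unit_functions_eq_mspace:
  "unit_functions X = mspace (submetric (cfunspace X euclidean_metric) {f. f \<in> topspace X \<rightarrow> {0..1}})"
proof -
  have "Metric_space.mbounded UNIV dist (f ` topspace X)" if "f \<in> topspace X \<rightarrow> {0..1}"
    for f :: "'a \<Rightarrow> real"
  proof -
    have "bounded (f ` topspace X)"
      using that by (intro bounded_subset[OF bounded_closed_interval[of 0 1]]) auto
    then show ?thesis by (simp add: mbounded_iff_bounded)
  qed
  then show ?thesis
    unfolding unit_functions_def by (auto simp: continuous_map_in_subtopology)
qed

lemma topspace_stone_cech:
  "topspace (stone_cech X) = unit_cube X closure_of (stone_cech_map X ` topspace X)"
  unfolding stone_cech_def using closure_of_subset_topspace by fastforce

lemma stone_cech_map_in_cube: "stone_cech_map X ` topspace X \<subseteq> topspace (unit_cube X)"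
proof (rule image_subsetI)
  fix x assume x: "x \<in> topspace X"
  have "f x \<in> {0..1}" if "f \<in> unit_functions X" for f
  proof -
    have "f ` topspace X \<subseteq> topspace (top_of_set {0..1})"
      using that unfolding unit_functions_def by (intro continuous_map_image_subset_topspace) blast
    then show ?thesis using x by force
  qed
  then show "stone_cech_map X x \<in> topspace (unit_cube X)"
    by (simp add: stone_cech_map_def unit_cube_def)
qed

text \<open>The coordinate \<open>f\<close> is the continuous extension of the function
  \<open>f\<close> to the compactification, so a closed condition on its values passes to
  closures.\<close>

lemma stone_cech_closed_coordinate:
  assumes "f \<in> unit_functions X" "closed S" "f ` F \<subseteq> S" "F \<subseteq> topspace X"
    and "z \<in> stone_cech X closure_of (stone_cech_map X ` F)"
  shows "z f \<in> S"
proof -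
  have "continuous_map (unit_cube X) (top_of_set {0..1}) (\<lambda>z. z f)"
    unfolding unit_cube_def using assms(1) by (rule continuous_map_product_projection)
  then have "continuous_map (stone_cech X) euclideanreal (\<lambda>z. z f)"
    unfolding stone_cech_def
    by (intro continuous_map_from_subtopology) (simp add: continuous_map_in_subtopology)
  then have "closedin (stone_cech X) {z \<in> topspace (stone_cech X). z f \<in> S}"
    using assms(2) by (intro closedin_continuous_map_preimage) auto
  moreover have "stone_cech_map X ` F \<subseteq> {z \<in> topspace (stone_cech X). z f \<in> S}"
    using assms(1,3,4) closure_of_subset[OF stone_cech_map_in_cube[of X]]
    by (auto simp: topspace_stone_cech stone_cech_map_def)
  ultimately show ?thesis using closure_of_minimal assms(5) by blast
qed

text \<open>Disjoint closed sets are separated by a Urysohn function. It is a coordinate of the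
  cube, which is 0 on one closure and 1 on the other.\<close>

lemma stone_cech_compactification:
  assumes "metrizable_space X"
  shows "metrizable_compactification X (stone_cech X) (stone_cech_map X)"
proof
  have normal: "normal_space X" and H: "Hausdorff_space X"
    using assms by (auto intro: metrizable_imp_normal_space metrizable_imp_Hausdorff_space)
  then have cr: "completely_regular_space X"
    using assms metrizable_imp_completely_regular_space by blast
  have unit: "compact_space (top_of_set {0..1::real})" "Hausdorff_space (top_of_set {0..1::real})"
    by (auto simp: compact_space_subtopology Hausdorff_space_subtopology)
  have cube: "compact_space (unit_cube X)" "Hausdorff_space (unit_cube X)"
    unfolding unit_cube_def using unit
    by (simp_all add: compact_space_product_topology Hausdorff_space_product_topology)
  show "compact_space (stone_cech X)"
    unfolding stone_cech_def
    by (intro compact_space_subtopology closedin_compact_space[OF cube(1)]) simp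
  show "Hausdorff_space (stone_cech X)"
    unfolding stone_cech_def by (intro Hausdorff_space_subtopology cube(2))
  have "embedding_map X (unit_cube X) (stone_cech_map X)"
    using completely_regular_space_cube_embedding_explicit[OF cr H]
    unfolding unit_functions_eq_mspace[symmetric] unit_cube_def stone_cech_map_def[abs_def] .
  then show "embedding_map X (stone_cech X) (stone_cech_map X)"
    unfolding stone_cech_def embedding_map_in_subtopology
    using closure_of_subset[OF stone_cech_map_in_cube] by (rule conjI)
  show "stone_cech X closure_of (stone_cech_map X ` topspace X) = topspace (stone_cech X)"
    using closure_of_subset[OF stone_cech_map_in_cube[of X]]
    unfolding topspace_stone_cech unfolding stone_cech_def closure_of_subtopology
    by (simp add: Int_absorb1)
  show "stone_cech X closure_of (stone_cech_map X ` F) \<inter> stone_cech X closure_of (stone_cech_map X ` F') = {}"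
    if F: "closedin X F" and F': "closedin X F'" and disj: "F \<inter> F' = {}" for F F'
  proof -
    obtain f :: "'a \<Rightarrow> real" where f: "continuous_map X (top_of_set {0..1}) f" "f ` F \<subseteq> {0}" "f ` F' \<subseteq> {1}"
      using normal F F' disj unfolding normal_space_iff_Urysohn disjnt_def by metis
    \<comment> \<open>The coordinates are extensional functions, so the Urysohn function is
      restricted in order to be one of them.\<close>
    define g where "g = restrict f (topspace X)"
    have "continuous_map X (top_of_set {0..1}) g"
      using f(1) by (rule continuous_map_eq) (simp add: g_def)
    then have g: "g \<in> unit_functions X" by (simp add: unit_functions_def g_def)
    have FX: "F \<subseteq> topspace X" "F' \<subseteq> topspace X" using F F' by (auto dest: closedin_subset)
    then have g01: "g ` F \<subseteq> {0}" "g ` F' \<subseteq> {1}" using f(2,3) by (auto simp: g_def)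
    have "z g \<in> {0} \<and> z g \<in> {1}"
      if "z \<in> stone_cech X closure_of (stone_cech_map X ` F)"
        "z \<in> stone_cech X closure_of (stone_cech_map X ` F')" for z
      using stone_cech_closed_coordinate[OF g closed_singleton g01(1) FX(1) that(1)]
        stone_cech_closed_coordinate[OF g closed_singleton g01(2) FX(2) that(2)] by blast
    then show ?thesis by force
  qed
qed (rule assms)

theorem theorem2p1:
  fixes X :: "'a topology" and A :: "'a set" and G :: "('g, 'm) monoid_scheme" and n :: nat
  assumes "metrizable_space X"
    and "closedin X A"
    and "comm_group G"
  shows "finite_cech_homology G n (remainder X) (remainder_of X A) \<cong> border_homology G n X A \<and>
         finite_cech_cohomology G n (remainder X) (remainder_of X A) \<cong> border_cohomology G n X A"
proof -
  interpret metrizable_compactification X "stone_cech X" "stone_cech_map X"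
    using assms(1) by (rule stone_cech_compactification)
  show ?thesis
    using remainder_iso[OF assms(2,3), of n]
    by (simp add: finite_cech_homology_def border_homology_def finite_cech_cohomology_def
        border_cohomology_def remainder_def remainder_of_def rest_def)
qed

end
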